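(* Let $M$ and $N$ be closed manifolds, $(N,\gamma)$ Riemannian. Let $(g(t),\phi(t))_{t\in[0,T)}$ be a smooth solution of the $(RH)_\alpha$ flow with a non-increasing coupling function $\alpha(t)$ satisfying $\alpha(t)\ge\underline{\alpha}>0$ for all $t\in[0,T)$. Suppose that $|\nabla\phi|^2(x_k,t_k)\to\infty$ for a sequence $(x_k,t_k)_{k\in\mathbb{N}}$ in $M\times[0,T)$ with $t_k\nearrow T$. Then also the scalar curvature satisfies $R(x_k,t_k)\to\infty$ for this sequence, and thus $g(t_k)$ must become singular as $t_k$ approaches $T$.
   Context: $(g(t),\phi(t))$, with $g(t)$ Riemannian metrics on $M$ and $\phi(t):M\to N$ smooth maps, solves $(RH)_\alpha$ with coupling function $\alpha(t)$ (smooth in $t$) if $$\partial_t g=-2\,\mathrm{Rc}+2\alpha\,\nabla\phi\otimes\nabla\phi,\qquad \partial_t\phi=\tau_g\phi ,$$ where $\mathrm{Rc}$ is the Ricci tensor of $g(t)$, $(\nabla\phi\otimes\nabla\phi)_{ij}=\langle\nabla_i\phi,\nabla_j\phi\rangle_\gamma$, and $\tau_g\phi=\mathrm{tr}_g\nabla d\phi$ is the tension field. $|\nabla\phi|^2(x,t)=g^{ij}\langle\nabla_i\phi,\nabla_j\phi\rangle_\gamma$ and $R(x,t)$ is the scalar curvature, both computed with $g(t)$ at $x$. That $g(t_k)$ becomes singular means that its curvature is unbounded along the sequence. *)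

theory Defs
  imports "HOL-Analysis.Analysis"
begin

section \<open>Smooth functions\<close>

text \<open>
  The set \<open>S\<close> need not be open: it is also used for relatively open subsets of
  \<open>[0,T) \<times> \<real>\<^sup>m\<close>. Derivatives are taken within \<open>S\<close>, hence are one-sided in time at \<open>t = 0\<close>;
  on such sets, as on open sets, the derivative within \<open>S\<close> is unique.
\<close>

primrec Ck_on :: "nat \<Rightarrow> 'a::euclidean_space set \<Rightarrow> ('a \<Rightarrow> 'b::real_normed_vector) \<Rightarrow> bool" where
  "Ck_on 0 S f \<longleftrightarrow> continuous_on S f"
| "Ck_on (Suc k) S f \<longleftrightarrow> f differentiable_on S \<and>
     (\<forall>b\<in>Basis. Ck_on k S (\<lambda>x. frechet_derivative f (at x within S) b))"

definition smooth_on :: "'a::euclidean_space set \<Rightarrow> ('a \<Rightarrow> 'b::real_normed_vector) \<Rightarrow> bool" where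
  "smooth_on S f \<longleftrightarrow> (\<forall>k. Ck_on k S f)"

definition pd :: "'m \<Rightarrow> (real^'m::finite \<Rightarrow> real) \<Rightarrow> real^'m \<Rightarrow> real" where
  "pd i f u = frechet_derivative f (at u) (axis i 1)"


section \<open>Closed manifolds\<close>

text \<open>
  A manifold is a whole type \<open>'p\<close> of points together with a smooth atlas, which need not be
  maximal. A chart is a pair of its domain and its coordinate map; the values of the coordinate
  map outside of the domain are irrelevant.
\<close>

type_synonym ('p, 'm) chart = "'p set \<times> ('p \<Rightarrow> real^'m)"

abbreviation cdom :: "('p, 'm::finite) chart \<Rightarrow> 'p set" where
  "cdom c \<equiv> fst c"

abbreviation cmap :: "('p, 'm::finite) chart \<Rightarrow> 'p \<Rightarrow> real^'m" where
  "cmap c \<equiv> snd c"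

abbreviation cran :: "('p, 'm::finite) chart \<Rightarrow> (real^'m) set" where
  "cran c \<equiv> cmap c ` cdom c"

definition cinv :: "('p, 'm::finite) chart \<Rightarrow> real^'m \<Rightarrow> 'p" where
  "cinv c = inv_into (cdom c) (cmap c)"

definition is_chart :: "('p::topological_space, 'm::finite) chart \<Rightarrow> bool" where
  "is_chart c \<longleftrightarrow> open (cdom c) \<and> open (cran c) \<and>
     homeomorphism (cdom c) (cran c) (cmap c) (cinv c)"

definition smooth_atlas :: "('p::topological_space, 'm::finite) chart set \<Rightarrow> bool" where
  "smooth_atlas A \<longleftrightarrow> (\<forall>c\<in>A. is_chart c) \<and> (\<Union>c\<in>A. cdom c) = UNIV \<and>
     (\<forall>c\<in>A. \<forall>d\<in>A. smooth_on (cmap c ` (cdom c \<inter> cdom d)) (cmap d \<circ> cinv c))"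

text \<open>
  The charts have open images in \<open>\<real>\<^sup>m\<close>, so there is no boundary. Second countability follows from
  compactness.
\<close>

definition closed_manifold :: "('p::t2_space, 'm::finite) chart set \<Rightarrow> bool" where
  "closed_manifold A \<longleftrightarrow> smooth_atlas A \<and> compact (UNIV :: 'p set)"

definition chart_at :: "('p, 'm::finite) chart set \<Rightarrow> 'p \<Rightarrow> ('p, 'm) chart" where
  "chart_at A p = (SOME c. c \<in> A \<and> p \<in> cdom c)"


section \<open>Riemannian metrics\<close>

text \<open>
  A metric is given by its component matrix in each chart, as a function of the coordinates,
  subject to the transformation law of a covariant 2-tensor.
\<close>

type_synonym ('p, 'm) metric = "('p, 'm) chart \<Rightarrow> real^'m \<Rightarrow> real^'m^'m"

definition riemannian_metric ::
    "('p, 'm::finite) chart set \<Rightarrow> ('p, 'm) metric \<Rightarrow> bool" where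
  "riemannian_metric A g \<longleftrightarrow>
     (\<forall>c\<in>A. smooth_on (cran c) (g c)) \<and>
     (\<forall>c\<in>A. \<forall>u\<in>cran c. transpose (g c u) = g c u \<and> (\<forall>v. v \<noteq> 0 \<longrightarrow> v \<bullet> (g c u *v v) > 0)) \<and>
     (\<forall>c\<in>A. \<forall>d\<in>A. \<forall>p\<in>cdom c \<inter> cdom d.
        let J = jacobian (cmap d \<circ> cinv c) (at (cmap c p))
        in g c (cmap c p) = transpose J ** g d (cmap d p) ** J)"


section \<open>Curvature in local coordinates\<close>

text \<open>
  Here \<open>h\<close> is the component matrix of a metric in a fixed chart.
  \<open>christoffel h k i j\<close> is \<open>\<Gamma>\<^sup>k\<^sub>i\<^sub>j\<close>.
\<close>

definition christoffel ::
    "(real^'m \<Rightarrow> real^'m^'m) \<Rightarrow> 'm \<Rightarrow> 'm \<Rightarrow> 'm \<Rightarrow> real^'m::finite \<Rightarrow> real" where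
  "christoffel h k i j u =
     (\<Sum>l\<in>UNIV. matrix_inv (h u) $ k $ l *
        (pd i (\<lambda>w. h w $ j $ l) u + pd j (\<lambda>w. h w $ i $ l) u - pd l (\<lambda>w. h w $ i $ j) u)) / 2"

text \<open>
  Convention: \<open>R(\<partial>\<^sub>i,\<partial>\<^sub>j)\<partial>\<^sub>k = \<Sum>\<^sub>l riemann h l i j k \<partial>\<^sub>l\<close> with
  \<open>R(X,Y)Z = \<nabla>\<^sub>X\<nabla>\<^sub>YZ - \<nabla>\<^sub>Y\<nabla>\<^sub>XZ - \<nabla>\<^bsub>[X,Y]\<^esub>Z\<close>; the Ricci tensor is the trace of \<open>X \<mapsto> R(X,Y)Z\<close>,
  so that round spheres have positive Ricci and scalar curvature.
\<close>

definition riemann ::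
    "(real^'m \<Rightarrow> real^'m^'m) \<Rightarrow> 'm \<Rightarrow> 'm \<Rightarrow> 'm \<Rightarrow> 'm \<Rightarrow> real^'m::finite \<Rightarrow> real" where
  "riemann h l i j k u =
     pd i (christoffel h l j k) u - pd j (christoffel h l i k) u
     + (\<Sum>n\<in>UNIV. christoffel h l i n u * christoffel h n j k u
                 - christoffel h l j n u * christoffel h n i k u)"

definition ricci :: "(real^'m \<Rightarrow> real^'m^'m) \<Rightarrow> real^'m::finite \<Rightarrow> real^'m^'m" where
  "ricci h u = (\<chi> j k. \<Sum>i\<in>UNIV. riemann h i i j k u)"

definition metric_trace :: "real^'m^'m \<Rightarrow> real^'m^'m \<Rightarrow> real" where
  "metric_trace G b = (\<Sum>i\<in>UNIV. \<Sum>j\<in>UNIV. matrix_inv G $ i $ j * b $ i $ j)"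

definition local_scalar :: "(real^'m \<Rightarrow> real^'m^'m) \<Rightarrow> real^'m::finite \<Rightarrow> real" where
  "local_scalar h u = metric_trace (h u) (ricci h u)"

definition local_riemann_norm :: "(real^'m \<Rightarrow> real^'m^'m) \<Rightarrow> real^'m::finite \<Rightarrow> real" where
  "local_riemann_norm h u = sqrt
     (\<Sum>l\<in>UNIV. \<Sum>i\<in>UNIV. \<Sum>j\<in>UNIV. \<Sum>k\<in>UNIV. \<Sum>l'\<in>UNIV. \<Sum>i'\<in>UNIV. \<Sum>j'\<in>UNIV. \<Sum>k'\<in>UNIV.
        h u $ l $ l' * matrix_inv (h u) $ i $ i' * matrix_inv (h u) $ j $ j'
        * matrix_inv (h u) $ k $ k' * riemann h l i j k u * riemann h l' i' j' k' u)"

text \<open>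
  Both of the following are independent of the chart around \<open>p\<close>.
\<close>

definition scalar_curvature ::
    "('p, 'm::finite) chart set \<Rightarrow> ('p, 'm) metric \<Rightarrow> 'p \<Rightarrow> real" where
  "scalar_curvature A g p =
     (let c = chart_at A p in local_scalar (g c) (cmap c p))"

definition riemann_norm ::
    "('p, 'm::finite) chart set \<Rightarrow> ('p, 'm) metric \<Rightarrow> 'p \<Rightarrow> real" where
  "riemann_norm A g p =
     (let c = chart_at A p in local_riemann_norm (g c) (cmap c p))"


section \<open>Maps between Riemannian manifolds\<close>

definition local_rep ::
    "('p, 'm::finite) chart \<Rightarrow> ('q, 'n::finite) chart \<Rightarrow> ('p \<Rightarrow> 'q) \<Rightarrow> real^'m \<Rightarrow> real^'n" where
  "local_rep c d \<phi> u = cmap d (\<phi> (cinv c u))"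

text \<open>
  \<open>grad_tensor k f u $ i $ j\<close> is \<open>\<langle>\<nabla>\<^sub>i\<phi>,\<nabla>\<^sub>j\<phi>\<rangle>\<close>, where \<open>f\<close> is the local representation of \<open>\<phi>\<close>
  and \<open>k\<close> the local representation of the metric of the target.
\<close>

definition grad_tensor ::
    "(real^'n \<Rightarrow> real^'n^'n) \<Rightarrow> (real^'m \<Rightarrow> real^'n::finite) \<Rightarrow> real^'m::finite \<Rightarrow> real^'m^'m" where
  "grad_tensor k f u = (\<chi> i j. \<Sum>a\<in>UNIV. \<Sum>b\<in>UNIV.
     k (f u) $ a $ b * pd i (\<lambda>w. f w $ a) u * pd j (\<lambda>w. f w $ b) u)"

definition second_fundamental ::
    "(real^'m \<Rightarrow> real^'m^'m) \<Rightarrow> (real^'n \<Rightarrow> real^'n^'n) \<Rightarrow>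
     (real^'m \<Rightarrow> real^'n::finite) \<Rightarrow> 'n \<Rightarrow> real^'m::finite \<Rightarrow> real^'m^'m" where
  \<comment> \<open>the component \<open>a\<close> of \<open>\<nabla>d\<phi>\<close>, for the connection on \<open>T*M \<otimes> \<phi>*TN\<close>\<close>
  "second_fundamental h k f a u = (\<chi> i j.
     pd i (\<lambda>v. pd j (\<lambda>w. f w $ a) v) u
     - (\<Sum>l\<in>UNIV. christoffel h l i j u * pd l (\<lambda>w. f w $ a) u)
     + (\<Sum>b\<in>UNIV. \<Sum>c\<in>UNIV. christoffel k a b c (f u)
          * pd i (\<lambda>w. f w $ b) u * pd j (\<lambda>w. f w $ c) u))"

definition tension ::
    "(real^'m \<Rightarrow> real^'m^'m) \<Rightarrow> (real^'n \<Rightarrow> real^'n^'n) \<Rightarrow>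
     (real^'m \<Rightarrow> real^'n::finite) \<Rightarrow> real^'m::finite \<Rightarrow> real^'n" where
  "tension h k f u = (\<chi> a. metric_trace (h u) (second_fundamental h k f a u))"

text \<open>The function \<open>|\<nabla>\<phi>|\<^sup>2\<close>; again independent of the charts around \<open>p\<close> and \<open>\<phi> p\<close>.\<close>

definition grad_norm_sq ::
    "('p, 'm::finite) chart set \<Rightarrow> ('q, 'n::finite) chart set \<Rightarrow> ('q, 'n) metric \<Rightarrow>
     ('p, 'm) metric \<Rightarrow> ('p \<Rightarrow> 'q) \<Rightarrow> 'p \<Rightarrow> real" where
  "grad_norm_sq A B \<gamma> g \<phi> p =
     (let c = chart_at A p; d = chart_at B (\<phi> p)
      in metric_trace (g c (cmap c p)) (grad_tensor (\<gamma> d) (local_rep c d \<phi>) (cmap c p)))"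


section \<open>The flow\<close>

definition smooth_metric_family ::
    "('p, 'm::finite) chart set \<Rightarrow> real set \<Rightarrow> (real \<Rightarrow> ('p, 'm) metric) \<Rightarrow> bool" where
  "smooth_metric_family A I g \<longleftrightarrow> (\<forall>t\<in>I. riemannian_metric A (g t)) \<and>
     (\<forall>c\<in>A. smooth_on (I \<times> cran c) (\<lambda>(t, u). g t c u))"

definition smooth_map_family ::
    "('p::topological_space, 'm::finite) chart set \<Rightarrow> ('q::topological_space, 'n::finite) chart set \<Rightarrow>
     real set \<Rightarrow> (real \<Rightarrow> 'p \<Rightarrow> 'q) \<Rightarrow> bool" where
  "smooth_map_family A B I \<phi> \<longleftrightarrow>
     continuous_on (I \<times> UNIV) (\<lambda>(t, p). \<phi> t p) \<and>
     (\<forall>c\<in>A. \<forall>d\<in>B. smooth_on {(t, u). t \<in> I \<and> u \<in> cran c \<and> \<phi> t (cinv c u) \<in> cdom d}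
        (\<lambda>(t, u). local_rep c d (\<phi> t) u))"

definition RH_flow ::
    "('p::topological_space, 'm::finite) chart set \<Rightarrow> ('q::topological_space, 'n::finite) chart set \<Rightarrow>
     ('q, 'n) metric \<Rightarrow> real set \<Rightarrow> (real \<Rightarrow> real) \<Rightarrow>
     (real \<Rightarrow> ('p, 'm) metric) \<Rightarrow> (real \<Rightarrow> 'p \<Rightarrow> 'q) \<Rightarrow> bool" where
  "RH_flow A B \<gamma> I \<alpha> g \<phi> \<longleftrightarrow>
     smooth_on I \<alpha> \<and> smooth_metric_family A I g \<and> smooth_map_family A B I \<phi> \<and>
     (\<forall>c\<in>A. \<forall>d\<in>B. \<forall>t\<in>I. \<forall>u\<in>cran c. \<phi> t (cinv c u) \<in> cdom d \<longrightarrow>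
        ((\<lambda>s. g s c u) has_vector_derivative
           (- 2) *\<^sub>R ricci (g t c) u
           + (2 * \<alpha> t) *\<^sub>R grad_tensor (\<gamma> d) (local_rep c d (\<phi> t)) u) (at t within I) \<and>
        ((\<lambda>s. local_rep c d (\<phi> s) u) has_vector_derivative
           tension (g t c) (\<gamma> d) (local_rep c d (\<phi> t)) u) (at t within I))"

text \<open>The interval \<open>[0,T)\<close>, where \<open>T\<close> may be infinite.\<close>

definition time_interval :: "ereal \<Rightarrow> real set" where
  "time_interval T = {t. 0 \<le> t \<and> ereal t < T}"

end

theory Submission
  imports Defs
begin

text \<open>
  Put \<open>S\<^sub>i\<^sub>j = R\<^sub>i\<^sub>j - \<alpha> \<langle>\<nabla>\<^sub>i\<phi>,\<nabla>\<^sub>j\<phi>\<rangle>\<close>, so that the flow reads \<open>\<partial>\<^sub>t g = - 2 S\<^sub>i\<^sub>j\<close>, and let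
  \<open>S = R - \<alpha> \<bar>\<nabla>\<phi>\<bar>\<^sup>2\<close> be its trace. The contracted Bianchi identity, the variation formula for the Ricci
  tensor and the divergence formula for the stress-energy tensor of \<open>\<phi>\<close> combine to
  \<open>\<partial>\<^sub>t S = \<Delta>S + 2 \<bar>S\<^sub>i\<^sub>j\<bar>\<^sup>2 + 2 \<alpha> \<bar>\<tau>\<phi>\<bar>\<^sup>2 - \<alpha>' \<bar>\<nabla>\<phi>\<bar>\<^sup>2\<close>. As \<open>\<alpha> > 0\<close> and \<open>\<alpha>' \<le> 0\<close>, the
  minimum principle bounds \<open>S\<close> from below by its initial minimum \<open>C\<close>, whence
  \<open>R \<ge> C + \<alpha> \<bar>\<nabla>\<phi>\<bar>\<^sup>2\<close>. The evolution equation is an identity between iterated partial derivatives;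
  it is computed in an arbitrary commutative ring with commuting derivations and then
  specialised to germs of smooth functions of time and space.
\<close>

section \<open>Curvature in a commutative ring with derivations\<close>

text \<open>Two obstacles shape the proof. The equation for \<open>S\<close> contains fourth spatial
  derivatives of \<open>g\<close>, and identities such as the flow equations have to be
  differentiated, so equality at a point is too weak. Germs are the objects on which equality
  survives differentiation and which still form a commutative ring with commuting derivations;
  evaluation at the base point returns to numbers at the very end. The second obstacle is the
  curvature of \<open>N\<close>, which enters the usual computation through the Bochner formula for
  |\<nabla>\<phi>|^2 and cancels only at the end. It never arises here: the trace of the variation
  of \<open>Rc\<close> is the divergence of a vector field, this field equals grad S + 2 \<alpha>
  <\<tau>, \<nabla>\<phi>>, and the part 2 \<alpha> <\<nabla>\<phi>, \<nabla>\<tau>> of its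
  divergence is exactly what the variation of \<alpha> <\<nabla>\<phi>, \<nabla>\<phi>> removes.
  Only compatibility and symmetry of the target connection are used. The resulting differential
  inequality is weak, so the minimum principle is run for \<open>S\<close> plus a small positive
  multiple of time.\<close>

lemma matrix_add_rdistrib': "(A + B) ** C = A ** C + B ** (C::'a::semiring_1^'k^'n)"
  by (vector matrix_matrix_mult_def sum.distrib[symmetric] field_simps)

lemma matrix_neg_left: "(- A) ** C = - (A ** (C::'a::ring_1^'k^'n))"
  by (vector matrix_matrix_mult_def sum_negf)

lemma matrix_neg_right: "A ** (- C) = - (A ** (C::'a::ring_1^'k^'n))"
  by (vector matrix_matrix_mult_def sum_negf)

lemma matrix_diff_ldistrib: "A ** (B - C) = A ** B - A ** (C::'a::ring_1^'k^'n)"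
  by (vector matrix_matrix_mult_def sum_subtractf[symmetric] right_diff_distrib)

lemma matrix_diff_rdistrib: "(A - B) ** C = A ** C - B ** (C::'a::ring_1^'k^'n)"
  by (vector matrix_matrix_mult_def sum_subtractf[symmetric] left_diff_distrib)

lemma trace_neg: "trace (- A) = - trace (A::'a::ring_1^'n^'n)"
  by (simp add: trace_def sum_negf)

lemma transpose_add: "transpose (A + B) = transpose A + transpose (B::'a::ring_1^'k^'n)"
  by (vector transpose_def)

lemma transpose_diff: "transpose (A - B) = transpose A - transpose (B::'a::ring_1^'k^'n)"
  by (vector transpose_def)

lemma transpose_neg: "transpose (- A) = - transpose (A::'a::ring_1^'k^'n)"
  by (vector transpose_def)

text \<open>A normal form for matrix expressions: signed sums of left-associated products, in which
  commutator identities cancel term by term.\<close>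

lemmas matrix_ring_simps = matrix_add_ldistrib matrix_add_rdistrib' matrix_neg_left matrix_neg_right
  matrix_diff_ldistrib matrix_diff_rdistrib matrix_mul_assoc transpose_add transpose_diff transpose_neg

lemma sum_swap23:
  "(\<Sum>i\<in>A. \<Sum>j\<in>B. \<Sum>k\<in>C. F i j k) = (\<Sum>i\<in>A. \<Sum>k\<in>C. \<Sum>j\<in>B. F i j k)"
  by (intro sum.cong refl sum.swap)

lemma sum_rot3:
  "(\<Sum>i\<in>A. \<Sum>j\<in>B. \<Sum>k\<in>C. F i j k) = (\<Sum>j\<in>B. \<Sum>k\<in>C. \<Sum>i\<in>A. F i j k)"
  by (rule trans[OF sum.swap]) (intro sum.cong refl sum.swap)

lemma sum_rot3':
  "(\<Sum>i\<in>A. \<Sum>j\<in>B. \<Sum>k\<in>C. F i j k) = (\<Sum>k\<in>C. \<Sum>i\<in>A. \<Sum>j\<in>B. F i j k)"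
  by (rule sum_rot3[symmetric])

lemma sum_swap13:
  "(\<Sum>i\<in>A. \<Sum>j\<in>B. \<Sum>k\<in>C. F i j k) = (\<Sum>k\<in>C. \<Sum>j\<in>B. \<Sum>i\<in>A. F i j k)"
  by (rule trans[OF sum_rot3]) (rule sum.swap)

definition dotp :: "'a::comm_ring_1^'n \<Rightarrow> 'a^'n \<Rightarrow> 'a" where
  "dotp V W = (\<Sum>a\<in>UNIV. V $ a * W $ a)"

lemma dotp_add: "dotp (V + V') W = dotp V W + dotp V' W" "dotp V (W + W') = dotp V W + dotp V W'"
  by (simp_all add: dotp_def algebra_simps sum.distrib)

lemma dotp_transpose: "dotp V (transpose A *v W) = dotp (A *v V) W"
  by (simp add: dotp_def transpose_def matrix_vector_mult_def sum_distrib_left sum_distrib_right mult_ac)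
    (rule sum.swap)

lemma dotp_commute: "dotp V W = dotp W V"
  by (simp add: dotp_def mult.commute)

lemma dotp_scale: "dotp (c *s V) W = c * dotp V W"
  by (simp add: dotp_def sum_distrib_left mult.assoc)

lemma dotp_sum: "dotp (\<Sum>i\<in>X. V i) W = (\<Sum>i\<in>X. dotp (V i) W)"
  by (induction X rule: infinite_finite_induct) (simp_all add: dotp_add, simp_all add: dotp_def)

lemma dotp_diff: "dotp (V - V') W = dotp V W - dotp V' W"
  by (simp add: dotp_def algebra_simps sum_subtractf)

lemma matrix_vector_mult_add_rdistrib': "(A + B) *v V = A *v V + B *v (V::'a::comm_ring_1^'n)"
  by (simp add: vec_eq_iff matrix_vector_mult_def algebra_simps sum.distrib)

section \<open>Derivations acting entrywise on matrices and vectors\<close>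

locale derivation =
  fixes d :: "'a::comm_ring_1 \<Rightarrow> 'a"
  assumes add: "d (x + y) = d x + d y"
    and mult: "d (x * y) = d x * y + x * d y"
begin

lemma zero [simp]: "d 0 = 0"
  using add[of 0 0] by simp

lemma one [simp]: "d 1 = 0"
  using mult[of 1 1] by simp

lemma minus: "d (- x) = - d x"
  using add[of x "- x"] by (simp add: eq_neg_iff_add_eq_0 add.commute)

lemma diff: "d (x - y) = d x - d y"
  using add[of x "- y"] by (simp add: minus)

lemma sum: "d (sum f X) = (\<Sum>i\<in>X. d (f i))"
  by (induction X rule: infinite_finite_induct) (simp_all add: add)

lemmas rules = add mult minus diff sum

definition mat_d :: "'a^'n^'m \<Rightarrow> 'a^'n^'m" where
  "mat_d A = (\<chi> i j. d (A $ i $ j))"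

lemma mat_d_nth [simp]: "mat_d A $ i $ j = d (A $ i $ j)"
  by (simp add: mat_d_def)

lemma mat_d_mult: "mat_d (A ** B) = mat_d A ** B + A ** mat_d B"
  by (simp add: vec_eq_iff matrix_matrix_mult_def rules sum.distrib)

lemma mat_d_add: "mat_d (A + B) = mat_d A + mat_d B"
  by (simp add: vec_eq_iff rules)

lemma mat_d_diff: "mat_d (A - B) = mat_d A - mat_d B"
  by (simp add: vec_eq_iff rules)

lemma mat_d_neg: "mat_d (- A) = - mat_d A"
  by (simp add: vec_eq_iff rules)

lemma mat_d_transpose: "mat_d (transpose A) = transpose (mat_d A)"
  by (simp add: vec_eq_iff transpose_def)

lemma mat_d_mat [simp]: "mat_d (mat 1) = 0"
  by (simp add: vec_eq_iff mat_def)

lemma trace_mat_d: "d (trace A) = trace (mat_d A)"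
  by (simp add: trace_def sum)

definition vec_d :: "'a^'n \<Rightarrow> 'a^'n" where
  "vec_d V = (\<chi> i. d (V $ i))"

lemma vec_d_nth [simp]: "vec_d V $ i = d (V $ i)"
  by (simp add: vec_d_def)

lemma vec_d_mult: "vec_d (A *v V) = mat_d A *v V + A *v vec_d V"
  by (simp add: vec_eq_iff matrix_vector_mult_def rules sum.distrib)

lemma d_dotp: "d (dotp V W) = dotp (vec_d V) W + dotp V (vec_d W)"
  by (simp add: dotp_def rules sum.distrib)

text \<open>The hypothesis says that the connection \<open>d + \<omega>\<close> preserves the form
  \<open>K\<close>; hence the pairing obeys the product rule for that connection.\<close>

lemma d_bilinear:
  assumes "mat_d K = transpose \<omega> ** K + K ** \<omega>"
  shows "d (dotp V (K *v W)) = dotp (vec_d V + \<omega> *v V) (K *v W) + dotp V (K *v (vec_d W + \<omega> *v W))"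
  by (simp add: d_dotp vec_d_mult assms dotp_add dotp_transpose[simplified] matrix_vector_right_distrib
      matrix_vector_mult_add_rdistrib' matrix_vector_mul_assoc[symmetric] algebra_simps)

lemmas mat_d_rules = mat_d_add mat_d_mult mat_d_diff mat_d_neg mat_d_transpose

end

section \<open>Curvature of a metric connection and the second Bianchi identity\<close>

text \<open>
  Here \<open>G\<close> is the inverse metric and \<open>\<Gamma> i $ l $ k\<close> is \<open>\<Gamma>\<^sup>l\<^sub>i\<^sub>k\<close>. The Levi-Civita connection enters only
  through its symmetry and \<open>\<nabla>G = 0\<close>, so that no division by 2 is needed in the ring.
\<close>

locale curvature_ring =
  fixes D :: "'m::finite \<Rightarrow> 'a::comm_ring_1 \<Rightarrow> 'a"
    and G :: "'a^'m^'m"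
    and \<Gamma> :: "'m \<Rightarrow> 'a^'m^'m"
  assumes D: "derivation (D i)"
    and D_commute: "D i (D j x) = D j (D i x)"
    and two_cancel: "(2::'a) * x = 2 * y \<Longrightarrow> x = y"
    and G_sym: "transpose G = G"
    and D_G: "derivation.mat_d (D i) G = - (\<Gamma> i ** G + G ** transpose (\<Gamma> i))"
    and \<Gamma>_sym: "\<Gamma> i $ l $ k = \<Gamma> k $ l $ i"
begin

sublocale D: derivation "D i" for i
  by (rule D)

abbreviation dm :: "'m \<Rightarrow> 'a^'m^'m \<Rightarrow> 'a^'m^'m" where
  "dm i \<equiv> D.mat_d i"

lemma dm_commute: "dm i (dm j A) = dm j (dm i A)"
  by (simp add: vec_eq_iff D_commute)

lemma G_sym': "G $ i $ j = G $ j $ i"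
  using G_sym by (metis transpose_def vec_lambda_beta)

text \<open>The curvature matrix of the connection with matrices \<open>\<Gamma>\<close>; its entry
  \<open>$ l $ k\<close> corresponds to \<open>riemann h l i j k\<close>.\<close>

definition curv :: "'m \<Rightarrow> 'm \<Rightarrow> 'a^'m^'m" where
  "curv i j = dm i (\<Gamma> j) - dm j (\<Gamma> i) + \<Gamma> i ** \<Gamma> j - \<Gamma> j ** \<Gamma> i"

definition ric :: "'a^'m^'m" where
  "ric = (\<chi> j k. \<Sum>i\<in>UNIV. curv i j $ i $ k)"

text \<open>
  \<open>Q\<close> is the curvature with one index raised. It is antisymmetric in both pairs of indices, and the
  second Bianchi identity keeps its form since \<open>\<nabla>G = 0\<close>; this makes its double contraction short.
\<close>

definition Q :: "'m \<Rightarrow> 'm \<Rightarrow> 'a^'m^'m" where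
  "Q i j = curv i j ** G"

lemma curv_swap: "curv i j = - curv j i"
  by (simp add: curv_def algebra_simps)

lemma Q_swap: "Q i j = - Q j i"
  by (metis Q_def curv_swap matrix_neg_left)

text \<open>Curvature is the commutator of covariant derivatives, and \<open>G\<close> is parallel.
  Antisymmetrising the second derivatives of \<open>G\<close> cancels the mixed terms \<Gamma> G
  \<Gamma>^T and leaves \<open>curv i j ** G + G ** transpose (curv i j) = 0\<close>.\<close>

lemma Q_transpose: "transpose (Q i j) = - Q i j"
proof -
  have *: "dm i (dm j G) = - (dm i (\<Gamma> j) ** G + G ** transpose (dm i (\<Gamma> j)))
      + \<Gamma> j ** \<Gamma> i ** G + \<Gamma> j ** G ** transpose (\<Gamma> i)
      + \<Gamma> i ** G ** transpose (\<Gamma> j) + G ** transpose (\<Gamma> i) ** transpose (\<Gamma> j)" for i j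
    by (simp add: D_G D.mat_d_rules matrix_ring_simps)
  have "dm i (dm j G) - dm j (dm i G) = 0"
    by (simp add: dm_commute)
  then have "Q i j + transpose (Q i j) = 0"
    unfolding * by (simp add: Q_def curv_def matrix_ring_simps matrix_transpose_mul G_sym algebra_simps)
  then show ?thesis
    by (metis add.commute eq_neg_iff_add_eq_0)
qed

text \<open>Only the two upper (matrix) indices are corrected by \<Gamma>. The corrections for the
  form indices \<open>j\<close>, \<open>k\<close> would cancel in the cyclic sum by the symmetry of
  \<Gamma>, so the Bianchi identity can be stated without them.\<close>

definition covQ :: "'m \<Rightarrow> 'm \<Rightarrow> 'm \<Rightarrow> 'a^'m^'m" where
  "covQ i j k = dm i (Q j k) + \<Gamma> i ** Q j k + Q j k ** transpose (\<Gamma> i)"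

text \<open>Since \<open>G\<close> is parallel it factors out on the right. What remains is the
  Bianchi identity for \<open>curv\<close>, that is, commuting derivations together with the Jacobi
  identity for matrix commutators.\<close>

lemma second_bianchi: "covQ i j k + covQ j k i + covQ k i j = 0"
proof -
  have *: "covQ i j k = (dm i (curv j k) + \<Gamma> i ** curv j k - curv j k ** \<Gamma> i) ** G" for i j k
    by (simp add: covQ_def Q_def D.mat_d_rules D_G matrix_ring_simps)
  have "dm i (curv j k) + \<Gamma> i ** curv j k - curv j k ** \<Gamma> i
      + (dm j (curv k i) + \<Gamma> j ** curv k i - curv k i ** \<Gamma> j)
      + (dm k (curv i j) + \<Gamma> k ** curv i j - curv i j ** \<Gamma> k) = 0"
    by (simp add: curv_def D.mat_d_rules matrix_ring_simps dm_commute[of i j] dm_commute[of i k] dm_commute[of j k])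
  then show ?thesis
    unfolding * by (metis (no_types, lifting) matrix_add_rdistrib' add.assoc
        matrix_diff_rdistrib diff_self)
qed

lemma covQ_transpose: "transpose (covQ i j k) = - covQ i j k"
  by (simp add: covQ_def D.mat_d_transpose[symmetric] matrix_ring_simps matrix_transpose_mul Q_transpose D.mat_d_neg)

lemma covQ_swap: "covQ i j k = - covQ i k j"
  by (simp add: covQ_def Q_swap[of j k] D.mat_d_neg matrix_ring_simps)

lemma covQ_nth: "covQ k i j $ i $ k = covQ k j i $ k $ i"
  using arg_cong[OF covQ_transpose[of k j i], where f="\<lambda>M. M $ i $ k"]
  by (simp add: covQ_swap[of k i j] transpose_def)

section \<open>Divergences and the contracted Bianchi identity\<close>

definition ricm :: "'a^'m^'m" where
  "ricm = ric ** G"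

text \<open>The covariant divergence \<open>\<nabla>\<^sub>i M\<^sub>j\<^sup>i\<close>: the first
  index of \<open>M\<close> is lower, the second upper. Likewise \<open>div_up\<close> is
  \<open>\<nabla>\<^sub>i Y\<^sup>i\<^sup>k\<close> and \<open>div_vec\<close> is
  \<open>\<nabla>\<^sub>i W\<^sup>i\<close>.\<close>

definition div_mixed :: "'a^'m^'m \<Rightarrow> 'm \<Rightarrow> 'a" where
  "div_mixed M j = (\<Sum>i\<in>UNIV. D i (M $ j $ i)) + (\<Sum>i\<in>UNIV. \<Sum>p\<in>UNIV. \<Gamma> i $ i $ p * M $ j $ p)
     - (\<Sum>i\<in>UNIV. \<Sum>p\<in>UNIV. \<Gamma> j $ i $ p * M $ i $ p)"

definition div_up :: "'a^'m^'m \<Rightarrow> 'm \<Rightarrow> 'a" where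
  "div_up Y k = (\<Sum>i\<in>UNIV. D i (Y $ i $ k)) + (\<Sum>i\<in>UNIV. \<Sum>p\<in>UNIV. \<Gamma> i $ i $ p * Y $ p $ k)
     + (\<Sum>i\<in>UNIV. \<Sum>p\<in>UNIV. \<Gamma> i $ k $ p * Y $ i $ p)"

definition div_vec :: "('m \<Rightarrow> 'a) \<Rightarrow> 'a" where
  "div_vec W = (\<Sum>i\<in>UNIV. D i (W i)) + (\<Sum>i\<in>UNIV. \<Sum>p\<in>UNIV. \<Gamma> i $ i $ p * W p)"

lemma double_zero:
  assumes "(x::'a) = - x"
  shows "x = 0"
proof (rule two_cancel)
  have "x + x = 0"
    by (rule iffD1[OF eq_neg_iff_add_eq_0 assms])
  then show "2 * x = 2 * 0"
    by (simp only: mult_2 mult_zero_right)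
qed

lemma antisym_sum_zero:
  fixes X Y :: "'m \<Rightarrow> 'm \<Rightarrow> 'a"
  assumes "\<And>i p. X i p = - X p i" "\<And>i p. Y i p = Y p i"
  shows "(\<Sum>i\<in>UNIV. \<Sum>p\<in>UNIV. X i p * Y i p) = 0"
proof -
  let ?s = "\<Sum>i\<in>UNIV. \<Sum>p\<in>UNIV. X i p * Y i p"
  have "?s = (\<Sum>p\<in>UNIV. \<Sum>i\<in>UNIV. X i p * Y i p)"
    by (rule sum.swap)
  also have "\<dots> = (\<Sum>p\<in>UNIV. \<Sum>i\<in>UNIV. - (X p i * Y p i))"
    by (intro sum.cong refl, subst assms(1), subst assms(2), rule mult_minus_left)
  also have "\<dots> = - ?s"
    by (simp add: sum_negf)
  finally show ?thesis
    by (rule double_zero)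
qed

lemma Q_nth_swap: "Q i j $ k $ l = - Q j i $ k $ l"
  by (simp add: Q_swap[of i j])

lemma Q_nth_transpose: "Q i j $ k $ l = - Q i j $ l $ k"
  using arg_cong[OF Q_transpose[of i j], where f="\<lambda>M. M $ l $ k"] by (simp add: transpose_def)

lemma ricm_Q: "ricm $ j $ p = (\<Sum>k\<in>UNIV. Q k j $ k $ p)"
  by (simp add: ricm_def Q_def ric_def matrix_matrix_mult_def sum_distrib_right) (rule sum.swap)

lemma ricm_Q2: "(\<Sum>k\<in>UNIV. Q j k $ p $ k) = ricm $ j $ p"
  unfolding ricm_Q by (intro sum.cong refl, subst Q_nth_swap, subst Q_nth_transpose) simp

lemma ricm_Q3: "(\<Sum>k\<in>UNIV. Q k j $ p $ k) = - ricm $ j $ p"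
  unfolding ricm_Q sum_negf[symmetric] by (intro sum.cong refl Q_nth_transpose)

lemma ricm_Q4: "(\<Sum>k\<in>UNIV. Q j k $ k $ p) = - ricm $ j $ p"
  unfolding ricm_Q sum_negf[symmetric] by (intro sum.cong refl Q_nth_swap)

text \<open>Contract the cyclic sum twice: by the two antisymmetries of \<open>Q\<close> the first
  and third terms agree, and the middle one is minus the derivative of the scalar curvature. The
  \<Gamma>-terms of the middle one also supply the lower-index correction in
  \<open>div_mixed\<close>.\<close>

lemma contracted_bianchi: "2 * div_mixed ricm j = D j (trace ricm)"
proof -
  define t1 where "t1 = (\<Sum>i\<in>UNIV. \<Sum>k\<in>UNIV. covQ i j k $ i $ k)"
  define t2 where "t2 = (\<Sum>i\<in>UNIV. \<Sum>k\<in>UNIV. covQ j k i $ i $ k)"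
  have "(\<Sum>i\<in>UNIV. \<Sum>k\<in>UNIV. (covQ i j k + covQ j k i + covQ k i j) $ i $ k) = 0"
    by (simp add: second_bianchi)
  moreover have "(\<Sum>i\<in>UNIV. \<Sum>k\<in>UNIV. covQ k i j $ i $ k) = t1"
  proof -
    have "(\<Sum>i\<in>UNIV. \<Sum>k\<in>UNIV. covQ k i j $ i $ k) = (\<Sum>k\<in>UNIV. \<Sum>i\<in>UNIV. covQ k i j $ i $ k)"
      by (rule sum.swap)
    also have "\<dots> = t1"
      unfolding t1_def
      by (intro sum.cong refl covQ_nth)
    finally show ?thesis .
  qed
  ultimately have sum0: "2 * t1 + t2 = 0"
    by (simp add: sum.distrib t1_def t2_def algebra_simps)
  \<comment> \<open>A skew pair of indices of \<open>Q\<close> is contracted with the symmetric pair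
    of \<Gamma>.\<close>
  have z: "(\<Sum>i\<in>UNIV. \<Sum>k\<in>UNIV. \<Sum>p\<in>UNIV. Q j k $ i $ p * \<Gamma> i $ k $ p) = 0"
  proof -
    have "(\<Sum>i\<in>UNIV. \<Sum>k\<in>UNIV. \<Sum>p\<in>UNIV. Q j k $ i $ p * \<Gamma> i $ k $ p)
        = (\<Sum>k\<in>UNIV. \<Sum>i\<in>UNIV. \<Sum>p\<in>UNIV. Q j k $ i $ p * \<Gamma> i $ k $ p)"
      by (rule sum.swap)
    also have "\<dots> = (\<Sum>k\<in>(UNIV::'m set). 0)"
      by (intro sum.cong refl antisym_sum_zero Q_nth_transpose \<Gamma>_sym)
    finally show ?thesis by simp
  qed
  have t1: "t1 = (\<Sum>i\<in>UNIV. D i (ricm $ j $ i)) + (\<Sum>i\<in>UNIV. \<Sum>p\<in>UNIV. \<Gamma> i $ i $ p * ricm $ j $ p)"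
  proof -
    have "t1 = (\<Sum>i\<in>UNIV. \<Sum>k\<in>UNIV. D i (Q j k $ i $ k))
       + (\<Sum>i\<in>UNIV. \<Sum>k\<in>UNIV. \<Sum>p\<in>UNIV. \<Gamma> i $ i $ p * Q j k $ p $ k)
       + (\<Sum>i\<in>UNIV. \<Sum>k\<in>UNIV. \<Sum>p\<in>UNIV. Q j k $ i $ p * \<Gamma> i $ k $ p)"
      by (simp add: t1_def covQ_def sum.distrib matrix_matrix_mult_def transpose_def)
    also have "(\<Sum>i\<in>UNIV. \<Sum>k\<in>UNIV. D i (Q j k $ i $ k)) = (\<Sum>i\<in>UNIV. D i (ricm $ j $ i))"
      by (simp add: ricm_Q2[symmetric] D.sum)
    also have "(\<Sum>i\<in>UNIV. \<Sum>k\<in>UNIV. \<Sum>p\<in>UNIV. \<Gamma> i $ i $ p * Q j k $ p $ k)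
        = (\<Sum>i\<in>UNIV. \<Sum>p\<in>UNIV. \<Gamma> i $ i $ p * ricm $ j $ p)"
      by (subst sum_swap23) (simp add: ricm_Q2[symmetric] sum_distrib_left)
    finally show ?thesis by (simp add: z)
  qed
  have t2: "t2 = - D j (trace ricm) - 2 * (\<Sum>i\<in>UNIV. \<Sum>p\<in>UNIV. \<Gamma> j $ i $ p * ricm $ i $ p)"
  proof -
    have "t2 = (\<Sum>i\<in>UNIV. \<Sum>k\<in>UNIV. D j (Q k i $ i $ k))
       + (\<Sum>i\<in>UNIV. \<Sum>k\<in>UNIV. \<Sum>p\<in>UNIV. \<Gamma> j $ i $ p * Q k i $ p $ k)
       + (\<Sum>i\<in>UNIV. \<Sum>k\<in>UNIV. \<Sum>p\<in>UNIV. Q k i $ i $ p * \<Gamma> j $ k $ p)"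
      by (simp add: t2_def covQ_def sum.distrib matrix_matrix_mult_def transpose_def)
    also have "(\<Sum>i\<in>UNIV. \<Sum>k\<in>UNIV. D j (Q k i $ i $ k)) = - D j (trace ricm)"
      by (simp add: trace_def D.sum[symmetric] ricm_Q3 D.minus sum_negf)
    also have "(\<Sum>i\<in>UNIV. \<Sum>k\<in>UNIV. \<Sum>p\<in>UNIV. \<Gamma> j $ i $ p * Q k i $ p $ k)
        = - (\<Sum>i\<in>UNIV. \<Sum>p\<in>UNIV. \<Gamma> j $ i $ p * ricm $ i $ p)"
      by (subst sum_swap23) (simp add: sum_distrib_left[symmetric] ricm_Q3 sum_negf)
    also have "(\<Sum>i\<in>UNIV. \<Sum>k\<in>UNIV. \<Sum>p\<in>UNIV. Q k i $ i $ p * \<Gamma> j $ k $ p)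
        = - (\<Sum>i\<in>UNIV. \<Sum>p\<in>UNIV. \<Gamma> j $ i $ p * ricm $ i $ p)"
    proof -
      have "(\<Sum>i\<in>UNIV. \<Sum>k\<in>UNIV. \<Sum>p\<in>UNIV. Q k i $ i $ p * \<Gamma> j $ k $ p)
        = (\<Sum>k\<in>UNIV. \<Sum>p\<in>UNIV. \<Sum>i\<in>UNIV. Q k i $ i $ p * \<Gamma> j $ k $ p)"
        by (rule sum_rot3)
      then show ?thesis
        unfolding sum_distrib_right[symmetric] ricm_Q4 by (simp add: sum_negf mult.commute)
    qed
    finally show ?thesis by simp
  qed
  show ?thesis
    using sum0 by (simp add: t1 t2 div_mixed_def algebra_simps)
qed

lemma D_G_nth: "D i (G $ k $ l) = - (\<Sum>p\<in>UNIV. \<Gamma> i $ k $ p * G $ p $ l) - (\<Sum>p\<in>UNIV. \<Gamma> i $ l $ p * G $ k $ p)"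
  using D_G[of i] by (simp add: vec_eq_iff matrix_matrix_mult_def transpose_def mult.commute)

lemma div_up_G: "div_up G k = 0"
  unfolding div_up_def D_G_nth
  by (simp add: sum_subtractf sum_negf)


lemma \<Gamma>_contract: "(\<Sum>i\<in>UNIV. \<Gamma> i $ i $ p) = trace (\<Gamma> p)"
  unfolding trace_def by (intro sum.cong refl \<Gamma>_sym)

lemma \<Gamma>_contract_sum: "(\<Sum>i\<in>UNIV. \<Sum>p\<in>UNIV. \<Gamma> i $ i $ p * F p) = (\<Sum>p\<in>UNIV. trace (\<Gamma> p) * F p)"
  by (subst sum.swap) (simp add: sum_distrib_right[symmetric] \<Gamma>_contract)

text \<open>As \<open>G\<close> is parallel, raising an index commutes with covariant
  differentiation; the right-hand side is the metric trace of
  \<open>\<nabla>\<^sub>i Y\<^sub>j\<close>. For \<open>Y = dS\<close> it is the Laplacian of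
  \<open>S\<close>.\<close>

lemma div_vec_raise:
  "div_vec (\<lambda>i. \<Sum>j\<in>UNIV. G $ i $ j * Y j)
     = (\<Sum>i\<in>UNIV. \<Sum>j\<in>UNIV. G $ i $ j * (D i (Y j) - (\<Sum>l\<in>UNIV. \<Gamma> i $ l $ j * Y l)))"
proof -
  have a: "(\<Sum>i\<in>UNIV. \<Sum>j\<in>UNIV. (\<Sum>p\<in>UNIV. \<Gamma> i $ i $ p * G $ p $ j) * Y j)
      = (\<Sum>i\<in>UNIV. \<Sum>p\<in>UNIV. \<Gamma> i $ i $ p * (\<Sum>j\<in>UNIV. G $ p $ j * Y j))"
    by (simp add: sum_distrib_left sum_distrib_right mult.assoc) (rule sum_swap23)
  have b: "(\<Sum>i\<in>UNIV. \<Sum>j\<in>UNIV. (\<Sum>p\<in>UNIV. \<Gamma> i $ j $ p * G $ i $ p) * Y j)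
      = (\<Sum>i\<in>UNIV. \<Sum>j\<in>UNIV. G $ i $ j * (\<Sum>l\<in>UNIV. \<Gamma> i $ l $ j * Y l))"
    by (simp add: sum_distrib_left sum_distrib_right mult_ac) (rule sum_swap23)
  show ?thesis
    unfolding div_vec_def
    by (simp add: D.sum D.mult sum.distrib D_G_nth left_diff_distrib right_diff_distrib sum_subtractf
        sum_negf a b)
qed

text \<open>The same principle for a symmetric 2-tensor: it converts the divergence delivered by
  \<open>T_trace\<close> into the one computed by the Bianchi identity.\<close>

lemma div_up_raise:
  assumes "transpose b = b"
  shows "div_up (G ** b ** G) k = (\<Sum>j\<in>UNIV. G $ k $ j * div_mixed (b ** G) j)"
proof -
  define M where "M = b ** G"
  have "transpose (G ** b ** G) = G ** b ** G"
    by (simp add: matrix_transpose_mul G_sym assms matrix_mul_assoc)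
  then have "(G ** b ** G) $ i $ k = transpose (G ** M) $ i $ k" for i k
    by (simp only: M_def matrix_mul_assoc)
  \<comment> \<open>Symmetry lets the free index \<open>k\<close> be the one raised by the outer
    \<open>G\<close>, so that the contraction runs over the upper index of \<open>M\<close>.\<close>
  then have Y: "(G ** b ** G) $ i $ k = (\<Sum>j\<in>UNIV. G $ k $ j * M $ j $ i)" for i k
    by (simp add: matrix_matrix_mult_def[of G M] transpose_def)
  have a: "(\<Sum>i\<in>UNIV. \<Sum>j\<in>UNIV. (\<Sum>p\<in>UNIV. \<Gamma> i $ j $ p * G $ k $ p) * M $ j $ i)
      = (\<Sum>j\<in>UNIV. G $ k $ j * (\<Sum>i\<in>UNIV. \<Sum>p\<in>UNIV. \<Gamma> j $ i $ p * M $ i $ p))"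
    unfolding sum_distrib_left sum_distrib_right
    by (subst sum_swap13) (simp add: \<Gamma>_sym mult_ac)
  have b: "(\<Sum>i\<in>UNIV. \<Sum>j\<in>UNIV. (\<Sum>p\<in>UNIV. \<Gamma> i $ k $ p * G $ p $ j) * M $ j $ i)
      = (\<Sum>i\<in>UNIV. \<Sum>p\<in>UNIV. \<Gamma> i $ k $ p * (\<Sum>j\<in>UNIV. G $ p $ j * M $ j $ i))"
    by (simp add: sum_distrib_left sum_distrib_right mult.assoc) (rule sum_swap23)
  have b': "(\<Sum>i\<in>UNIV. \<Sum>p\<in>UNIV. \<Gamma> i $ k $ p * (\<Sum>j\<in>UNIV. G $ i $ j * M $ j $ p))
      = (\<Sum>i\<in>UNIV. \<Sum>p\<in>UNIV. \<Gamma> i $ k $ p * (\<Sum>j\<in>UNIV. G $ p $ j * M $ j $ i))"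
    by (subst sum.swap) (simp add: \<Gamma>_sym[of _ k])
  have c: "(\<Sum>i\<in>UNIV. \<Sum>j\<in>UNIV. G $ k $ j * D i (M $ j $ i))
      = (\<Sum>j\<in>UNIV. G $ k $ j * (\<Sum>i\<in>UNIV. D i (M $ j $ i)))"
    by (subst sum.swap) (simp add: sum_distrib_left)
  have d: "(\<Sum>i\<in>UNIV. \<Sum>p\<in>UNIV. \<Gamma> i $ i $ p * (\<Sum>j\<in>UNIV. G $ k $ j * M $ j $ p))
      = (\<Sum>j\<in>UNIV. G $ k $ j * (\<Sum>i\<in>UNIV. \<Sum>p\<in>UNIV. \<Gamma> i $ i $ p * M $ j $ p))"
    unfolding sum_distrib_left
    by (subst sum_rot3') (simp add: mult_ac)
  show ?thesis
    unfolding div_up_def Y div_mixed_def M_def[symmetric]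
    by (simp add: D.sum D.mult sum.distrib D_G_nth left_diff_distrib right_diff_distrib sum_subtractf
        distrib_left sum_negf a b b' c d)
qed

end

section \<open>A metric moving in time: variation of the connection and of the Ricci tensor\<close>

locale metric_flow_ring = curvature_ring D G \<Gamma>
  for D :: "'m::finite \<Rightarrow> 'a::comm_ring_1 \<Rightarrow> 'a" and G :: "'a^'m^'m" and \<Gamma> :: "'m \<Rightarrow> 'a^'m^'m" +
  fixes Dt :: "'a \<Rightarrow> 'a" and g S :: "'a^'m^'m"
  assumes Dt: "derivation Dt"
    and Dt_D: "Dt (D i x) = D i (Dt x)"
    and gG: "g ** G = mat 1" "G ** g = mat 1"
    and S_sym: "transpose S = S"
    and Dt_g: "derivation.mat_d Dt g = - (S + S)"
begin

sublocale Dt: derivation Dt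
  by (rule Dt)

lemma gG_cancel: "A ** G ** g = A" "A ** g ** G = A" for A :: "'a^'m^'m"
  by (simp_all add: matrix_mul_assoc[symmetric] gG)

lemma Dt_G: "Dt.mat_d G = G ** S ** G + G ** S ** G"
proof -
  have "Dt.mat_d (g ** G) = 0"
    by (simp add: gG)
  then have "G ** (Dt.mat_d g ** G + g ** Dt.mat_d G) = 0"
    by (simp add: Dt.mat_d_mult)
  then have "- (G ** S ** G) - G ** S ** G + Dt.mat_d G = 0"
    by (simp only: Dt_g matrix_ring_simps gG matrix_mul_lid minus_add_distrib diff_conv_add_uminus)
  then show ?thesis
    by (simp add: algebra_simps eq_diff_eq)
qed

lemma dm_G: "dm i G = - (G ** dm i g ** G)"
proof -
  have "dm i (g ** G) = 0"
    by (simp add: gG)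
  then have "G ** (dm i g ** G + g ** dm i G) = 0"
    by (simp add: D.mat_d_mult)
  then show ?thesis
    by (simp add: matrix_ring_simps gG eq_neg_iff_add_eq_0 add.commute)
qed

text \<open>Trace of the compatibility of connection and metric. It says that the trace of \<Gamma>
  is the logarithmic derivative of the volume density, with the factor 2 kept on the left.\<close>

lemma trace_\<Gamma>: "2 * trace (\<Gamma> p) = trace (G ** dm p g)"
proof -
  have "G ** dm p g ** (G ** g) = (\<Gamma> p ** G + G ** transpose (\<Gamma> p)) ** g"
    using dm_G[of p] D_G[of p] by (simp only: matrix_mul_assoc neg_equal_iff_equal)
  then have "trace (G ** dm p g) = trace (\<Gamma> p ** (G ** g)) + trace (G ** (transpose (\<Gamma> p) ** g))"
    by (simp add: gG_cancel matrix_ring_simps trace_add)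
  also have "trace (G ** (transpose (\<Gamma> p) ** g)) = trace (transpose (\<Gamma> p) ** (g ** G))"
    by (subst trace_mul_sym) (simp add: matrix_mul_assoc)
  also have "\<dots> = trace (\<Gamma> p)"
    by (simp add: gG trace_def transpose_def)
  finally show ?thesis
    by (simp add: gG)
qed

text \<open>At this stage \<open>S\<close> is any symmetric tensor with
  \<open>\<partial>\<^sub>t g = - 2 S\<close>; its link with curvature is imposed only in the
  coupled flow.\<close>

definition Sc :: 'a where
  "Sc = trace (S ** G)"

text \<open>The volume density has logarithmic time derivative \<open>- Sc\<close>, and its
  logarithmic space derivative is the trace of \<Gamma>; exchange the two derivatives. As the ring
  has no logarithms, \<open>trace_\<Gamma>\<close> is differentiated instead.\<close>

lemma Dt_trace_\<Gamma>: "Dt (trace (\<Gamma> p)) = - D p Sc"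
proof (rule two_cancel)
  have "trace (G ** S ** G ** dm p g) = trace (S ** (G ** dm p g ** G))"
    using trace_mul_sym[of G "S ** G ** dm p g"] by (simp add: matrix_mul_assoc)
  also have "\<dots> = - trace (S ** dm p G)"
    by (simp add: dm_G matrix_neg_right trace_neg)
  finally have *: "trace (G ** S ** G ** dm p g) = - trace (S ** dm p G)" .
  have "2 * Dt (trace (\<Gamma> p)) = Dt (2 * trace (\<Gamma> p))"
    by (simp only: mult_2 Dt.add)
  also have "\<dots> = trace (Dt.mat_d G ** dm p g) + trace (G ** Dt.mat_d (dm p g))"
    by (simp only: trace_\<Gamma> Dt.trace_mat_d Dt.mat_d_mult trace_add)
  also have "Dt.mat_d (dm p g) = dm p (Dt.mat_d g)"
    by (simp add: vec_eq_iff Dt_D)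
  also have "trace (Dt.mat_d G ** dm p g) = 2 * trace (G ** S ** G ** dm p g)"
    by (simp only: Dt_G matrix_add_rdistrib' trace_add mult_2)
  also have "trace (G ** dm p (Dt.mat_d g)) = - (2 * trace (dm p S ** G))"
    by (simp only: Dt_g D.mat_d_rules matrix_ring_simps trace_add trace_neg mult_2 trace_mul_sym[of _ G] minus_add_distrib)
  also have "2 * trace (G ** S ** G ** dm p g) + - (2 * trace (dm p S ** G)) = 2 * - D p Sc"
    by (simp add: Sc_def * D.trace_mat_d D.mat_d_mult trace_add algebra_simps)
  finally show "2 * Dt (trace (\<Gamma> p)) = 2 * - D p Sc" .
qed


abbreviation T :: "'m \<Rightarrow> 'a^'m^'m" where
  "T i \<equiv> Dt.mat_d (\<Gamma> i)"

lemma div_up_add: "div_up (X + Y) k = div_up X k + div_up Y k"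
  by (simp add: div_up_def D.add distrib_left sum.distrib)

text \<open>Obtained by differentiating \<open>div G = 0\<close> in time, which avoids the variation formula for \<open>\<Gamma>\<close>.\<close>

lemma T_trace: "(\<Sum>j\<in>UNIV. \<Sum>l\<in>UNIV. G $ j $ l * T j $ k $ l)
    = (\<Sum>p\<in>UNIV. G $ k $ p * D p Sc) - 2 * div_up (G ** S ** G) k"
proof -
  have "0 = Dt (div_up G k)"
    by (simp add: div_up_G)
  also have "\<dots> = div_up (Dt.mat_d G) k + (\<Sum>i\<in>UNIV. \<Sum>p\<in>UNIV. Dt (\<Gamma> i $ i $ p) * G $ p $ k)
      + (\<Sum>i\<in>UNIV. \<Sum>p\<in>UNIV. Dt (\<Gamma> i $ k $ p) * G $ i $ p)"
    by (simp add: div_up_def Dt.sum Dt.add Dt.mult Dt_D sum.distrib)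
  also have "(\<Sum>i\<in>UNIV. \<Sum>p\<in>UNIV. Dt (\<Gamma> i $ i $ p) * G $ p $ k)
      = (\<Sum>p\<in>UNIV. (\<Sum>i\<in>UNIV. Dt (\<Gamma> i $ i $ p)) * G $ p $ k)"
    by (subst sum.swap) (simp add: sum_distrib_right)
  also have "\<dots> = - (\<Sum>p\<in>UNIV. G $ k $ p * D p Sc)"
    by (simp add: Dt.sum[symmetric] \<Gamma>_contract Dt_trace_\<Gamma> sum_negf mult.commute G_sym'[of _ k])
  also have "div_up (Dt.mat_d G) k = 2 * div_up (G ** S ** G) k"
    by (simp only: Dt_G div_up_add mult_2)
  finally show ?thesis
    by (simp add: algebra_simps)
qed

text \<open>Used for \<open>X = T\<close>: the two halves of the time derivative of the term
  \<Gamma>\<Gamma> in the Ricci tensor have the same trace.\<close>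

lemma \<Gamma>_quad_sum:
  "(\<Sum>j\<in>UNIV. \<Sum>k\<in>UNIV. G $ j $ k * (\<Sum>i\<in>UNIV. \<Sum>n\<in>UNIV. \<Gamma> j $ i $ n * X i $ n $ k))
    = (\<Sum>j\<in>UNIV. \<Sum>k\<in>UNIV. G $ j $ k * (\<Sum>i\<in>UNIV. \<Sum>n\<in>UNIV. X j $ i $ n * \<Gamma> i $ n $ k))"
  if X_sym: "\<And>i l k. X i $ l $ k = X k $ l $ i" for X :: "'m \<Rightarrow> 'a^'m^'m"
proof -
  have "(\<Sum>j\<in>UNIV. \<Sum>k\<in>UNIV. G $ j $ k * (\<Sum>i\<in>UNIV. \<Sum>n\<in>UNIV. \<Gamma> j $ i $ n * X i $ n $ k))
    = (\<Sum>k\<in>UNIV. \<Sum>j\<in>UNIV. G $ j $ k * (\<Sum>n\<in>UNIV. \<Sum>i\<in>UNIV. \<Gamma> j $ i $ n * X i $ n $ k))"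
    by (subst sum.swap, subst (2) sum.swap) (rule refl)
  also have "\<dots> = (\<Sum>j\<in>UNIV. \<Sum>k\<in>UNIV. G $ j $ k * (\<Sum>i\<in>UNIV. \<Sum>n\<in>UNIV. X j $ i $ n * \<Gamma> i $ n $ k))"
  proof (intro sum.cong refl)
    fix k j
    have "\<Gamma> j $ i $ n * X i $ n $ k = X k $ n $ i * \<Gamma> n $ i $ j" for i n
      by (subst \<Gamma>_sym, subst X_sym) (rule mult.commute)
    then show "G $ j $ k * (\<Sum>n\<in>UNIV. \<Sum>i\<in>UNIV. \<Gamma> j $ i $ n * X i $ n $ k)
      = G $ k $ j * (\<Sum>i\<in>UNIV. \<Sum>n\<in>UNIV. X k $ i $ n * \<Gamma> i $ n $ j)"
      by (simp add: G_sym'[of j k])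
  qed
  finally show ?thesis .
qed

text \<open>The vector field of the Palatini identity \<open>\<partial>\<^sub>t R\<^sub>j\<^sub>k =
  \<nabla>\<^sub>i T\<^sup>i\<^sub>j\<^sub>k - \<nabla>\<^sub>j T\<^sup>i\<^sub>i\<^sub>k\<close>
  after contraction with the parallel \<open>G\<close>.\<close>

definition Wv :: "'m \<Rightarrow> 'a" where
  "Wv i = (\<Sum>j\<in>UNIV. \<Sum>k\<in>UNIV. G $ j $ k * T j $ i $ k) - (\<Sum>j\<in>UNIV. G $ i $ j * Dt (trace (\<Gamma> j)))"

lemma T_sym: "T i $ l $ k = T k $ l $ i"
  by (simp add: \<Gamma>_sym[of i])

lemma ric_nth: "ric $ j $ k = (\<Sum>i\<in>UNIV. D i (\<Gamma> j $ i $ k)) - D j (trace (\<Gamma> k))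
    + (\<Sum>n\<in>UNIV. trace (\<Gamma> n) * \<Gamma> j $ n $ k) - (\<Sum>i\<in>UNIV. \<Sum>n\<in>UNIV. \<Gamma> j $ i $ n * \<Gamma> i $ n $ k)"
  unfolding \<Gamma>_contract_sum[symmetric]
  by (simp add: ric_def curv_def sum.distrib sum_subtractf matrix_matrix_mult_def
      \<Gamma>_contract[symmetric] D.sum)

lemma Dt_ric_nth: "Dt (ric $ j $ k) = (\<Sum>i\<in>UNIV. D i (T j $ i $ k)) - D j (Dt (trace (\<Gamma> k)))
    + (\<Sum>n\<in>UNIV. Dt (trace (\<Gamma> n)) * \<Gamma> j $ n $ k) + (\<Sum>n\<in>UNIV. trace (\<Gamma> n) * T j $ n $ k)
    - (\<Sum>i\<in>UNIV. \<Sum>n\<in>UNIV. T j $ i $ n * \<Gamma> i $ n $ k)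
    - (\<Sum>i\<in>UNIV. \<Sum>n\<in>UNIV. \<Gamma> j $ i $ n * T i $ n $ k)"
  by (simp add: ric_nth Dt.rules Dt_D sum.distrib)

text \<open>Both sides are expanded in coordinates. The quadratic contraction \<open>Z\<close>
  occurs twice in each: on the left from the two halves of \<partial>_t(\<Gamma>\<Gamma>), on the
  right from differentiating both indices of \<open>G\<close>. The other terms match by renaming
  indices.\<close>

lemma palatini: "(\<Sum>j\<in>UNIV. \<Sum>k\<in>UNIV. G $ j $ k * Dt (ric $ j $ k)) = div_vec Wv"
proof -
  define c where "c k = Dt (trace (\<Gamma> k))" for k
  define Z where "Z = (\<Sum>j\<in>UNIV. \<Sum>k\<in>UNIV. G $ j $ k * (\<Sum>i\<in>UNIV. \<Sum>n\<in>UNIV. T j $ i $ n * \<Gamma> i $ n $ k))"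
  have Z': "(\<Sum>j\<in>UNIV. \<Sum>k\<in>UNIV. G $ j $ k * (\<Sum>i\<in>UNIV. \<Sum>n\<in>UNIV. \<Gamma> j $ i $ n * T i $ n $ k)) = Z"
    unfolding Z_def by (rule \<Gamma>_quad_sum[OF T_sym])
  have Q1: "(\<Sum>i\<in>UNIV. \<Sum>j\<in>UNIV. \<Sum>k\<in>UNIV. (\<Sum>p\<in>UNIV. \<Gamma> i $ k $ p * G $ j $ p) * T j $ i $ k) = Z"
  proof -
    have "(\<Sum>i\<in>UNIV. \<Sum>j\<in>UNIV. \<Sum>k\<in>UNIV. (\<Sum>p\<in>UNIV. \<Gamma> i $ k $ p * G $ j $ p) * T j $ i $ k)
      = (\<Sum>j\<in>UNIV. \<Sum>i\<in>UNIV. \<Sum>k\<in>UNIV. \<Sum>p\<in>UNIV. \<Gamma> i $ k $ p * G $ j $ p * T j $ i $ k)"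
      by (subst sum.swap) (simp only: sum_distrib_right)
    also have "\<dots> = (\<Sum>j\<in>UNIV. \<Sum>p\<in>UNIV. \<Sum>i\<in>UNIV. \<Sum>k\<in>UNIV. \<Gamma> i $ k $ p * G $ j $ p * T j $ i $ k)"
      by (intro sum.cong refl sum_rot3')
    also have "\<dots> = Z"
      unfolding Z_def sum_distrib_left by (simp add: mult_ac)
    finally show ?thesis .
  qed
  have Q2: "(\<Sum>i\<in>UNIV. \<Sum>j\<in>UNIV. \<Sum>k\<in>UNIV. (\<Sum>p\<in>UNIV. \<Gamma> i $ j $ p * G $ p $ k) * T j $ i $ k) = Z"
  proof -
    have "(\<Sum>i\<in>UNIV. \<Sum>j\<in>UNIV. \<Sum>k\<in>UNIV. (\<Sum>p\<in>UNIV. \<Gamma> i $ j $ p * G $ p $ k) * T j $ i $ k)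
       = (\<Sum>i\<in>UNIV. \<Sum>k\<in>UNIV. \<Sum>j\<in>UNIV. (\<Sum>p\<in>UNIV. \<Gamma> i $ j $ p * G $ k $ p) * T k $ i $ j)"
      by (subst sum_swap23) (simp only: T_sym[of _ _ k for k] G_sym'[of _ k for k])
    then show ?thesis using Q1 by simp
  qed
  have W: "div_vec Wv =
      (\<Sum>i\<in>UNIV. \<Sum>j\<in>UNIV. \<Sum>k\<in>UNIV. G $ j $ k * D i (T j $ i $ k)) - Z - Z
      - (\<Sum>i\<in>UNIV. \<Sum>j\<in>UNIV. G $ i $ j * D i (c j))
      + (\<Sum>i\<in>UNIV. \<Sum>j\<in>UNIV. (\<Sum>p\<in>UNIV. \<Gamma> i $ i $ p * G $ p $ j) * c j)
      + (\<Sum>i\<in>UNIV. \<Sum>j\<in>UNIV. (\<Sum>p\<in>UNIV. \<Gamma> i $ j $ p * G $ i $ p) * c j)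
      + (\<Sum>p\<in>UNIV. trace (\<Gamma> p) * (\<Sum>j\<in>UNIV. \<Sum>k\<in>UNIV. G $ j $ k * T j $ p $ k))
      - (\<Sum>p\<in>UNIV. trace (\<Gamma> p) * (\<Sum>j\<in>UNIV. G $ p $ j * c j))"
    unfolding div_vec_def \<Gamma>_contract_sum Wv_def c_def[symmetric]
    by (simp add: D.rules D_G_nth sum.distrib left_diff_distrib right_diff_distrib sum_subtractf sum_negf
        Q1[simplified] Q2[simplified])
  have W1: "(\<Sum>i\<in>UNIV. \<Sum>j\<in>UNIV. (\<Sum>p\<in>UNIV. \<Gamma> i $ i $ p * G $ p $ j) * c j)
      = (\<Sum>p\<in>UNIV. trace (\<Gamma> p) * (\<Sum>j\<in>UNIV. G $ p $ j * c j))"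
    unfolding \<Gamma>_contract_sum[symmetric]
    by (simp add: sum_distrib_left sum_distrib_right mult.assoc) (rule sum_swap23)
  have W2: "(\<Sum>i\<in>UNIV. \<Sum>j\<in>UNIV. (\<Sum>p\<in>UNIV. \<Gamma> i $ j $ p * G $ i $ p) * c j)
      = (\<Sum>j\<in>UNIV. \<Sum>k\<in>UNIV. G $ j $ k * (\<Sum>n\<in>UNIV. c n * \<Gamma> j $ n $ k))"
    by (simp add: sum_distrib_left sum_distrib_right mult_ac) (rule sum_swap23)
  have W3: "(\<Sum>p\<in>UNIV. trace (\<Gamma> p) * (\<Sum>j\<in>UNIV. \<Sum>k\<in>UNIV. G $ j $ k * T j $ p $ k))
      = (\<Sum>j\<in>UNIV. \<Sum>k\<in>UNIV. G $ j $ k * (\<Sum>n\<in>UNIV. trace (\<Gamma> n) * T j $ n $ k))"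
    unfolding sum_distrib_left by (subst sum_rot3) (simp add: mult_ac)
  have W4: "(\<Sum>i\<in>UNIV. \<Sum>j\<in>UNIV. \<Sum>k\<in>UNIV. G $ j $ k * D i (T j $ i $ k))
      = (\<Sum>j\<in>UNIV. \<Sum>k\<in>UNIV. G $ j $ k * (\<Sum>i\<in>UNIV. D i (T j $ i $ k)))"
    unfolding sum_distrib_left by (rule sum_rot3)
  show ?thesis
    unfolding W W1 W2 W3 W4 Dt_ric_nth c_def[symmetric]
    by (simp only: distrib_left right_diff_distrib sum.distrib sum_subtractf Z' Z_def[symmetric]) simp
qed

end


section \<open>Maps into a Riemannian target and their stress-energy tensor\<close>

text \<open>\<open>\<omega> i\<close> is the connection matrix of the pull-back of the tangent bundle of the target along \<open>f\<close>.\<close>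

locale map_ring = curvature_ring D G \<Gamma>
  for D :: "'m::finite \<Rightarrow> 'a::comm_ring_1 \<Rightarrow> 'a" and G :: "'a^'m^'m" and \<Gamma> :: "'m \<Rightarrow> 'a^'m^'m" +
  fixes K :: "'a^'n::finite^'n" and f :: "'a^'n" and \<omega> :: "'m \<Rightarrow> 'a^'n^'n"
  assumes K_sym: "transpose K = K"
    and D_K: "derivation.mat_d (D i) K = transpose (\<omega> i) ** K + K ** \<omega> i"
    and torsion: "\<omega> i *v derivation.vec_d (D j) f = \<omega> j *v derivation.vec_d (D i) f"
begin

definition ip :: "'a^'n \<Rightarrow> 'a^'n \<Rightarrow> 'a" where
  "ip V W = dotp V (K *v W)"

definition F :: "'m \<Rightarrow> 'a^'n" where
  "F i = D.vec_d i f"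

text \<open>The pulled-back connection on the bundle \<phi>*TN. With it, \<open>hess\<close> is the
  second fundamental form, \<open>tens\<close> the tension field, and \<open>energy\<close> is
  |\<nabla>\<phi>|^2.\<close>

definition nab :: "'m \<Rightarrow> 'a^'n \<Rightarrow> 'a^'n" where
  "nab i V = D.vec_d i V + \<omega> i *v V"

definition hess :: "'m \<Rightarrow> 'm \<Rightarrow> 'a^'n" where
  "hess i j = nab i (F j) - (\<Sum>l\<in>UNIV. \<Gamma> i $ l $ j *s F l)"

definition tens :: "'a^'n" where
  "tens = (\<Sum>i\<in>UNIV. \<Sum>j\<in>UNIV. G $ i $ j *s hess i j)"

definition P :: "'a^'m^'m" where
  "P = (\<chi> i j. ip (F i) (F j))"

definition energy :: 'a where
  "energy = trace (P ** G)"

lemma P_nth: "P $ i $ j = ip (F i) (F j)"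
  by (simp add: P_def)

lemma ip_commute: "ip V W = ip W V"
  by (metis K_sym dotp_commute dotp_transpose ip_def)

lemma P_sym: "P $ i $ j = P $ j $ i"
  by (simp add: P_nth ip_commute)

lemma ip_linear: "ip (c *s V) W = c * ip V W" "ip (\<Sum>i\<in>X. U i) W = (\<Sum>i\<in>X. ip (U i) W)"
  "ip (V - V') W = ip V W - ip V' W"
  by (simp_all add: ip_def dotp_scale dotp_sum dotp_diff)

lemma D_ip: "D i (ip V W) = ip (nab i V) W + ip V (nab i W)"
  unfolding ip_def nab_def by (rule D.d_bilinear[OF D_K])

text \<open>Freedom from torsion of the target connection; it is the symmetry of the second
  fundamental form before the symmetric \<Gamma>-term is subtracted.\<close>

lemma nab_F: "nab i (F j) = nab j (F i)"
  by (simp add: nab_def F_def torsion[of i j] vec_eq_iff D_commute)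

lemma trace_G: "trace (b ** G) = (\<Sum>i\<in>UNIV. \<Sum>j\<in>UNIV. G $ i $ j * b $ i $ j)"
  by (simp add: trace_def matrix_matrix_mult_def mult.commute G_sym')

lemma ip_tens: "ip tens V = (\<Sum>i\<in>UNIV. \<Sum>j\<in>UNIV. G $ i $ j *
    (ip (nab i (F j)) V - (\<Sum>l\<in>UNIV. \<Gamma> i $ l $ j * ip (F l) V)))"
  by (simp add: tens_def hess_def ip_linear right_diff_distrib)

text \<open>Product rule for the divergence of the one-form <\<nabla>\<phi>, V>. It is used with
  \<open>V = F j\<close> for the stress-energy tensor and with \<open>V = tens\<close> in the
  evolution equation.\<close>

lemma div_X: "(\<Sum>i\<in>UNIV. \<Sum>p\<in>UNIV. G $ i $ p *
    (D i (ip (F p) V) - (\<Sum>l\<in>UNIV. \<Gamma> i $ l $ p * ip (F l) V)))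
    = ip tens V + (\<Sum>i\<in>UNIV. \<Sum>p\<in>UNIV. G $ i $ p * ip (F p) (nab i V))"
  by (simp add: ip_tens D_ip algebra_simps sum.distrib sum_subtractf)

lemma sum_G_swap: "(\<Sum>i\<in>UNIV. \<Sum>p\<in>UNIV. G $ i $ p * X p i) = (\<Sum>i\<in>UNIV. \<Sum>p\<in>UNIV. G $ i $ p * X i p)"
  by (subst sum.swap) (simp add: G_sym')

text \<open>The product rule leaves tr <\<nabla>\<phi>, \<nabla>\<nabla>_j\<phi>>; by
  \<open>nab_F\<close> the two derivatives may be exchanged, which makes it half the derivative of
  the energy. The \<Gamma>-term \<open>Z\<close> arises both from the divergence and from
  differentiating \<open>G\<close> in the energy.\<close>

lemma stress_energy: "2 * div_mixed (P ** G) j = D j energy + 2 * ip tens (F j)"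
proof -
  have PG: "(P ** G) $ a $ i = (\<Sum>p\<in>UNIV. G $ i $ p * ip (F p) (F a))" for a i
    by (simp add: matrix_matrix_mult_def P_nth mult.commute ip_commute[of "F a"] G_sym'[of i])
  define Y where "Y = (\<Sum>i\<in>UNIV. \<Sum>p\<in>UNIV. G $ i $ p * ip (F p) (nab j (F i)))"
  define Z where "Z = (\<Sum>i\<in>UNIV. \<Sum>p\<in>UNIV. \<Gamma> j $ i $ p * (P ** G) $ i $ p)"
  have "div_mixed (P ** G) j = div_vec (\<lambda>i. \<Sum>p\<in>UNIV. G $ i $ p * ip (F p) (F j)) - Z"
    unfolding div_mixed_def div_vec_def Z_def by (simp add: PG)
  then have 1: "div_mixed (P ** G) j = ip tens (F j) + Y - Z"
    unfolding div_vec_raise div_X Y_def by (simp add: nab_F[of _ j])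
  have "D j energy = (\<Sum>i\<in>UNIV. \<Sum>p\<in>UNIV. D j (G $ i $ p) * P $ i $ p)
      + (\<Sum>i\<in>UNIV. \<Sum>p\<in>UNIV. G $ i $ p * D j (P $ i $ p))"
    by (simp add: energy_def trace_G D.rules sum.distrib)
  also have "(\<Sum>i\<in>UNIV. \<Sum>p\<in>UNIV. G $ i $ p * D j (P $ i $ p)) = Y + Y"
  proof -
    have "(\<Sum>i\<in>UNIV. \<Sum>p\<in>UNIV. G $ i $ p * D j (P $ i $ p))
      = (\<Sum>i\<in>UNIV. \<Sum>p\<in>UNIV. G $ i $ p * ip (F i) (nab j (F p))) + Y"
      by (simp add: P_nth D_ip distrib_left sum.distrib Y_def ip_commute add.commute)
    then show ?thesis
      unfolding Y_def by (subst (asm) sum_G_swap[symmetric])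
  qed
  also have "(\<Sum>i\<in>UNIV. \<Sum>p\<in>UNIV. D j (G $ i $ p) * P $ i $ p) = - (Z + Z)"
  proof -
    have a: "(\<Sum>i\<in>UNIV. \<Sum>p\<in>UNIV. (\<Sum>q\<in>UNIV. \<Gamma> j $ i $ q * G $ q $ p) * P $ i $ p) = Z"
      unfolding Z_def
      by (simp add: matrix_matrix_mult_def sum_distrib_left sum_distrib_right)
        (subst sum_swap23, simp add: mult_ac G_sym')
    have b: "(\<Sum>i\<in>UNIV. \<Sum>p\<in>UNIV. (\<Sum>q\<in>UNIV. \<Gamma> j $ p $ q * G $ i $ q) * P $ i $ p) = Z"
      unfolding a[symmetric] by (subst sum.swap) (simp add: G_sym' P_sym)
    show ?thesis
      by (simp only: D_G_nth left_diff_distrib minus_mult_left[symmetric] sum_subtractf sum_negf a b) simp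
  qed
  finally show ?thesis
    by (simp add: 1 algebra_simps)
qed

end

section \<open>The coupled flow and the evolution equation of \<open>Sc\<close>\<close>

locale rh_ring = metric_flow_ring D G \<Gamma> Dt g S + map_ring D G \<Gamma> K f \<omega>
  for D :: "'m::finite \<Rightarrow> 'a::comm_ring_1 \<Rightarrow> 'a" and G \<Gamma> Dt g S
    and K :: "'a^'n::finite^'n" and f \<omega> +
  fixes \<omega>t :: "'a^'n^'n" and \<alpha> :: 'a
  assumes Dt_K: "derivation.mat_d Dt K = transpose \<omega>t ** K + K ** \<omega>t"
    and torsion_t: "\<omega>t *v derivation.vec_d (D j) f = \<omega> j *v derivation.vec_d Dt f"
    and D_\<alpha>: "D i \<alpha> = 0"
    and S_def: "S $ i $ j = ric $ i $ j - \<alpha> * P $ i $ j"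
    and Dt_f: "Dt.vec_d f = tens"
begin

lemma div_S: "2 * div_mixed (S ** G) j = D j Sc - 2 * (\<alpha> * ip tens (F j))"
proof -
  have SG: "(S ** G) $ i $ p = ricm $ i $ p - \<alpha> * (P ** G) $ i $ p" for i p
    by (simp add: ricm_def matrix_matrix_mult_def S_def left_diff_distrib sum_subtractf sum_distrib_left mult.assoc)
  have "Sc = trace ricm - \<alpha> * energy"
    by (simp add: Sc_def energy_def trace_def SG sum_subtractf sum_distrib_left)
  then have Sc: "D j Sc = D j (trace ricm) - \<alpha> * D j energy"
    by (simp add: D.rules D_\<alpha>)
  have "div_mixed (S ** G) j = div_mixed ricm j - \<alpha> * div_mixed (P ** G) j"
    unfolding div_mixed_def SG
    by (simp add: D.rules D_\<alpha> right_diff_distrib distrib_left sum_subtractf sum_distrib_left mult_ac)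
  then have "2 * div_mixed (S ** G) j = 2 * div_mixed ricm j - \<alpha> * (2 * div_mixed (P ** G) j)"
    by (simp only: right_diff_distrib mult.left_commute[of 2])
  then show ?thesis
    by (simp only: contracted_bianchi stress_energy Sc distrib_left) (simp add: algebra_simps)
qed

text \<open>\<open>T_trace\<close> and \<open>Dt_trace_\<Gamma>\<close> contribute the gradient of
  \<open>Sc\<close> once each; twice the divergence of \<open>S\<close> takes one of them back and,
  by \<open>div_S\<close>, adds the coupling term.\<close>

lemma Wv_eq: "Wv i = (\<Sum>j\<in>UNIV. G $ i $ j * (D j Sc + 2 * \<alpha> * ip (F j) tens))"
proof -
  have "2 * div_up (G ** S ** G) i = (\<Sum>j\<in>UNIV. G $ i $ j * (2 * div_mixed (S ** G) j))"
    by (simp add: div_up_raise[OF S_sym] sum_distrib_left mult_ac)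
  then show ?thesis
    unfolding Wv_def T_trace Dt_trace_\<Gamma> div_S
    by (simp add: sum_negf right_diff_distrib distrib_left sum_subtractf sum.distrib ip_commute[of tens] mult_ac)
qed

text \<open>\<open>\<omega>t\<close> is the pulled-back connection in the time direction, so
  \<open>torsion_t\<close> exchanges the time and space derivatives of \<phi> itself. No second
  covariant derivatives are commuted, hence no target curvature appears.\<close>

lemma nabt_F: "Dt.vec_d (F j) + \<omega>t *v F j = nab j tens"
  by (simp add: F_def torsion_t Dt_f nab_def) (simp add: vec_eq_iff Dt_D Dt_f[symmetric])

lemma Dt_P: "(\<Sum>j\<in>UNIV. \<Sum>k\<in>UNIV. G $ j $ k * Dt (P $ j $ k))
    = 2 * (\<Sum>j\<in>UNIV. \<Sum>k\<in>UNIV. G $ j $ k * ip (F k) (nab j tens))"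
proof -
  have "Dt (P $ j $ k) = ip (F k) (nab j tens) + ip (F j) (nab k tens)" for j k
    unfolding P_nth ip_def[of "F j" "F k"] Dt.d_bilinear[OF Dt_K] nabt_F
    by (simp add: ip_def[symmetric] ip_commute[of "nab j tens"])
  then show ?thesis
    by (simp add: distrib_left sum.distrib sum_G_swap[of "\<lambda>k j. ip (F k) (nab j tens)", symmetric])
qed

text \<open>The divergence of \<open>Wv\<close> yields the Laplacian, 2 \<alpha> |\<tau>|^2, and 2
  \<alpha> tr <\<nabla>\<phi>, \<nabla>\<tau>>; the last term cancels against \<open>Dt_P\<close>.
  Differentiating the inverse metric in the trace yields the square of \<open>S\<close>.\<close>

theorem evolution: "Dt Sc = (\<Sum>i\<in>UNIV. \<Sum>j\<in>UNIV. G $ i $ j * (D i (D j Sc) - (\<Sum>l\<in>UNIV. \<Gamma> i $ l $ j * D l Sc)))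
    + 2 * trace (S ** G ** S ** G) + 2 * \<alpha> * ip tens tens - Dt \<alpha> * energy"
proof -
  have "Dt Sc = trace (Dt.mat_d S ** G) + trace (S ** Dt.mat_d G)"
    by (simp only: Sc_def Dt.trace_mat_d Dt.mat_d_mult trace_add)
  also have "trace (S ** Dt.mat_d G) = 2 * trace (S ** G ** S ** G)"
    by (simp only: Dt_G matrix_ring_simps trace_add mult_2)
  also have "trace (Dt.mat_d S ** G) = (\<Sum>j\<in>UNIV. \<Sum>k\<in>UNIV. G $ j $ k * Dt (ric $ j $ k))
      - Dt \<alpha> * energy - \<alpha> * (\<Sum>j\<in>UNIV. \<Sum>k\<in>UNIV. G $ j $ k * Dt (P $ j $ k))"
    unfolding trace_G energy_def
    by (simp add: S_def Dt.rules right_diff_distrib distrib_left sum_subtractf sum.distrib sum_distrib_left mult_ac)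
  also have "(\<Sum>j\<in>UNIV. \<Sum>k\<in>UNIV. G $ j $ k * Dt (ric $ j $ k)) = div_vec Wv"
    by (rule palatini)
  also have "Wv = (\<lambda>i. \<Sum>j\<in>UNIV. G $ i $ j * (D j Sc + 2 * \<alpha> * ip (F j) tens))"
    by (simp add: fun_eq_iff Wv_eq)
  also have "div_vec \<dots> = (\<Sum>i\<in>UNIV. \<Sum>j\<in>UNIV. G $ i $ j * (D i (D j Sc) - (\<Sum>l\<in>UNIV. \<Gamma> i $ l $ j * D l Sc)))
     + 2 * \<alpha> * (\<Sum>i\<in>UNIV. \<Sum>j\<in>UNIV. G $ i $ j * (D i (ip (F j) tens) - (\<Sum>l\<in>UNIV. \<Gamma> i $ l $ j * ip (F l) tens)))"
  proof -
    have dd: "D i (2 * (\<alpha> * x)) = 2 * (\<alpha> * D i x)" for i x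
      by (simp only: mult_2 D.rules D_\<alpha>) simp
    show ?thesis
      unfolding div_vec_raise mult.assoc D.add dd
      by (simp add: right_diff_distrib distrib_left sum_subtractf sum.distrib sum_distrib_left mult_ac)
  qed
  finally show ?thesis
    unfolding div_X Dt_P by (simp add: algebra_simps)
qed

end

section \<open>Smooth functions\<close>

declare Ck_on.simps(2) [simp del]

lemma frechet_derivative_open:
  assumes "open S" "x \<in> S"
  shows "frechet_derivative f (at x within S) = frechet_derivative f (at x)"
  by (simp add: at_within_open[OF assms(2,1)])

lemma Ck_on_cong:
  assumes "open S" "\<And>x. x \<in> S \<Longrightarrow> f x = h x"
  shows "Ck_on k S f \<longleftrightarrow> Ck_on k S h"
  using assms(2)
proof (induction k arbitrary: f h)
  case 0
  then show ?case by (auto intro: continuous_on_eq)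
next
  case (Suc k)
  have d: "(f has_derivative F) (at x within S) \<longleftrightarrow> (h has_derivative F) (at x within S)" if "x \<in> S" for x F
    using has_derivative_transform[OF that, of h f F] has_derivative_transform[OF that, of f h F] Suc.prems
    by auto
  then have "f differentiable_on S \<longleftrightarrow> h differentiable_on S"
    by (auto simp: differentiable_on_def differentiable_def)
  moreover have "frechet_derivative f (at x within S) = frechet_derivative h (at x within S)" if "x \<in> S" for x
    unfolding frechet_derivative_def using d[OF that] by simp
  ultimately show ?case
    unfolding Ck_on.simps
    using Suc.IH[of "\<lambda>x. frechet_derivative f (at x within S) b" "\<lambda>x. frechet_derivative h (at x within S) b" for b]
    by auto
qed

lemma Ck_on_Suc_open:
  assumes "open S"
  shows "Ck_on (Suc k) S f \<longleftrightarrow> (\<forall>x\<in>S. f differentiable at x) \<and>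
    (\<forall>b\<in>Basis. Ck_on k S (\<lambda>x. frechet_derivative f (at x) b))"
proof -
  have "Ck_on k S (\<lambda>x. frechet_derivative f (at x within S) b) \<longleftrightarrow> Ck_on k S (\<lambda>x. frechet_derivative f (at x) b)" for b
    by (rule Ck_on_cong[OF assms]) (simp add: frechet_derivative_open[OF assms])
  then show ?thesis
    by (simp add: Ck_on.simps differentiable_on_eq_differentiable_at[OF assms])
qed

text \<open>Allows any explicit formula for the derivative, so that the closure properties below
  follow by induction on the order.\<close>

lemma Ck_on_SucI:
  assumes "open S" "\<And>x. x \<in> S \<Longrightarrow> (f has_derivative f' x) (at x)"
    "\<And>b. b \<in> Basis \<Longrightarrow> Ck_on k S (\<lambda>x. f' x b)"
  shows "Ck_on (Suc k) S f"
  unfolding Ck_on_Suc_open[OF assms(1)]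
proof (intro conjI ballI)
  fix b :: 'a assume b: "b \<in> Basis"
  have "Ck_on k S (\<lambda>x. frechet_derivative f (at x) b) \<longleftrightarrow> Ck_on k S (\<lambda>x. f' x b)"
    by (rule Ck_on_cong[OF assms(1)]) (metis assms(2) frechet_derivative_at)
  then show "Ck_on k S (\<lambda>x. frechet_derivative f (at x) b)"
    using assms(3)[OF b] by simp
qed (use assms(2) differentiableI in blast)

lemma Ck_on_SucD:
  assumes "open S" "Ck_on (Suc k) S f"
  shows "x \<in> S \<Longrightarrow> (f has_derivative frechet_derivative f (at x)) (at x)"
    and "b \<in> Basis \<Longrightarrow> Ck_on k S (\<lambda>x. frechet_derivative f (at x) b)"
  using assms by (auto simp: Ck_on_Suc_open frechet_derivative_works)

lemma Ck_on_mono: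
  assumes "open S" "Ck_on (Suc k) S f"
  shows "Ck_on k S f"
  using assms(2)
proof (induction k arbitrary: f)
  case 0
  then show ?case by (simp add: Ck_on.simps differentiable_imp_continuous_on)
next
  case (Suc k)
  then show ?case
    unfolding Ck_on_Suc_open[OF assms(1), of "Suc k"] Ck_on_Suc_open[OF assms(1), of k] by blast
qed

text \<open>The passage from a set such as [0,T) x V, with one-sided derivatives at the initial
  time, to an open subset, where derivatives within the set are ordinary ones.\<close>

lemma Ck_on_subset:
  assumes "open U" "U \<subseteq> S" "Ck_on k S f"
  shows "Ck_on k U f"
  using assms(3)
proof (induction k arbitrary: f)
  case 0
  then show ?case using assms(2) by (auto intro: continuous_on_subset)
next
  case (Suc k)
  have at: "at x within S = at x" if "x \<in> U" for x
    using that assms(1,2) interior_maximal by (intro at_within_interior) blast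
  show ?case
    unfolding Ck_on_Suc_open[OF assms(1)]
  proof (intro conjI ballI)
    show "f differentiable at x" if "x \<in> U" for x
    proof -
      have "f differentiable at x within S"
        using Suc.prems that assms(2) unfolding Ck_on.simps differentiable_on_def by auto
      then show ?thesis
        unfolding at[OF that] .
    qed
    fix b :: 'a assume "b \<in> Basis"
    then have "Ck_on k U (\<lambda>x. frechet_derivative f (at x within S) b)"
      using Suc by (simp add: Ck_on.simps)
    then show "Ck_on k U (\<lambda>x. frechet_derivative f (at x) b)"
      using Ck_on_cong[OF assms(1)] at by (metis (no_types, lifting))
  qed
qed

lemma Ck_on_const: "open S \<Longrightarrow> Ck_on k S (\<lambda>x. c)"
proof (induction k arbitrary: c)
  case (Suc k)
  show ?case
    by (rule Ck_on_SucI[OF Suc.prems, where f'="\<lambda>x h. 0"]) (use Suc in auto)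
qed simp

lemma Ck_on_bounded_linear:
  assumes "open S" "bounded_linear L" "Ck_on k S f"
  shows "Ck_on k S (\<lambda>x. L (f x))"
  using assms(3)
proof (induction k arbitrary: f)
  case 0
  then show ?case using assms(2) by (auto intro: bounded_linear.continuous_on)
next
  case (Suc k)
  note f = Ck_on_SucD[OF assms(1) Suc.prems]
  show ?case
    by (rule Ck_on_SucI[OF assms(1) bounded_linear.has_derivative[OF assms(2) f(1)] Suc.IH[OF f(2)]])
qed

lemma Ck_on_linear: "open S \<Longrightarrow> bounded_linear L \<Longrightarrow> Ck_on k S L"
proof (cases k)
  case (Suc j)
  assume "open S" "bounded_linear L"
  then show ?thesis unfolding Suc
    by (intro Ck_on_SucI[where f'="\<lambda>x. L"] Ck_on_const) (auto simp: bounded_linear_imp_has_derivative)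
qed (simp add: linear_continuous_on)

lemma Ck_on_add:
  assumes "open S" "Ck_on k S f" "Ck_on k S h"
  shows "Ck_on k S (\<lambda>x. f x + h x)"
  using assms(2,3)
proof (induction k arbitrary: f h)
  case 0
  then show ?case by (auto intro: continuous_intros)
next
  case (Suc k)
  show ?case
    by (rule Ck_on_SucI[OF assms(1), where f'="\<lambda>x b. frechet_derivative f (at x) b + frechet_derivative h (at x) b"])
      (use Suc Ck_on_SucD[OF assms(1) Suc.prems(1)] Ck_on_SucD[OF assms(1) Suc.prems(2)] in
        \<open>auto intro: has_derivative_add\<close>)
qed

lemma Ck_on_mult:
  fixes f h :: "_ \<Rightarrow> real"
  assumes "open S" "Ck_on k S f" "Ck_on k S h"
  shows "Ck_on k S (\<lambda>x. f x * h x)"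
  using assms(2,3)
proof (induction k arbitrary: f h)
  case 0
  then show ?case by (auto intro: continuous_intros)
next
  case (Suc k)
  note f = Ck_on_SucD[OF assms(1) Suc.prems(1)] and h = Ck_on_SucD[OF assms(1) Suc.prems(2)]
  have m: "Ck_on k S f" "Ck_on k S h"
    using Suc.prems Ck_on_mono[OF assms(1)] by auto
  show ?case
  proof (rule Ck_on_SucI[OF assms(1), where f'="\<lambda>x b. f x * frechet_derivative h (at x) b + frechet_derivative f (at x) b * h x"])
    show "Ck_on k S (\<lambda>x. f x * frechet_derivative h (at x) b + frechet_derivative f (at x) b * h x)"
      if "b \<in> Basis" for b
      by (intro Ck_on_add[OF assms(1)] Suc.IH m f(2) h(2) that)
  qed (intro has_derivative_mult f(1) h(1), assumption+)
qed

lemma Ck_on_sum: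
  assumes "open S" "\<And>i. i \<in> I \<Longrightarrow> Ck_on k S (f i)"
  shows "Ck_on k S (\<lambda>x. \<Sum>i\<in>I. f i x)"
  using assms(2)
  by (induction I rule: infinite_finite_induct) (auto intro: Ck_on_const[OF assms(1)] Ck_on_add[OF assms(1)])

lemma Ck_on_inverse:
  fixes f :: "_ \<Rightarrow> real"
  assumes "open S" "\<And>x. x \<in> S \<Longrightarrow> f x \<noteq> 0" "Ck_on k S f"
  shows "Ck_on k S (\<lambda>x. inverse (f x))"
  using assms(3)
proof (induction k)
  case 0
  then show ?case using assms(2) by (auto intro: continuous_intros)
next
  case (Suc k)
  have "Ck_on k S (\<lambda>x. inverse (f x))"
    using Suc Ck_on_mono[OF assms(1)] by blast
  then have "Ck_on k S (\<lambda>x. - 1 * (inverse (f x) * frechet_derivative f (at x) b * inverse (f x)))"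
    if "b \<in> Basis" for b
    by (intro Ck_on_mult Ck_on_const assms(1) Ck_on_SucD(2)[OF assms(1) Suc.prems that])
  then show ?case
    by (intro Ck_on_SucI[OF assms(1), where f'="\<lambda>x b. - (inverse (f x) * frechet_derivative f (at x) b * inverse (f x))"])
      (use assms(2) Ck_on_SucD(1)[OF assms(1) Suc.prems] has_derivative_inverse in auto)
qed

text \<open>The chain rule as a sum over partial derivatives: each summand is a product to which the
  induction hypothesis of \<open>Ck_on_compose\<close> applies.\<close>

lemma derivative_compose_basis:
  fixes F :: "'f::euclidean_space \<Rightarrow> real"
  assumes "(f has_derivative f') (at x)" "(F has_derivative F') (at (f x))"
  shows "((\<lambda>x. F (f x)) has_derivative (\<lambda>b. \<Sum>c\<in>Basis. (f' b \<bullet> c) * F' c)) (at x)"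
proof -
  have "F' y = (\<Sum>c\<in>Basis. (y \<bullet> c) * F' c)" for y
  proof -
    have "linear F'"
      using assms(2) has_derivative_linear by blast
    then have "F' (\<Sum>c\<in>Basis. (y \<bullet> c) *\<^sub>R c) = (\<Sum>c\<in>Basis. (y \<bullet> c) * F' c)"
      by (simp add: linear_sum linear_scale)
    then show ?thesis by (simp add: euclidean_representation)
  qed
  then show ?thesis
    using has_derivative_compose[OF assms] by (metis (no_types, lifting) ext)
qed

lemma Ck_on_compose:
  fixes F :: "'f::euclidean_space \<Rightarrow> real"
  assumes "open S" "open V" "\<And>x. x \<in> S \<Longrightarrow> f x \<in> V" "Ck_on k V F" "Ck_on k S f"
  shows "Ck_on k S (\<lambda>x. F (f x))"
  using assms(4,5)
proof (induction k arbitrary: F)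
  case 0
  then show ?case using assms(3) by (auto intro: continuous_on_compose2)
next
  case (Suc k)
  note F = Ck_on_SucD[OF assms(2) Suc.prems(1)]
  note f = Ck_on_SucD[OF assms(1) Suc.prems(2)]
  show ?case
  proof (rule Ck_on_SucI[OF assms(1), where
      f'="\<lambda>x b. \<Sum>c\<in>Basis. (frechet_derivative f (at x) b \<bullet> c) * frechet_derivative F (at (f x)) c"])
    show "Ck_on k S (\<lambda>x. \<Sum>c\<in>Basis. (frechet_derivative f (at x) b \<bullet> c) * frechet_derivative F (at (f x)) c)"
      if "b \<in> Basis" for b
      by (intro Ck_on_sum Ck_on_mult assms(1) Suc.IH F(2) Ck_on_mono[OF assms(1) Suc.prems(2)]
          Ck_on_bounded_linear[OF _ bounded_linear_inner_left] f(2) that)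
  qed (intro derivative_compose_basis f(1) F(1) assms(3), assumption+)
qed

lemma has_derivative_along:
  "(F has_derivative F') (at (z s)) \<Longrightarrow> (z has_derivative z') (at s within A) \<Longrightarrow>
    ((\<lambda>s. F (z s)) has_derivative (\<lambda>r. F' (z' r))) (at s within A)"
  by (rule has_derivative_compose)

section \<open>Symmetry of second derivatives\<close>

text \<open>Schwarz: one and the same second difference quotient tends to both iterated derivatives.\<close>

lemma mixed_difference:
  fixes f :: "'e::euclidean_space \<Rightarrow> real"
  assumes S: "open S" and f: "\<And>y. y \<in> S \<Longrightarrow> (f has_derivative f' y) (at y)"
    and fv: "\<And>y. y \<in> S \<Longrightarrow> ((\<lambda>y. f' y v) has_derivative f'' y) (at y)"
    and h: "0 < h" and sub: "\<And>s t. s \<in> {0..h} \<Longrightarrow> t \<in> {0..h} \<Longrightarrow> x + s *\<^sub>R v + t *\<^sub>R w \<in> S"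
  shows "\<exists>s\<in>{0..h}. \<exists>t\<in>{0..h}. f (x + h *\<^sub>R v + h *\<^sub>R w) - f (x + h *\<^sub>R v) - f (x + h *\<^sub>R w) + f x
           = h * h * f'' (x + s *\<^sub>R v + t *\<^sub>R w) w"
proof -
  \<comment> \<open>The mean value theorem is applied twice: to \<open>p\<close> in the direction
    \<open>v\<close>, then to the increment \<open>q\<close> of the \<open>v\<close>-derivative in
    the direction \<open>w\<close>.\<close>
  define p where "p s = f (x + s *\<^sub>R v + h *\<^sub>R w) - f (x + s *\<^sub>R v)" for s
  have lin: "linear (f' y)" if "y \<in> S" for y
    using f[OF that] has_derivative_linear by blast
  have dp: "(p has_derivative (\<lambda>r. r * (f' (x + s *\<^sub>R v + h *\<^sub>R w) v - f' (x + s *\<^sub>R v) v))) (at s within {0..h})"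
    if s: "s \<in> {0..h}" for s
  proof -
    have S1: "x + s *\<^sub>R v + h *\<^sub>R w \<in> S" and S2: "x + s *\<^sub>R v \<in> S"
      using sub[OF s, of h] sub[OF s, of 0] h by auto
    have "((\<lambda>s. f (x + s *\<^sub>R v + h *\<^sub>R w)) has_derivative (\<lambda>r. f' (x + s *\<^sub>R v + h *\<^sub>R w) (r *\<^sub>R v))) (at s within {0..h})"
      by (rule has_derivative_along[where z="\<lambda>s. x + s *\<^sub>R v + h *\<^sub>R w", OF f[OF S1]]) (auto intro!: derivative_eq_intros)
    moreover have "((\<lambda>s. f (x + s *\<^sub>R v)) has_derivative (\<lambda>r. f' (x + s *\<^sub>R v) (r *\<^sub>R v))) (at s within {0..h})"
      by (rule has_derivative_along[where z="\<lambda>s. x + s *\<^sub>R v", OF f[OF S2]]) (auto intro!: derivative_eq_intros)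
    ultimately show ?thesis
      unfolding p_def using lin[OF S1] lin[OF S2]
      by (auto intro!: derivative_eq_intros simp: linear_scale algebra_simps)
  qed
  obtain s where s: "s \<in> {0<..<h}" and ps: "p h - p 0 = h * (f' (x + s *\<^sub>R v + h *\<^sub>R w) v - f' (x + s *\<^sub>R v) v)"
    using mvt_simple[OF h, of p "\<lambda>s r. r * (f' (x + s *\<^sub>R v + h *\<^sub>R w) v - f' (x + s *\<^sub>R v) v)"] dp by auto
  have s': "s \<in> {0..h}" using s by auto
  define q where "q t = f' (x + s *\<^sub>R v + t *\<^sub>R w) v" for t
  have dq: "(q has_derivative (\<lambda>r. r * f'' (x + s *\<^sub>R v + t *\<^sub>R w) w)) (at t within {0..h})"
    if t: "t \<in> {0..h}" for t
  proof -
    have S1: "x + s *\<^sub>R v + t *\<^sub>R w \<in> S"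
      using sub[OF s' t] .
    have "(q has_derivative (\<lambda>r. f'' (x + s *\<^sub>R v + t *\<^sub>R w) (r *\<^sub>R w))) (at t within {0..h})"
      unfolding q_def
      by (rule has_derivative_along[where z="\<lambda>t. x + s *\<^sub>R v + t *\<^sub>R w", OF fv[OF S1]]) (auto intro!: derivative_eq_intros)
    moreover have "linear (f'' (x + s *\<^sub>R v + t *\<^sub>R w))"
      using fv[OF S1] has_derivative_linear by blast
    ultimately show ?thesis by (simp add: linear_scale)
  qed
  obtain t where t: "t \<in> {0<..<h}" and qt: "q h - q 0 = h * f'' (x + s *\<^sub>R v + t *\<^sub>R w) w"
    using mvt_simple[OF h, of q "\<lambda>t r. r * f'' (x + s *\<^sub>R v + t *\<^sub>R w) w"] dq by auto
  have "p h - p 0 = h * h * f'' (x + s *\<^sub>R v + t *\<^sub>R w) w"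
    using ps qt by (simp add: q_def)
  then show ?thesis
    using s t by (intro bexI[of _ s] bexI[of _ t]) (auto simp: p_def)
qed

lemma mixed_limit:
  fixes f :: "'e::euclidean_space \<Rightarrow> real"
  assumes S: "open S" "x \<in> S" and f: "\<And>y. y \<in> S \<Longrightarrow> (f has_derivative f' y) (at y)"
    and fv: "\<And>y. y \<in> S \<Longrightarrow> ((\<lambda>y. f' y v) has_derivative f'' y) (at y)"
    and cont: "continuous_on S (\<lambda>y. f'' y w)"
  shows "((\<lambda>h. (f (x + h *\<^sub>R v + h *\<^sub>R w) - f (x + h *\<^sub>R v) - f (x + h *\<^sub>R w) + f x) / (h * h))
           \<longlongrightarrow> f'' x w) (at_right 0)"
  unfolding tendsto_iff
proof (intro allI impI)
  fix e :: real assume e: "0 < e"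
  have "isCont (\<lambda>y. f'' y w) x"
    using cont S continuous_on_eq_continuous_at by blast
  then obtain d1 where d1: "0 < d1" "\<And>y. dist y x < d1 \<Longrightarrow> dist (f'' y w) (f'' x w) < e"
    using e unfolding continuous_at_eps_delta by blast
  obtain d2 where d2: "0 < d2" "ball x d2 \<subseteq> S"
    using S openE by blast
  \<comment> \<open>Parallelograms with coefficients below \<open>d\<close> stay inside both balls;
    the summand 1 keeps the denominator positive when \<open>v\<close> and \<open>w\<close>
    vanish.\<close>
  define d where "d = min d1 d2 / (norm v + norm w + 1)"
  have nn: "0 < norm v + norm w + 1"
    by (simp add: add_nonneg_pos)
  have d: "0 < d"
    using d1 d2 nn by (simp add: d_def)
  have near: "dist (x + s *\<^sub>R v + t *\<^sub>R w) x < min d1 d2" if "0 \<le> s" "s < d" "0 \<le> t" "t < d" for s t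
  proof -
    have "dist (x + s *\<^sub>R v + t *\<^sub>R w) x \<le> s * norm v + t * norm w"
      using that by (simp add: dist_norm algebra_simps) (metis abs_of_nonneg norm_scaleR norm_triangle_ineq)
    also have "\<dots> \<le> d * norm v + d * norm w"
      using that by (intro add_mono mult_right_mono) auto
    also have "\<dots> < d * (norm v + norm w + 1)"
      using d by (simp add: algebra_simps)
    also have "\<dots> = min d1 d2"
      using nn by (simp add: d_def)
    finally show ?thesis .
  qed
  have "dist ((f (x + h *\<^sub>R v + h *\<^sub>R w) - f (x + h *\<^sub>R v) - f (x + h *\<^sub>R w) + f x) / (h * h)) (f'' x w) < e"
    if h: "0 < h" "h < d" for h
  proof -
    have "x + s *\<^sub>R v + t *\<^sub>R w \<in> S" if "s \<in> {0..h}" "t \<in> {0..h}" for s t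
      using near[of s t] that h d2(2) by (auto simp: dist_commute)
    from mixed_difference[OF S(1) f fv h(1) this] obtain s t where
      st: "s \<in> {0..h}" "t \<in> {0..h}"
        and eq: "f (x + h *\<^sub>R v + h *\<^sub>R w) - f (x + h *\<^sub>R v) - f (x + h *\<^sub>R w) + f x
           = h * h * f'' (x + s *\<^sub>R v + t *\<^sub>R w) w"
      by auto
    then show ?thesis
      using near[of s t] h d1(2) by (simp add: eq)
  qed
  then show "\<forall>\<^sub>F h in at_right 0. dist ((f (x + h *\<^sub>R v + h *\<^sub>R w) - f (x + h *\<^sub>R v) - f (x + h *\<^sub>R w) + f x) / (h * h)) (f'' x w) < e"
    using d eventually_at_right_field by blast
qed

lemma derivatives_commute:
  fixes f :: "'e::euclidean_space \<Rightarrow> real"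
  assumes "open S" "x \<in> S" "\<And>y. y \<in> S \<Longrightarrow> (f has_derivative f' y) (at y)"
    and "\<And>y. y \<in> S \<Longrightarrow> ((\<lambda>y. f' y v) has_derivative fv y) (at y)" "continuous_on S (\<lambda>y. fv y w)"
    and "\<And>y. y \<in> S \<Longrightarrow> ((\<lambda>y. f' y w) has_derivative fw y) (at y)" "continuous_on S (\<lambda>y. fw y v)"
  shows "fv x w = fw x v"
proof (rule tendsto_unique[OF trivial_limit_at_right_real])
  show "((\<lambda>h. (f (x + h *\<^sub>R v + h *\<^sub>R w) - f (x + h *\<^sub>R v) - f (x + h *\<^sub>R w) + f x) / (h * h)) \<longlongrightarrow> fv x w) (at_right 0)"
    by (rule mixed_limit[OF assms(1-5)])
  show "((\<lambda>h. (f (x + h *\<^sub>R v + h *\<^sub>R w) - f (x + h *\<^sub>R v) - f (x + h *\<^sub>R w) + f x) / (h * h)) \<longlongrightarrow> fw x v) (at_right 0)"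
    using mixed_limit[OF assms(1-3) assms(6,7)] by (simp add: algebra_simps)
qed

section \<open>Germs of smooth functions\<close>

definition smooth_near :: "('e::euclidean_space \<Rightarrow> 'b::real_normed_vector) \<Rightarrow> 'e \<Rightarrow> bool" where
  "smooth_near f z \<longleftrightarrow> (\<exists>U. open U \<and> z \<in> U \<and> smooth_on U f)"

lemma smooth_nearI: "open U \<Longrightarrow> z \<in> U \<Longrightarrow> smooth_on U f \<Longrightarrow> smooth_near f z"
  unfolding smooth_near_def by blast

lemma smooth_on_subset: "open U \<Longrightarrow> U \<subseteq> S \<Longrightarrow> smooth_on S f \<Longrightarrow> smooth_on U f"
  unfolding smooth_on_def using Ck_on_subset by blast

lemma smooth_near2:
  assumes "smooth_near f z" "smooth_near h z"
  obtains U where "open U" "z \<in> U" "smooth_on U f" "smooth_on U h"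
proof -
  obtain U V where "open U" "z \<in> U" "smooth_on U f" "open V" "z \<in> V" "smooth_on V h"
    using assms unfolding smooth_near_def by blast
  then show ?thesis
    by (intro that[of "U \<inter> V"]) (auto intro: smooth_on_subset[of _ U] smooth_on_subset[of _ V])
qed

lemma smooth_near_eventually:
  assumes "smooth_near f z"
  shows "\<forall>\<^sub>F y in nhds z. smooth_near f y"
proof -
  obtain U where U: "open U" "z \<in> U" "smooth_on U f"
    using assms unfolding smooth_near_def by blast
  then have "\<forall>y\<in>U. smooth_near f y"
    by (auto intro: smooth_nearI)
  then show ?thesis
    using U eventually_nhds by blast
qed

lemma smooth_near_transfer:
  assumes "smooth_near f z" "\<forall>\<^sub>F y in nhds z. f y = h y"
  shows "smooth_near h z"
proof -
  obtain U where U: "open U" "z \<in> U" "smooth_on U f"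
    using assms(1) unfolding smooth_near_def by blast
  obtain V where V: "open V" "z \<in> V" "\<And>y. y \<in> V \<Longrightarrow> f y = h y"
    using assms(2) unfolding eventually_nhds by blast
  have op: "open (U \<inter> V)"
    using U V by blast
  have "smooth_on (U \<inter> V) f"
    by (rule smooth_on_subset[OF op _ U(3)]) simp
  then have "smooth_on (U \<inter> V) h"
    unfolding smooth_on_def using Ck_on_cong[OF op, of f h] V(3) by simp
  then show ?thesis
    using U(2) V(2) by (intro smooth_nearI[OF op]) simp_all
qed

lemma smooth_near_cong:
  assumes ev: "\<forall>\<^sub>F y in nhds z. f y = h y"
  shows "smooth_near f z \<longleftrightarrow> smooth_near h z"
proof
  have "\<forall>\<^sub>F y in nhds z. h y = f y"
    using ev by (rule eventually_mono) simp
  then show "smooth_near h z \<Longrightarrow> smooth_near f z"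
    using smooth_near_transfer by blast
qed (rule smooth_near_transfer[OF _ ev])

lemma smooth_near_const [intro, simp]: "smooth_near (\<lambda>x. c) z"
  by (rule smooth_nearI[of UNIV]) (auto simp: smooth_on_def Ck_on_const)

lemma smooth_near_add [intro]:
  "smooth_near f z \<Longrightarrow> smooth_near h z \<Longrightarrow> smooth_near (\<lambda>x. f x + h x) z"
  by (erule (1) smooth_near2) (auto intro!: smooth_nearI Ck_on_add simp: smooth_on_def)

lemma smooth_near_mult [intro]:
  fixes f h :: "'e::euclidean_space \<Rightarrow> real"
  shows "smooth_near f z \<Longrightarrow> smooth_near h z \<Longrightarrow> smooth_near (\<lambda>x. f x * h x) z"
  by (erule (1) smooth_near2) (auto intro!: smooth_nearI Ck_on_mult simp: smooth_on_def)

lemma smooth_near_bounded_linear: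
  "bounded_linear L \<Longrightarrow> smooth_near f z \<Longrightarrow> smooth_near (\<lambda>x. L (f x)) z"
  unfolding smooth_near_def smooth_on_def by (blast intro: Ck_on_bounded_linear)

lemma smooth_near_linear: "bounded_linear L \<Longrightarrow> smooth_near L z"
  by (rule smooth_nearI[of UNIV]) (auto simp: smooth_on_def Ck_on_linear)

lemma smooth_near_minus [intro]: "smooth_near f z \<Longrightarrow> smooth_near (\<lambda>x. - f x) z"
  by (rule smooth_near_bounded_linear[OF bounded_linear_minus[OF bounded_linear_ident]])

lemma smooth_near_diff [intro]:
  "smooth_near f z \<Longrightarrow> smooth_near h z \<Longrightarrow> smooth_near (\<lambda>x. f x - h x) z"
  using smooth_near_add[OF _ smooth_near_minus] by force

lemma smooth_near_nth [intro]: "smooth_near f z \<Longrightarrow> smooth_near (\<lambda>x. f x $ i) z"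
  by (rule smooth_near_bounded_linear[OF bounded_linear_vec_nth])

lemma smooth_near_sum [intro]:
  assumes "\<And>i. i \<in> I \<Longrightarrow> smooth_near (f i) z"
  shows "smooth_near (\<lambda>x. \<Sum>i\<in>I. f i x) z"
  using assms by (induction I rule: infinite_finite_induct) auto

lemma smooth_near_prod [intro]:
  fixes f :: "_ \<Rightarrow> 'e::euclidean_space \<Rightarrow> real"
  assumes "\<And>i. i \<in> I \<Longrightarrow> smooth_near (f i) z"
  shows "smooth_near (\<lambda>x. \<Prod>i\<in>I. f i x) z"
  using assms by (induction I rule: infinite_finite_induct) auto

lemma smooth_near_isCont:
  assumes "smooth_near f z"
  shows "isCont f z"
proof -
  obtain U where "open U" "z \<in> U" "continuous_on U f"
    using assms unfolding smooth_near_def smooth_on_def by (metis Ck_on.simps(1))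
  then show ?thesis
    by (simp add: continuous_on_eq_continuous_at)
qed

lemma smooth_near_inverse [intro]:
  fixes f :: "'e::euclidean_space \<Rightarrow> real"
  assumes "smooth_near f z" "f z \<noteq> 0"
  shows "smooth_near (\<lambda>x. inverse (f x)) z"
proof -
  obtain U where U: "open U" "z \<in> U" "smooth_on U f"
    using assms unfolding smooth_near_def by blast
  then have "continuous_on U f"
    unfolding smooth_on_def by (metis Ck_on.simps(1))
  then have op: "open (U \<inter> f -` (- {0}))"
    using U(1) by (intro continuous_open_preimage) auto
  have "smooth_on (U \<inter> f -` (- {0})) f"
    by (rule smooth_on_subset[OF op _ U(3)]) auto
  then have "smooth_on (U \<inter> f -` (- {0})) (\<lambda>x. inverse (f x))"
    unfolding smooth_on_def using Ck_on_inverse[OF op] by blast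
  then show ?thesis
    using U(2) assms(2) by (intro smooth_nearI[OF op]) auto
qed

lemma smooth_near_compose:
  fixes F :: "'f::euclidean_space \<Rightarrow> real"
  assumes "smooth_near f z" "smooth_near F (f z)"
  shows "smooth_near (\<lambda>x. F (f x)) z"
proof -
  obtain U where U: "open U" "z \<in> U" "smooth_on U f"
    using assms unfolding smooth_near_def by blast
  obtain V where V: "open V" "f z \<in> V" "smooth_on V F"
    using assms unfolding smooth_near_def by blast
  have "continuous_on U f"
    using U(3) unfolding smooth_on_def by (metis Ck_on.simps(1))
  then have op: "open (U \<inter> f -` V)"
    using U(1) V(1) by (intro continuous_open_preimage)
  have "smooth_on (U \<inter> f -` V) f"
    by (rule smooth_on_subset[OF op _ U(3)]) auto
  then have "smooth_on (U \<inter> f -` V) (\<lambda>x. F (f x))"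
    using V(3) Ck_on_compose[OF op V(1)] unfolding smooth_on_def by blast
  then show ?thesis
    using U(2) V(2) by (intro smooth_nearI[OF op]) auto
qed

lemma smooth_near_derivative:
  assumes "smooth_near f z"
  shows "(f has_derivative frechet_derivative f (at z)) (at z)"
proof -
  obtain U where U: "open U" "z \<in> U" "smooth_on U f"
    using assms unfolding smooth_near_def by blast
  then show ?thesis
    unfolding smooth_on_def using Ck_on_SucD(1) by blast
qed

lemma frechet_derivative_eq:
  "(f has_derivative F) (at z) \<Longrightarrow> frechet_derivative f (at z) v = F v"
  by (metis frechet_derivative_at)

text \<open>\<open>Ck_on\<close> speaks of basis directions only; other directions follow from
  linearity of the derivative at all nearby points.\<close>

lemma smooth_near_derivI [intro]:
  fixes f :: "'e::euclidean_space \<Rightarrow> real"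
  assumes "smooth_near f z"
  shows "smooth_near (\<lambda>x. frechet_derivative f (at x) v) z"
proof -
  obtain U where U: "open U" "z \<in> U" "smooth_on U f"
    using assms unfolding smooth_near_def by blast
  have "smooth_near (\<lambda>x. frechet_derivative f (at x) b) z" if "b \<in> Basis" for b
  proof (rule smooth_nearI[OF U(1,2)])
    show "smooth_on U (\<lambda>x. frechet_derivative f (at x) b)"
      using Ck_on_SucD(2)[OF U(1) _ that] U(3) unfolding smooth_on_def by blast
  qed
  then have *: "smooth_near (\<lambda>x. \<Sum>b\<in>Basis. (v \<bullet> b) * frechet_derivative f (at x) b) z"
    by (intro smooth_near_sum smooth_near_mult smooth_near_const)
  have "frechet_derivative f (at x) v = (\<Sum>b\<in>Basis. (v \<bullet> b) * frechet_derivative f (at x) b)"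
    if "smooth_near f x" for x
  proof -
    have "linear (frechet_derivative f (at x))"
      using smooth_near_derivative[OF that] has_derivative_linear by blast
    then have "frechet_derivative f (at x) (\<Sum>b\<in>Basis. (v \<bullet> b) *\<^sub>R b) = (\<Sum>b\<in>Basis. (v \<bullet> b) * frechet_derivative f (at x) b)"
      by (simp add: linear_sum linear_scale)
    then show ?thesis by (simp add: euclidean_representation)
  qed
  then have "\<forall>\<^sub>F x in nhds z. frechet_derivative f (at x) v = (\<Sum>b\<in>Basis. (v \<bullet> b) * frechet_derivative f (at x) b)"
    by (rule eventually_mono[OF smooth_near_eventually[OF assms], rotated])
  from smooth_near_cong[OF this] * show ?thesis
    by simp
qed

lemma smooth_near_derivatives_commute:
  fixes f :: "'e::euclidean_space \<Rightarrow> real"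
  assumes "smooth_near f z"
  shows "frechet_derivative (\<lambda>x. frechet_derivative f (at x) v) (at z) w
       = frechet_derivative (\<lambda>x. frechet_derivative f (at x) w) (at z) v"
proof -
  obtain U where U: "open U" "z \<in> U" "smooth_on U f"
    using assms unfolding smooth_near_def by blast
  have n: "smooth_near f y" if "y \<in> U" for y
    using U that by (auto intro: smooth_nearI)
  show ?thesis
    using smooth_near_isCont[OF smooth_near_derivI[OF smooth_near_derivI[OF n]]]
    by (intro derivatives_commute[OF U(1,2) smooth_near_derivative])
      (auto intro!: smooth_near_derivative smooth_near_derivI n continuous_at_imp_continuous_on)
qed

lemma frechet_derivative_cong:
  assumes "\<forall>\<^sub>F y in nhds z. f y = h y"
  shows "frechet_derivative f (at z) = frechet_derivative h (at z)"
proof -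
  have "f z = h z"
    using assms eventually_nhds_x_imp_x by fast
  moreover have "\<forall>\<^sub>F y in at z. f y = h y"
    using assms by (simp add: eventually_at_filter eventually_mono)
  ultimately have "(f has_derivative F) (at z) \<longleftrightarrow> (h has_derivative F) (at z)" for F
    by (auto intro: has_derivative_transform_eventually simp: eq_commute)
  then show ?thesis
    by (simp add: frechet_derivative_def)
qed

lemma frechet_derivative_cong_eventually:
  assumes "\<forall>\<^sub>F y in nhds z. f y = h y"
  shows "\<forall>\<^sub>F y in nhds z. frechet_derivative f (at y) v = frechet_derivative h (at y) v"
proof -
  have "\<forall>\<^sub>F y in nhds z. \<forall>\<^sub>F y in nhds y. f y = h y"
    using assms by (simp add: eventually_eventually)
  then show ?thesis
    by (rule eventually_mono) (simp add: frechet_derivative_cong)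
qed

section \<open>The ring of germs at the origin\<close>

definition germ_rel :: "('e::euclidean_space \<Rightarrow> real) \<Rightarrow> ('e \<Rightarrow> real) \<Rightarrow> bool" where
  "germ_rel f h \<longleftrightarrow> smooth_near f 0 \<and> smooth_near h 0 \<and> (\<forall>\<^sub>F y in nhds 0. f y = h y)"

\<comment> \<open>A type cannot depend on a base point, so all germs live at the origin and
  \<open>germ_at\<close> translates. The quotient is partial because only functions smooth near 0
  have a germ.\<close>
quotient_type (overloaded) 'e germ = "'e::euclidean_space \<Rightarrow> real" / partial: germ_rel
proof (rule part_equivpI)
  show "\<exists>f :: 'e \<Rightarrow> real. germ_rel f f"
    by (rule exI[of _ "\<lambda>x. 0"]) (simp add: germ_rel_def)
  show "symp (germ_rel :: ('e \<Rightarrow> real) \<Rightarrow> _)"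
    by (auto intro!: sympI simp: germ_rel_def eq_commute)
  show "transp (germ_rel :: ('e \<Rightarrow> real) \<Rightarrow> _)"
  proof (rule transpI)
    fix f g h :: "'e \<Rightarrow> real"
    assume fg: "germ_rel f g" and gh: "germ_rel g h"
    have "\<forall>\<^sub>F y in nhds 0. f y = g y" "\<forall>\<^sub>F y in nhds 0. g y = h y"
      using fg gh by (simp_all add: germ_rel_def)
    then have "\<forall>\<^sub>F y in nhds 0. f y = h y"
      by eventually_elim simp
    then show "germ_rel f h"
      using fg gh by (simp add: germ_rel_def)
  qed
qed

instantiation germ :: (euclidean_space) comm_ring_1
begin

lift_definition zero_germ :: "'a germ" is "\<lambda>x. 0" by (simp add: germ_rel_def)
lift_definition one_germ :: "'a germ" is "\<lambda>x. 1" by (simp add: germ_rel_def)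
lift_definition plus_germ :: "'a germ \<Rightarrow> 'a germ \<Rightarrow> 'a germ" is "\<lambda>f h x. f x + h x"
  by (auto simp: germ_rel_def elim: eventually_elim2)
lift_definition minus_germ :: "'a germ \<Rightarrow> 'a germ \<Rightarrow> 'a germ" is "\<lambda>f h x. f x - h x"
  by (auto simp: germ_rel_def elim: eventually_elim2)
lift_definition uminus_germ :: "'a germ \<Rightarrow> 'a germ" is "\<lambda>f x. - f x"
  by (auto simp: germ_rel_def elim: eventually_mono)
lift_definition times_germ :: "'a germ \<Rightarrow> 'a germ \<Rightarrow> 'a germ" is "\<lambda>f h x. f x * h x"
  by (auto simp: germ_rel_def elim: eventually_elim2)

instance
proof
  show "(0::'a germ) \<noteq> 1"
    by transfer (auto simp: germ_rel_def)
qed (transfer; auto simp: germ_rel_def algebra_simps intro!: always_eventually)+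

end

lift_definition germ_D :: "'e \<Rightarrow> 'e::euclidean_space germ \<Rightarrow> 'e germ" is
  "\<lambda>v f x. frechet_derivative f (at x) v"
  by (auto simp: germ_rel_def frechet_derivative_cong_eventually)

text \<open>Evaluation at the base point is a ring homomorphism; it turns the evolution equation for
  germs into one for real numbers, where signs make sense.\<close>

lift_definition germ_ev :: "'e::euclidean_space germ \<Rightarrow> real" is "\<lambda>f. f 0"
  by (auto simp: germ_rel_def dest: eventually_nhds_x_imp_x)

lemma germ_ev_simps [simp]: "germ_ev 0 = 0" "germ_ev 1 = 1" "germ_ev (x + y) = germ_ev x + germ_ev y"
  "germ_ev (x - y) = germ_ev x - germ_ev y" "germ_ev (- x) = - germ_ev x" "germ_ev (x * y) = germ_ev x * germ_ev y"
  by (transfer; simp)+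

lemma germ_ev_sum [simp]: "germ_ev (sum f I) = (\<Sum>i\<in>I. germ_ev (f i))"
  by (induction I rule: infinite_finite_induct) auto

lemma germ_ev_numeral [simp]: "germ_ev (numeral n) = numeral n"
  by (induction n) (simp_all only: numeral.simps germ_ev_simps)

lemma germ_D_add: "germ_D v (x + y) = germ_D v x + germ_D v y"
proof (transfer, unfold germ_rel_def, safe)
  fix v :: 'a and x y :: "'a \<Rightarrow> real"
  assume x: "smooth_near x 0" and y: "smooth_near y 0"
  show "\<forall>\<^sub>F z in nhds 0. frechet_derivative (\<lambda>z. x z + y z) (at z) v
      = frechet_derivative x (at z) v + frechet_derivative y (at z) v"
    using smooth_near_eventually[OF x] smooth_near_eventually[OF y]
  proof eventually_elim
    case (elim z)
    show ?case
      by (rule frechet_derivative_eq[OF has_derivative_add])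
        (intro smooth_near_derivative elim)+
  qed
qed (intro smooth_near_add smooth_near_derivI, assumption+)+

lemma germ_D_mult: "germ_D v (x * y) = germ_D v x * y + x * germ_D v y"
proof (transfer, unfold germ_rel_def, safe)
  fix v :: 'a and x y :: "'a \<Rightarrow> real"
  assume x: "smooth_near x 0" and y: "smooth_near y 0"
  show "\<forall>\<^sub>F z in nhds 0. frechet_derivative (\<lambda>z. x z * y z) (at z) v
      = frechet_derivative x (at z) v * y z + x z * frechet_derivative y (at z) v"
    using smooth_near_eventually[OF x] smooth_near_eventually[OF y]
  proof eventually_elim
    case (elim z)
    show ?case
      by (subst frechet_derivative_eq[OF has_derivative_mult[OF smooth_near_derivative[OF elim(1)]
              smooth_near_derivative[OF elim(2)]]]) (rule add.commute)
  qed
qed (intro smooth_near_add smooth_near_mult smooth_near_derivI, assumption+)+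

lemma germ_D_commute: "germ_D v (germ_D w x) = germ_D w (germ_D v x)"
proof (transfer, unfold germ_rel_def, safe)
  fix v w :: 'a and x :: "'a \<Rightarrow> real"
  assume x: "smooth_near x 0"
  show "\<forall>\<^sub>F z in nhds 0. frechet_derivative (\<lambda>z. frechet_derivative x (at z) w) (at z) v
      = frechet_derivative (\<lambda>z. frechet_derivative x (at z) v) (at z) w"
    using smooth_near_eventually[OF x] by eventually_elim (rule smooth_near_derivatives_commute)
qed (intro smooth_near_derivI, assumption+)+

lemma germ_two_cancel: "2 * (x :: 'e::euclidean_space germ) = 2 * y \<Longrightarrow> x = y"
  unfolding mult_2 by transfer (auto simp: germ_rel_def elim: eventually_mono)

section \<open>Germs of functions at arbitrary points\<close>

definition germ_at :: "'e::euclidean_space \<Rightarrow> ('e \<Rightarrow> real) \<Rightarrow> 'e germ" where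
  "germ_at z f = abs_germ (\<lambda>x. f (z + x))"

lemma smooth_near_shift: "smooth_near f z \<Longrightarrow> smooth_near (\<lambda>x. f (z + x)) (0::'e::euclidean_space)"
  for f :: "_ \<Rightarrow> real"
  by (rule smooth_near_compose[of "\<lambda>x. z + x" 0 f,
        OF smooth_near_add[OF smooth_near_const smooth_near_linear[OF bounded_linear_ident]]]) simp

lemma eventually_shift: "(\<forall>\<^sub>F x in nhds (0::'e::euclidean_space). P (z + x)) \<longleftrightarrow> (\<forall>\<^sub>F y in nhds z. P y)"
  using filtermap_nhds_shift[of "- z" "0::'e"] 
  by (simp add: eventually_filtermap[of P "\<lambda>x. x + z", symmetric] add.commute)

lemma germ_at_cr:
  fixes f :: "'e::euclidean_space \<Rightarrow> real"
  assumes "smooth_near f z"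
  shows "germ_rel (\<lambda>x. f (z + x)) (\<lambda>x. f (z + x))"
  using smooth_near_shift[OF assms] by (simp add: germ_rel_def)

lemma germ_at_eqI:
  fixes f :: "'e::euclidean_space \<Rightarrow> real"
  assumes "smooth_near f z" "\<forall>\<^sub>F y in nhds z. f y = h y"
  shows "germ_at z f = germ_at z h"
proof -
  have "smooth_near h z"
    using assms smooth_near_cong by blast
  then show ?thesis
    unfolding germ_at_def
    using assms smooth_near_shift[of f z] smooth_near_shift[of h z] eventually_shift[of "\<lambda>y. f y = h y" z]
    by (intro Quotient_rel_abs[OF Quotient_germ]) (simp add: germ_rel_def)
qed

lemma germ_at_const: "germ_at z (\<lambda>x. 0) = 0" "germ_at z (\<lambda>x. 1) = 1"
  by (simp_all add: germ_at_def zero_germ_def one_germ_def)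

lemma germ_at_add: "smooth_near f z \<Longrightarrow> smooth_near h z \<Longrightarrow> germ_at z (\<lambda>x. f x + h x) = germ_at z f + germ_at z h"
  unfolding germ_at_def by (subst plus_germ.abs_eq) (auto intro: germ_at_cr)

lemma germ_at_mult: "smooth_near f z \<Longrightarrow> smooth_near h z \<Longrightarrow> germ_at z (\<lambda>x. f x * h x) = germ_at z f * germ_at z h"
  unfolding germ_at_def by (subst times_germ.abs_eq) (auto intro: germ_at_cr)

lemma germ_at_diff: "smooth_near f z \<Longrightarrow> smooth_near h z \<Longrightarrow> germ_at z (\<lambda>x. f x - h x) = germ_at z f - germ_at z h"
  unfolding germ_at_def by (subst minus_germ.abs_eq) (auto intro: germ_at_cr)

lemma germ_at_minus: "smooth_near f z \<Longrightarrow> germ_at z (\<lambda>x. - f x) = - germ_at z f"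
  unfolding germ_at_def by (subst uminus_germ.abs_eq) (auto intro: germ_at_cr)

lemma germ_at_sum:
  assumes "\<And>i. i \<in> I \<Longrightarrow> smooth_near (f i) z"
  shows "germ_at z (\<lambda>x. \<Sum>i\<in>I. f i x) = (\<Sum>i\<in>I. germ_at z (f i))"
  using assms
  by (induction I rule: infinite_finite_induct) (auto simp: germ_at_const germ_at_add smooth_near_sum)

lemma germ_at_D:
  assumes "smooth_near f z"
  shows "germ_at z (\<lambda>x. frechet_derivative f (at x) v) = germ_D v (germ_at z f)"
proof -
  have *: "frechet_derivative (\<lambda>x. f (z + x)) (at x) v = frechet_derivative f (at (z + x)) v"
    if "smooth_near f (z + x)" for x
  proof -
    have "((\<lambda>x. f (z + x)) has_derivative (\<lambda>h. frechet_derivative f (at (z + x)) h)) (at x)"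
      by (rule has_derivative_along[where z="\<lambda>x. z + x", OF smooth_near_derivative[OF that]])
        (auto intro!: derivative_eq_intros)
    then show ?thesis by (metis frechet_derivative_at)
  qed
  have "\<forall>\<^sub>F x in nhds 0. smooth_near f (z + x)"
    using smooth_near_eventually[OF assms] by (simp add: eventually_shift)
  then have "\<forall>\<^sub>F x in nhds 0. frechet_derivative f (at (z + x)) v = frechet_derivative (\<lambda>x. f (z + x)) (at x) v"
    by (rule eventually_mono) (simp add: *)
  then show ?thesis
    unfolding germ_at_def germ_D.abs_eq[OF germ_at_cr[OF assms]]
    using smooth_near_shift[OF smooth_near_derivI[OF assms]] smooth_near_derivI[OF smooth_near_shift[OF assms]]
    by (intro Quotient_rel_abs[OF Quotient_germ]) (simp add: germ_rel_def)
qed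

lemma germ_ev_at: "smooth_near f z \<Longrightarrow> germ_ev (germ_at z f) = f z"
  unfolding germ_at_def by (subst germ_ev.abs_eq) (auto intro: germ_at_cr)

section \<open>Positive semidefinite forms\<close>

lemma matrix_inv:
  assumes "invertible (A :: real^'n^'n)"
  shows "A ** matrix_inv A = mat 1" "matrix_inv A ** A = mat 1"
  using assms someI_ex[of "\<lambda>B. A ** B = mat 1 \<and> B ** A = mat 1"]
  unfolding invertible_def matrix_inv_def by blast+

lemma matrix_inv_unique:
  fixes A B :: "real^'n^'n"
  assumes "A ** B = mat 1" "B ** A = mat 1"
  shows "matrix_inv A = B"
proof -
  have inv: "matrix_inv A ** A = mat 1"
    using assms matrix_inv(2)[of A] unfolding invertible_def by blast
  have "matrix_inv A ** (A ** B) = B"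
    unfolding matrix_mul_assoc by (simp add: inv)
  then show ?thesis using assms by simp
qed

lemma matrix_inv_transpose:
  assumes "invertible (A :: real^'n^'n)"
  shows "matrix_inv (transpose A) = transpose (matrix_inv A)"
  by (rule matrix_inv_unique) (simp_all add: matrix_transpose_mul[symmetric] matrix_inv assms)

lemma transpose_nth_sym:
  assumes "transpose A = A"
  shows "A $ i $ j = A $ j $ i"
  using arg_cong[OF assms, of "\<lambda>M. M $ j $ i"] by (simp add: transpose_def)

definition posdef :: "real^'n^'n \<Rightarrow> bool" where
  "posdef A \<longleftrightarrow> transpose A = A \<and> (\<forall>v. v \<noteq> 0 \<longrightarrow> v \<bullet> (A *v v) > 0)"

lemma posdef_invertible: "posdef A \<Longrightarrow> invertible A"
  unfolding invertible_left_inverse matrix_left_invertible_ker posdef_def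
  by (auto dest!: spec)

lemma posdef_inv:
  assumes "posdef A"
  shows "posdef (matrix_inv A)"
  unfolding posdef_def
proof (intro conjI allI impI)
  note inv = matrix_inv[OF posdef_invertible[OF assms]]
  show "transpose (matrix_inv A) = matrix_inv A"
    using matrix_inv_transpose[OF posdef_invertible[OF assms]] assms by (simp add: posdef_def)
  fix v :: "real^'a" assume v: "v \<noteq> 0"
  have Av: "A *v (matrix_inv A *v v) = v"
    by (simp add: matrix_vector_mul_assoc inv)
  then have "matrix_inv A *v v \<noteq> 0"
    using v by auto
  then have "0 < (matrix_inv A *v v) \<bullet> (A *v (matrix_inv A *v v))"
    using assms unfolding posdef_def by blast
  then show "0 < v \<bullet> (matrix_inv A *v v)"
    by (simp only: Av inner_commute)
qed

lemma matrix_inv_nth_sym: "posdef A \<Longrightarrow> matrix_inv A $ i $ j = matrix_inv A $ j $ i"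
  using posdef_inv[of A] by (auto simp: posdef_def intro: transpose_nth_sym)

text \<open>A form is a function of two indices instead of a matrix, so that the index type may be a
  product; tensor products of forms then stay within the same notion.\<close>

definition psd :: "('i::finite \<Rightarrow> 'i \<Rightarrow> real) \<Rightarrow> bool" where
  "psd H \<longleftrightarrow> (\<forall>i j. H i j = H j i) \<and> (\<forall>v. 0 \<le> (\<Sum>i\<in>UNIV. \<Sum>j\<in>UNIV. H i j * v i * v j))"

lemma psd_sym: "psd H \<Longrightarrow> H i j = H j i"
  unfolding psd_def by blast

lemma psd_nonneg: "psd H \<Longrightarrow> 0 \<le> (\<Sum>i\<in>UNIV. \<Sum>j\<in>UNIV. H i j * v i * v j)"
  by (simp add: psd_def)

lemma posdef_psd: "posdef A \<Longrightarrow> psd (\<lambda>i j. A $ i $ j)"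
proof (unfold psd_def, intro conjI allI)
  fix v :: "'a \<Rightarrow> real"
  assume A: "posdef A"
  have "0 \<le> (\<chi> i. v i) \<bullet> (A *v (\<chi> i. v i))"
    using A by (cases "(\<chi> i. v i) = 0") (auto simp: posdef_def intro: less_imp_le)
  then show "0 \<le> (\<Sum>i\<in>UNIV. \<Sum>j\<in>UNIV. A $ i $ j * v i * v j)"
    by (simp add: inner_vec_def matrix_vector_mult_def sum_distrib_left mult_ac)
qed (auto simp: posdef_def intro: transpose_nth_sym)

lemma psd_diag: "psd H \<Longrightarrow> 0 \<le> H i i"
proof -
  assume H: "psd H"
  let ?v = "\<lambda>j. if j = i then 1 else 0 :: real"
  have "(\<Sum>k\<in>UNIV. \<Sum>l\<in>UNIV. H k l * ?v k * ?v l) = (\<Sum>k\<in>UNIV. \<Sum>l\<in>UNIV. if l = i then if k = i then H i i else 0 else 0)"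
    by (intro sum.cong refl) auto
  then show ?thesis
    using psd_nonneg[OF H, of ?v] by simp
qed

lemma psd_2x2:
  assumes "psd H" "i \<noteq> j"
  shows "0 \<le> H i i * x * x + 2 * H i j * x * y + H j j * y * y"
proof -
  let ?v = "\<lambda>k. if k = i then x else if k = j then y else 0"
  have *: "(\<Sum>l\<in>UNIV. F l * ?v l) = F i * x + F j * y" for F
  proof -
    have "(\<Sum>l\<in>UNIV. F l * ?v l) = (\<Sum>l\<in>{i, j}. F l * ?v l)"
      by (rule sum.mono_neutral_right) auto
    then show ?thesis using assms(2) by simp
  qed
  have "(\<Sum>k\<in>UNIV. \<Sum>l\<in>UNIV. H k l * ?v k * ?v l) = (\<Sum>k\<in>UNIV. (\<Sum>l\<in>UNIV. H k l * ?v l) * ?v k)"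
    by (simp only: sum_distrib_right) (simp only: mult_ac)
  also have "\<dots> = (H i i * x + H i j * y) * x + (H j i * x + H j j * y) * y"
    unfolding * ..
  finally show ?thesis
    using psd_nonneg[OF assms(1), of ?v] assms(1) unfolding psd_def by (simp add: algebra_simps)
qed

lemma psd_zero_row:
  assumes "psd H" "H i i = 0"
  shows "H i j = 0"
proof (cases "i = j")
  case False
  show ?thesis
  proof (rule ccontr)
    assume n: "H i j \<noteq> 0"
    \<comment> \<open>At this vector the form has the value -1.\<close>
    have "0 \<le> 2 * H i j * (- (H j j + 1) / (2 * H i j)) * 1 + H j j * 1 * 1"
      using psd_2x2[OF assms(1) False, of "- (H j j + 1) / (2 * H i j)" 1] assms(2) by simp
    then show False
      using n by (simp add: field_simps)
  qed
qed (use assms in simp)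

text \<open>Induction on the number of rows that are not zero: subtracting the rank one form of a
  pivot row keeps the form positive semidefinite and clears that row.\<close>

lemma psd_trace_nonneg:
  assumes "psd G" "psd H"
  shows "0 \<le> (\<Sum>i\<in>UNIV. \<Sum>j\<in>UNIV. G i j * H i j)"
proof -
  have "0 \<le> (\<Sum>i\<in>UNIV. \<Sum>j\<in>UNIV. G i j * H i j)" if "finite K" "psd H" "\<And>i j. i \<notin> K \<Longrightarrow> H i j = 0" for K H
    using that
  proof (induction K arbitrary: H rule: finite_induct)
    case (insert k K)
    note sym = insert.prems(1)[unfolded psd_def, THEN conjunct1, rule_format]
    show ?case
    proof (cases "H k k = 0")
      case True
      show ?thesis
      proof (rule insert.IH[OF insert.prems(1)])
        show "H i j = 0" if "i \<notin> K" for i j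
          using that insert.prems(2)[of i j] psd_zero_row[OF insert.prems(1) True] by (cases "i = k") auto
      qed
    next
      case False
      then have pos: "0 < H k k"
        using psd_diag[OF insert.prems(1), of k] by simp
      define H' where "H' i j = H i j - H k i * H k j / H k k" for i j
      have "psd H'"
        unfolding psd_def
      proof (intro conjI allI)
        show "H' i j = H' j i" for i j
          unfolding H'_def sym[of i j] by (simp add: mult.commute)
        fix v :: "'a \<Rightarrow> real"
        define s where "s = (\<Sum>i\<in>UNIV. H k i * v i)"
        \<comment> \<open>Completing the square: \<open>w\<close> is \<open>v\<close> with
          coordinate \<open>k\<close> moved to the minimiser of the form, so \<open>H\<close> at
          \<open>w\<close> has the value of \<open>H'\<close> at \<open>v\<close>.\<close>
        define w where "w i = v i - (if i = k then s / H k k else 0)" for i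
        have d: "(\<Sum>i\<in>UNIV. F i * w i) = (\<Sum>i\<in>UNIV. F i * v i) - F k * (s / H k k)" for F
        proof -
          have "(\<Sum>i\<in>UNIV. F i * w i) = (\<Sum>i\<in>UNIV. F i * v i - (if i = k then F k * (s / H k k) else 0))"
            by (intro sum.cong refl) (auto simp: w_def right_diff_distrib)
          then show ?thesis by (simp add: sum_subtractf)
        qed
        have "(\<Sum>i\<in>UNIV. \<Sum>j\<in>UNIV. H i j * w i * w j) = (\<Sum>i\<in>UNIV. (\<Sum>j\<in>UNIV. H i j * w j) * w i)"
          by (simp only: sum_distrib_right) (simp only: mult_ac)
        also have "\<dots> = (\<Sum>i\<in>UNIV. (\<Sum>j\<in>UNIV. H i j * v j) * v i) - s * (s / H k k)
            - (\<Sum>i\<in>UNIV. H i k * v i * (s / H k k)) + H k k * (s / H k k) * (s / H k k)"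
          unfolding d by (simp add: s_def left_diff_distrib right_diff_distrib sum_subtractf mult_ac)
        also have "(\<Sum>i\<in>UNIV. H i k * v i * (s / H k k)) = s * (s / H k k)"
        proof -
          have "(\<Sum>i\<in>UNIV. H i k * v i * (s / H k k)) = (\<Sum>i\<in>UNIV. H k i * v i * (s / H k k))"
            by (intro sum.cong refl) (subst sym, rule refl)
          then show ?thesis
            unfolding sum_distrib_right[symmetric] s_def .
        qed
        also have "H k k * (s / H k k) * (s / H k k) = s * (s / H k k)"
          using pos by simp
        also have "(\<Sum>i\<in>UNIV. (\<Sum>j\<in>UNIV. H i j * v j) * v i) - s * (s / H k k)
            - s * (s / H k k) + s * (s / H k k) = (\<Sum>i\<in>UNIV. \<Sum>j\<in>UNIV. H' i j * v i * v j)"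
        proof -
          have "s * (s / H k k) = (\<Sum>i\<in>UNIV. \<Sum>j\<in>UNIV. H k i * H k j / H k k * v i * v j)"
            unfolding s_def sum_divide_distrib sum_product
            by (simp add: sum_distrib_left sum_distrib_right mult_ac)
          then have "(\<Sum>i\<in>UNIV. \<Sum>j\<in>UNIV. H' i j * v i * v j) = (\<Sum>i\<in>UNIV. (\<Sum>j\<in>UNIV. H i j * v j) * v i) - s * (s / H k k)"
            by (simp only: H'_def left_diff_distrib sum_subtractf sum_distrib_right) (simp only: mult_ac)
          then show ?thesis by simp
        qed
        finally show "0 \<le> (\<Sum>i\<in>UNIV. \<Sum>j\<in>UNIV. H' i j * v i * v j)"
          using psd_nonneg[OF insert.prems(1), of w] by simp
      qed
      moreover have "H' i j = 0" if "i \<notin> K" for i j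
        using that insert.prems(2)[of i] pos by (cases "i = k") (auto simp: H'_def sym[of k i])
      ultimately have "0 \<le> (\<Sum>i\<in>UNIV. \<Sum>j\<in>UNIV. G i j * H' i j)"
        by (rule insert.IH)
      moreover have "(\<Sum>i\<in>UNIV. \<Sum>j\<in>UNIV. G i j * H i j) = (\<Sum>i\<in>UNIV. \<Sum>j\<in>UNIV. G i j * H' i j)
          + (\<Sum>i\<in>UNIV. \<Sum>j\<in>UNIV. G i j * H k i * H k j) / H k k"
        unfolding H'_def sum_divide_distrib sum.distrib[symmetric]
        using pos by (intro sum.cong refl) (simp add: field_simps)
      moreover have "0 \<le> (\<Sum>i\<in>UNIV. \<Sum>j\<in>UNIV. G i j * H k i * H k j) / H k k"
        using psd_nonneg[OF assms(1), of "H k"] pos by simp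
      ultimately show ?thesis by linarith
    qed
  qed simp
  from this[OF finite_class.finite_UNIV assms(2)] show ?thesis by simp
qed

lemma psd_congruence:
  assumes "psd B"
  shows "psd (\<lambda>i k. \<Sum>j\<in>UNIV. \<Sum>l\<in>UNIV. B j l * X i j * X k l)"
  unfolding psd_def
proof (intro conjI allI)
  fix i k
  show "(\<Sum>j\<in>UNIV. \<Sum>l\<in>UNIV. B j l * X i j * X k l) = (\<Sum>j\<in>UNIV. \<Sum>l\<in>UNIV. B j l * X k j * X i l)"
    by (subst sum.swap) (use assms in \<open>simp add: psd_def mult_ac\<close>)
next
  fix v
  have "(\<Sum>i\<in>UNIV. \<Sum>k\<in>UNIV. (\<Sum>j\<in>UNIV. \<Sum>l\<in>UNIV. B j l * X i j * X k l) * v i * v k)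
      = (\<Sum>i\<in>UNIV. \<Sum>k\<in>UNIV. \<Sum>j\<in>UNIV. \<Sum>l\<in>UNIV. B j l * (X i j * v i) * (X k l * v k))"
    by (simp add: sum_distrib_left sum_distrib_right mult_ac)
  also have "\<dots> = (\<Sum>j\<in>UNIV. \<Sum>l\<in>UNIV. \<Sum>i\<in>UNIV. \<Sum>k\<in>UNIV. B j l * (X i j * v i) * (X k l * v k))"
  proof -
    have "(\<Sum>i\<in>UNIV. \<Sum>k\<in>UNIV. \<Sum>j\<in>UNIV. \<Sum>l\<in>UNIV. F i k j l) = (\<Sum>j\<in>UNIV. \<Sum>l\<in>UNIV. \<Sum>i\<in>UNIV. \<Sum>k\<in>UNIV. F i k j l)"
      for F :: "_ \<Rightarrow> _ \<Rightarrow> _ \<Rightarrow> _ \<Rightarrow> real"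
      by (rule trans[OF sum.cong[OF refl sum_rot3] sum_rot3])
    then show ?thesis .
  qed
  also have "\<dots> = (\<Sum>j\<in>UNIV. \<Sum>l\<in>UNIV. B j l * (\<Sum>i\<in>UNIV. X i j * v i) * (\<Sum>k\<in>UNIV. X k l * v k))"
    by (simp only: mult.assoc[of "B j l" for j l] sum_product) (simp only: sum_distrib_left)
  finally show "0 \<le> (\<Sum>i\<in>UNIV. \<Sum>k\<in>UNIV. (\<Sum>j\<in>UNIV. \<Sum>l\<in>UNIV. B j l * X i j * X k l) * v i * v k)"
    using psd_nonneg[OF assms] by simp
qed

text \<open>A vector \<open>v\<close> with two indices is a matrix; the value of the tensor product
  at \<open>v\<close> is the trace of \<open>A\<close> against the congruence of \<open>B\<close> by
  that matrix.\<close>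

lemma psd_tensor:
  assumes "psd A" "psd B"
  shows "psd (\<lambda>(i, j) (k, l). A i k * B j l)"
  unfolding psd_def
proof (intro conjI allI)
  fix v :: "'a \<times> 'b \<Rightarrow> real"
  have "(\<Sum>p\<in>UNIV. \<Sum>q\<in>UNIV. (case p of (i, j) \<Rightarrow> \<lambda>(k, l). A i k * B j l) q * v p * v q)
    = (\<Sum>i\<in>UNIV. \<Sum>j\<in>UNIV. \<Sum>k\<in>UNIV. \<Sum>l\<in>UNIV. A i k * B j l * v (i, j) * v (k, l))"
    by (simp add: UNIV_Times_UNIV[symmetric] sum.cartesian_product' del: UNIV_Times_UNIV)
  also have "\<dots> = (\<Sum>i\<in>UNIV. \<Sum>k\<in>UNIV. \<Sum>j\<in>UNIV. \<Sum>l\<in>UNIV. A i k * B j l * v (i, j) * v (k, l))"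
    by (intro sum.cong refl sum.swap)
  also have "\<dots> = (\<Sum>i\<in>UNIV. \<Sum>k\<in>UNIV. A i k * (\<Sum>j\<in>UNIV. \<Sum>l\<in>UNIV. B j l * v (i, j) * v (k, l)))"
    by (simp add: sum_distrib_left mult.assoc)
  finally show "0 \<le> (\<Sum>p\<in>UNIV. \<Sum>q\<in>UNIV. (case p of (i, j) \<Rightarrow> \<lambda>(k, l). A i k * B j l) q * v p * v q)"
    using psd_trace_nonneg[OF assms(1) psd_congruence[OF assms(2), of "\<lambda>i j. v (i, j)"]] by simp
next
  fix p q :: "'a \<times> 'b"
  obtain i j k l where "p = (i, j)" "q = (k, l)"
    by (cases p, cases q)
  then show "(case p of (i, j) \<Rightarrow> \<lambda>(k, l). A i k * B j l) q = (case q of (i, j) \<Rightarrow> \<lambda>(k, l). A i k * B j l) p"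
    using psd_sym[OF assms(1), of i k] psd_sym[OF assms(2), of j l] by simp
qed

lemma psd_Cauchy_Schwarz:
  assumes "psd H"
  shows "(\<Sum>i\<in>UNIV. \<Sum>j\<in>UNIV. H i j * x i * y j)\<^sup>2
    \<le> (\<Sum>i\<in>UNIV. \<Sum>j\<in>UNIV. H i j * x i * x j) * (\<Sum>i\<in>UNIV. \<Sum>j\<in>UNIV. H i j * y i * y j)"
proof -
  define a b c where "a = (\<Sum>i\<in>UNIV. \<Sum>j\<in>UNIV. H i j * x i * x j)"
    and "b = (\<Sum>i\<in>UNIV. \<Sum>j\<in>UNIV. H i j * x i * y j)" and "c = (\<Sum>i\<in>UNIV. \<Sum>j\<in>UNIV. H i j * y i * y j)"
  have b': "(\<Sum>i\<in>UNIV. \<Sum>j\<in>UNIV. H i j * y i * x j) = b"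
    unfolding b_def by (subst sum.swap) (use assms in \<open>simp add: psd_def mult_ac\<close>)
  have q: "0 \<le> a * r * r + 2 * b * r * s + c * s * s" for r s
  proof -
    have "(\<Sum>i\<in>UNIV. \<Sum>j\<in>UNIV. H i j * (x i * r + y i * s) * (x j * r + y j * s))
      = a * r * r + b * r * s + (\<Sum>i\<in>UNIV. \<Sum>j\<in>UNIV. H i j * y i * x j) * r * s + c * s * s"
      unfolding a_def b_def c_def by (simp add: sum_distrib_left sum_distrib_right sum.distrib algebra_simps)
    then have "(\<Sum>i\<in>UNIV. \<Sum>j\<in>UNIV. H i j * (x i * r + y i * s) * (x j * r + y j * s))
      = a * r * r + 2 * b * r * s + c * s * s"
      unfolding b' by simp
    then show ?thesis
      using psd_nonneg[OF assms, of "\<lambda>i. x i * r + y i * s"] by simp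
  qed
  have a0: "0 \<le> a" using q[of 1 0] by simp
  have "b\<^sup>2 \<le> a * c"
  proof (cases "a = 0")
    case True
    have "b = 0"
    proof (rule ccontr)
      assume n: "b \<noteq> 0"
      \<comment> \<open>For \<open>a = 0\<close> the quadratic is affine in the first variable when
        the second is 1; the chosen point gives the value -1.\<close>
      have "0 \<le> 2 * b * (- (c + 1) / (2 * b)) + c"
        using q[of "- (c + 1) / (2 * b)" 1] True by simp
      then show False using n by (simp add: field_simps)
    qed
    then show ?thesis using True by simp
  next
    case False
    then have "0 < a" using a0 by simp
    \<comment> \<open>The choice \<open>r = - b\<close>, \<open>s = a\<close> produces
      \<open>a\<close> times the discriminant inequality.\<close>
    moreover have "0 \<le> a * (a * c - b\<^sup>2)"
      using q[of "- b" a] by (simp add: power2_eq_square algebra_simps)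
    ultimately show ?thesis
      by (simp add: zero_le_mult_iff)
  qed
  then show ?thesis by (simp add: a_def b_def c_def)
qed

section \<open>The scalar curvature is controlled by the norm of the curvature tensor\<close>

text \<open>Tensor products of positive semidefinite forms satisfy the Cauchy-Schwarz inequality; the
  scalar curvature is the inner product of the curvature tensor with \<open>\<delta> \<otimes> g\<close>, which has
  norm \<open>m\<close>.\<close>

lemma local_scalar_bound:
  fixes h :: "real^'m \<Rightarrow> real^'m^'m::finite"
  assumes "posdef (h u)"
  shows "\<bar>local_scalar h u\<bar> \<le> real CARD('m) * local_riemann_norm h u"
proof -
  define G where "G = matrix_inv (h u)"
  \<comment> \<open>The inner product on curvature tensors used in
    \<open>local_riemann_norm\<close>: \<open>h\<close> on the upper index and the inverse metric on
    each of the three lower ones.\<close>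
  define H where "H = (\<lambda>(l, l2 :: 'm \<times> 'm \<times> 'm). \<lambda>(l', l2' :: 'm \<times> 'm \<times> 'm).
      h u $ l $ l' * (case l2 of (i, jk) \<Rightarrow> \<lambda>(i', jk'). G $ i $ i' *
      (case jk of (j, k) \<Rightarrow> \<lambda>(j', k'). G $ j $ j' * G $ k $ k') jk') l2')"
  define X where "X = (\<lambda>(l, i, j, k). riemann h l i j k u)"
  define Y where "Y = (\<lambda>(l :: 'm, i :: 'm, j, k). (if l = i then 1 else 0) * h u $ j $ k)"
  have pG: "psd (\<lambda>i j. G $ i $ j)" and ph: "psd (\<lambda>i j. h u $ i $ j)"
    unfolding G_def using assms by (simp_all add: posdef_psd posdef_inv)
  have H: "psd H"
    unfolding H_def by (intro psd_tensor pG ph)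
  note inv = matrix_inv[OF posdef_invertible[OF assms], folded G_def]
  have inv_nth: "(\<Sum>p\<in>UNIV. h u $ i $ p * G $ p $ j) = (if i = j then 1 else 0)"
    "(\<Sum>p\<in>UNIV. G $ i $ p * h u $ p $ j) = (if i = j then 1 else 0)" for i j
    using arg_cong[OF inv(1), of "\<lambda>M. M $ i $ j"] arg_cong[OF inv(2), of "\<lambda>M. M $ i $ j"]
    by (simp_all add: matrix_matrix_mult_def mat_def)
  have split: "(\<Sum>q\<in>UNIV. F q) = (\<Sum>l\<in>UNIV. \<Sum>i\<in>UNIV. \<Sum>j\<in>UNIV. \<Sum>k\<in>UNIV. F (l, i, j, k))"
    for F :: "'m \<times> 'm \<times> 'm \<times> 'm \<Rightarrow> real"
    by (simp add: UNIV_Times_UNIV[symmetric] sum.cartesian_product' del: UNIV_Times_UNIV)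
  have Gsym: "G $ i $ j = G $ j $ i" and hsym: "h u $ i $ j = h u $ j $ i" for i j
    using psd_sym[OF pG] psd_sym[OF ph] by auto
  have h1: "(\<Sum>l'\<in>UNIV. \<Sum>i'\<in>UNIV. h u $ l $ l' * G $ i $ i' * (if l' = i' then 1 else 0)) = (if l = i then 1 else 0)" for l i
    using inv_nth(1)[of l i] by (simp add: Gsym[of i] if_distrib cong: if_cong)
  have h2: "(\<Sum>k'\<in>UNIV. G $ k $ k' * h u $ j' $ k') = (if k = j' then 1 else 0)" for k j'
    using inv_nth(2)[of k j'] by (simp add: hsym[of j'])
  have HY: "(\<Sum>q\<in>UNIV. H (l, i, j, k) q * Y q) = (if l = i then 1 else 0) * G $ j $ k" for l i j k
  proof -
    have "(\<Sum>q\<in>UNIV. H (l, i, j, k) q * Y q) = (\<Sum>l'\<in>UNIV. \<Sum>i'\<in>UNIV. \<Sum>j'\<in>UNIV. \<Sum>k'\<in>UNIV.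
        (h u $ l $ l' * G $ i $ i' * (if l' = i' then 1 else 0)) * (G $ j $ j' * (G $ k $ k' * h u $ j' $ k')))"
      unfolding split by (simp add: H_def Y_def mult_ac)
    also have "\<dots> = (\<Sum>l'\<in>UNIV. \<Sum>i'\<in>UNIV. h u $ l $ l' * G $ i $ i' * (if l' = i' then 1 else 0))
        * (\<Sum>j'\<in>UNIV. G $ j $ j' * (\<Sum>k'\<in>UNIV. G $ k $ k' * h u $ j' $ k'))"
      by (simp only: sum_distrib_left[symmetric] sum_distrib_right[symmetric])
    also have "\<dots> = (if l = i then 1 else 0) * (\<Sum>j'\<in>UNIV. G $ j $ j' * (if k = j' then 1 else 0))"
      unfolding h1 h2 ..
    finally show ?thesis
      by (simp add: if_distrib cong: if_cong)
  qed
  define Z where "Z = (\<lambda>(l :: 'm, i :: 'm, j, k). (if l = i then 1 else 0) * G $ j $ k)"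
  have HZ: "(\<Sum>q\<in>UNIV. H p q * Y q) = Z p" for p
    by (cases p) (simp add: HY Z_def)
  have XY: "(\<Sum>p\<in>UNIV. \<Sum>q\<in>UNIV. H p q * X p * Y q) = local_scalar h u"
  proof -
    have "(\<Sum>p\<in>UNIV. \<Sum>q\<in>UNIV. H p q * X p * Y q) = (\<Sum>p\<in>UNIV. X p * (\<Sum>q\<in>UNIV. H p q * Y q))"
      by (simp add: sum_distrib_left mult_ac)
    also have "\<dots> = (\<Sum>l\<in>UNIV. \<Sum>j\<in>UNIV. \<Sum>k\<in>UNIV. riemann h l l j k u * G $ j $ k)"
    proof -
      have "(\<Sum>p\<in>UNIV. X p * (\<Sum>q\<in>UNIV. H p q * Y q)) = (\<Sum>l\<in>UNIV. \<Sum>i\<in>UNIV.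
          if l = i then \<Sum>j\<in>UNIV. \<Sum>k\<in>UNIV. riemann h l i j k u * G $ j $ k else 0)"
        unfolding HZ split by (intro sum.cong refl) (simp add: X_def Z_def)
      then show ?thesis by simp
    qed
    also have "\<dots> = (\<Sum>j\<in>UNIV. \<Sum>k\<in>UNIV. \<Sum>l\<in>UNIV. riemann h l l j k u * G $ j $ k)"
      by (rule sum_rot3)
    also have "\<dots> = local_scalar h u"
      by (simp add: local_scalar_def metric_trace_def ricci_def G_def sum_distrib_left mult.commute)
    finally show ?thesis .
  qed
  \<comment> \<open>Two full contractions of the identity, each giving the dimension; so the norm of
    \<open>Y\<close> is the dimension.\<close>
  have YY: "(\<Sum>p\<in>UNIV. \<Sum>q\<in>UNIV. H p q * Y p * Y q) = real CARD('m) * real CARD('m)"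
  proof -
    have "(\<Sum>p\<in>UNIV. \<Sum>q\<in>UNIV. H p q * Y p * Y q) = (\<Sum>p\<in>UNIV. Y p * (\<Sum>q\<in>UNIV. H p q * Y q))"
      by (simp add: sum_distrib_left mult_ac)
    also have "\<dots> = (\<Sum>l\<in>(UNIV::'m set). \<Sum>i\<in>UNIV. (if l = i then 1 else 0) * (\<Sum>j\<in>UNIV. \<Sum>k\<in>UNIV. h u $ j $ k * G $ k $ j))"
      unfolding HZ split by (simp add: Y_def Z_def Gsym sum_distrib_left if_distrib[of "\<lambda>x. x * _"] cong: if_cong)
    also have "\<dots> = real CARD('m) * real CARD('m)"
      by (simp add: inv_nth if_distrib[of "\<lambda>x. x * _"] cong: if_cong)
    finally show ?thesis .
  qed
  have XX: "(\<Sum>p\<in>UNIV. \<Sum>q\<in>UNIV. H p q * X p * X q) = (\<Sum>l\<in>UNIV. \<Sum>i\<in>UNIV. \<Sum>j\<in>UNIV. \<Sum>k\<in>UNIV. \<Sum>l'\<in>UNIV. \<Sum>i'\<in>UNIV. \<Sum>j'\<in>UNIV. \<Sum>k'\<in>UNIV.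
        h u $ l $ l' * G $ i $ i' * G $ j $ j' * G $ k $ k' * riemann h l i j k u * riemann h l' i' j' k' u)"
    unfolding split by (simp add: H_def X_def mult_ac)
  have "(local_scalar h u)\<^sup>2 \<le> (\<Sum>p\<in>UNIV. \<Sum>q\<in>UNIV. H p q * X p * X q) * (real CARD('m) * real CARD('m))"
    using psd_Cauchy_Schwarz[OF H, of X Y] unfolding XY YY .
  then have "sqrt ((local_scalar h u)\<^sup>2) \<le> sqrt ((\<Sum>p\<in>UNIV. \<Sum>q\<in>UNIV. H p q * X p * X q) * (real CARD('m) * real CARD('m)))"
    by (rule real_sqrt_le_mono)
  then show ?thesis
    unfolding local_riemann_norm_def G_def[symmetric] XX[symmetric]
    by (simp add: real_sqrt_mult mult.commute)
qed

section \<open>The evolution inequality in a chart\<close>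

lemma smooth_near_det:
  fixes A :: "'e::euclidean_space \<Rightarrow> real^'n^'n"
  assumes "\<And>i j. smooth_near (\<lambda>z. A z $ i $ j) z"
  shows "smooth_near (\<lambda>z. det (A z)) z"
  unfolding det_def by (intro smooth_near_sum smooth_near_mult smooth_near_prod smooth_near_const assms)

text \<open>Writes the entries of the inverse as quotients of polynomials in the entries, which
  gives both their smoothness and their continuity.\<close>

lemma matrix_inv_cramer:
  assumes "invertible (A :: real^'n^'n)"
  shows "matrix_inv A $ i $ j = det (\<chi> r c. if c = i then axis j 1 $ r else A $ r $ c) * inverse (det A)"
proof -
  have d: "det A \<noteq> 0"
    using assms invertible_det_nz by blast
  have "A *v (matrix_inv A *v axis j 1) = axis j 1"
    by (simp add: matrix_vector_mul_assoc matrix_inv[OF assms])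
  then have "matrix_inv A *v axis j 1 = (\<chi> k. det (\<chi> r c. if c = k then axis j 1 $ r else A $ r $ c) / det A)"
    by (simp only: cramer[OF d])
  then have "(matrix_inv A *v axis j 1) $ i = det (\<chi> r c. if c = i then axis j 1 $ r else A $ r $ c) / det A"
    by simp
  then show ?thesis
    by (simp add: matrix_vector_mult_basis column_def divide_inverse)
qed

lemma smooth_near_matrix_inv:
  fixes A :: "'e::euclidean_space \<Rightarrow> real^'n^'n"
  assumes A: "smooth_near A z" and inv: "\<forall>\<^sub>F y in nhds z. invertible (A y)"
  shows "smooth_near (\<lambda>z. matrix_inv (A z) $ i $ j) z"
proof -
  have nth: "smooth_near (\<lambda>z. A z $ i $ j) z" for i j
    using A by (intro smooth_near_nth)
  have "det (A z) \<noteq> 0"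
    using eventually_nhds_x_imp_x[OF inv] invertible_det_nz by blast
  moreover have "smooth_near (\<lambda>z. (\<chi> r c. if c = i then axis j 1 $ r else A z $ r $ c) $ r $ c) z" for r c
    using nth by (cases "c = i") simp_all
  ultimately have "smooth_near (\<lambda>z. det (\<chi> r c. if c = i then axis j 1 $ r else A z $ r $ c) * inverse (det (A z))) z"
    by (intro smooth_near_mult smooth_near_inverse smooth_near_det nth)
  moreover have "\<forall>\<^sub>F y in nhds z. det (\<chi> r c. if c = i then axis j 1 $ r else A y $ r $ c) * inverse (det (A y)) = matrix_inv (A y) $ i $ j"
    using inv by (rule eventually_mono) (simp add: matrix_inv_cramer)
  ultimately show ?thesis
    by (rule smooth_near_transfer)
qed

section \<open>Symmetry and metric compatibility of the Christoffel symbols\<close>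

lemma christoffel_sym:
  assumes "\<And>i j. h u $ i $ j = h u $ j $ i" "\<And>i j l. pd l (\<lambda>w. h w $ i $ j) u = pd l (\<lambda>w. h w $ j $ i) u"
  shows "christoffel h k i j u = christoffel h k j i u"
  unfolding christoffel_def
  by (intro arg_cong2[where f="(/)"] sum.cong refl) (simp add: assms(2)[of _ i j] add.commute)

lemma christoffel_metric:
  assumes "posdef (h u)" "\<And>i j l. pd l (\<lambda>w. h w $ i $ j) u = pd l (\<lambda>w. h w $ j $ i) u"
  shows "pd l (\<lambda>w. h w $ i $ j) u = (\<Sum>p\<in>UNIV. christoffel h p l i u * h u $ p $ j)
    + (\<Sum>p\<in>UNIV. h u $ i $ p * christoffel h p l j u)"
proof -
  have sym: "h u $ i $ j = h u $ j $ i" for i j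
    using assms(1) transpose_nth_sym by (auto simp: posdef_def)
  \<comment> \<open>Lowering the index recovers the Koszul formula; adding two instances cancels all
    but one derivative of the metric.\<close>
  have low: "(\<Sum>p\<in>UNIV. h u $ j $ p * christoffel h p l i u)
      = (pd l (\<lambda>w. h w $ i $ j) u + pd i (\<lambda>w. h w $ l $ j) u - pd j (\<lambda>w. h w $ l $ i) u) / 2" for i j
  proof -
    define X where "X q = pd l (\<lambda>w. h w $ i $ q) u + pd i (\<lambda>w. h w $ l $ q) u - pd q (\<lambda>w. h w $ l $ i) u" for q
    have "(\<Sum>p\<in>UNIV. h u $ j $ p * christoffel h p l i u) = (\<Sum>p\<in>UNIV. \<Sum>q\<in>UNIV. h u $ j $ p * (matrix_inv (h u) $ p $ q * X q)) / 2"
      by (simp add: christoffel_def X_def sum_distrib_left sum_divide_distrib)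
    also have "\<dots> = (\<Sum>q\<in>UNIV. (h u ** matrix_inv (h u)) $ j $ q * X q) / 2"
      by (subst sum.swap) (simp add: matrix_matrix_mult_def sum_distrib_right mult.assoc)
    also have "\<dots> = X j / 2"
      by (simp add: matrix_inv[OF posdef_invertible[OF assms(1)]] mat_def if_distrib[of "\<lambda>x. x * _"] cong: if_cong)
    finally show ?thesis by (simp add: X_def)
  qed
  have swap: "(\<Sum>p\<in>UNIV. christoffel h p l i u * h u $ p $ j) = (\<Sum>p\<in>UNIV. h u $ j $ p * christoffel h p l i u)"
    by (intro sum.cong refl) (simp add: sym[of _ j] mult.commute)
  show ?thesis
    unfolding swap low using assms(2)[of l j i] by (simp add: field_simps)
qed

text \<open>Defined through \<open>pd\<close> at frozen time, so that it matches the definitions of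
  the curvature quantities literally; \<open>sp_eq\<close> identifies it with a directional
  derivative in space-time wherever the function is smooth.\<close>

definition sp :: "'m \<Rightarrow> (real \<times> (real^'m::finite) \<Rightarrow> real) \<Rightarrow> real \<times> (real^'m) \<Rightarrow> real" where
  "sp i \<Phi> z = pd i (\<lambda>w. \<Phi> (fst z, w)) (snd z)"

abbreviation sdir :: "'m \<Rightarrow> real \<times> (real^'m::finite)" where
  "sdir i \<equiv> (0, axis i 1)"

abbreviation tdir :: "real \<times> (real^'m::finite)" where
  "tdir \<equiv> (1, 0)"

lemma sp_eq:
  assumes "smooth_near \<Phi> z"
  shows "sp i \<Phi> z = frechet_derivative \<Phi> (at z) (sdir i)"
proof -
  have "((\<lambda>w. \<Phi> (fst z, w)) has_derivative (\<lambda>r. frechet_derivative \<Phi> (at z) (0, r))) (at (snd z))"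
    by (rule has_derivative_along[where z="\<lambda>w. (fst z, w)" and F=\<Phi>])
      (use smooth_near_derivative[OF assms] in \<open>auto intro!: derivative_eq_intros\<close>)
  then show ?thesis
    unfolding sp_def pd_def by (rule frechet_derivative_eq)
qed

lemma sp_eventually:
  assumes "smooth_near \<Phi> z"
  shows "\<forall>\<^sub>F y in nhds z. frechet_derivative \<Phi> (at y) (sdir i) = sp i \<Phi> y"
  using smooth_near_eventually[OF assms] by (rule eventually_mono) (simp add: sp_eq)

lemma smooth_near_sp:
  assumes "smooth_near \<Phi> z"
  shows "smooth_near (sp i \<Phi>) z"
  by (rule smooth_near_transfer[OF smooth_near_derivI[OF assms] sp_eventually[OF assms]])

lemma germ_at_sp:
  assumes "smooth_near \<Phi> z"
  shows "germ_at z (sp i \<Phi>) = germ_D (sdir i) (germ_at z \<Phi>)"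
  using germ_at_eqI[OF smooth_near_derivI[OF assms] sp_eventually[OF assms]] germ_at_D[OF assms] by simp

lemma sp_cong:
  assumes "\<forall>\<^sub>F y in nhds z. \<Phi> y = \<Psi> y" "smooth_near \<Phi> z"
  shows "sp i \<Phi> z = sp i \<Psi> z"
  using assms smooth_near_transfer[OF assms(2,1)] by (simp add: sp_eq frechet_derivative_cong)


section \<open>The flow in one chart of each manifold\<close>

locale local_flow =
  fixes W :: "(real \<times> (real^'m::finite)) set" and h :: "real \<Rightarrow> real^'m \<Rightarrow> real^'m^'m"
    and V :: "(real^'n::finite) set" and k :: "real^'n \<Rightarrow> real^'n^'n"
    and f :: "real \<Rightarrow> real^'m \<Rightarrow> real^'n" and \<alpha> :: "real \<Rightarrow> real"
  assumes W: "open W"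
    and h_smooth: "smooth_on W (\<lambda>(t, u). h t u)"
    and h_posdef: "(t, u) \<in> W \<Longrightarrow> posdef (h t u)"
    and V: "open V"
    and k_smooth: "smooth_on V k"
    and k_posdef: "v \<in> V \<Longrightarrow> posdef (k v)"
    and f_smooth: "smooth_on W (\<lambda>(t, u). f t u)"
    and f_V: "(t, u) \<in> W \<Longrightarrow> f t u \<in> V"
    and \<alpha>_smooth: "(t, u) \<in> W \<Longrightarrow> smooth_near \<alpha> t"
    and h_flow: "(t, u) \<in> W \<Longrightarrow> ((\<lambda>s. h s u) has_vector_derivative
        (- 2) *\<^sub>R ricci (h t) u + (2 * \<alpha> t) *\<^sub>R grad_tensor k (f t) u) (at t)"
    and f_flow: "(t, u) \<in> W \<Longrightarrow> ((\<lambda>s. f s u) has_vector_derivative tension (h t) k (f t) u) (at t)"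
begin

text \<open>The quantities of the flow, here and below, are turned into functions of the space-time
  point \<open>z = (t, u)\<close>, the form in which germs can be taken. \<open>sc\<close> is S_ij
  and \<open>Sfun\<close> its trace.\<close>

definition hc where "hc i j z = h (fst z) (snd z) $ i $ j"
definition hi where "hi i j z = matrix_inv (h (fst z) (snd z)) $ i $ j"
definition fc where "fc a z = f (fst z) (snd z) $ a"
definition kc where "kc a b z = k (f (fst z) (snd z)) $ a $ b"
definition ch where "ch l i j z = christoffel (h (fst z)) l i j (snd z)"
definition kch where "kch a b c z = christoffel k a b c (f (fst z) (snd z))"
definition rm where "rm l i j m z = riemann (h (fst z)) l i j m (snd z)"
definition sc where "sc i j z = ricci (h (fst z)) (snd z) $ i $ j
  - \<alpha> (fst z) * grad_tensor k (f (fst z)) (snd z) $ i $ j"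

definition Sfun :: "real \<times> (real^'m) \<Rightarrow> real" where
  "Sfun z = (\<Sum>i\<in>UNIV. \<Sum>j\<in>UNIV. hi i j z * sc i j z)"

lemma ch_eq: "ch l i j z = (\<Sum>q\<in>UNIV. hi l q z * (sp i (hc j q) z + sp j (hc i q) z - sp q (hc i j) z)) * (1 / 2)"
  by (simp add: ch_def christoffel_def hi_def sp_def hc_def)

lemma rm_eq: "rm l i j m z = sp i (ch l j m) z - sp j (ch l i m) z
    + (\<Sum>n\<in>UNIV. ch l i n z * ch n j m z - ch l j n z * ch n i m z)"
  by (simp add: rm_def riemann_def sp_def ch_def)

lemma sc_eq: "sc i j z = (\<Sum>l\<in>UNIV. rm l l i j z)
    - \<alpha> (fst z) * (\<Sum>a\<in>UNIV. \<Sum>b\<in>UNIV. kc a b z * sp i (fc a) z * sp j (fc b) z)"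
  by (simp add: sc_def ricci_def rm_def grad_tensor_def kc_def sp_def fc_def)

context
  fixes z assumes z: "z \<in> W"
begin

lemma near_W: "\<forall>\<^sub>F y in nhds z. y \<in> W"
  using W z eventually_nhds by blast

lemma h_near: "smooth_near (\<lambda>z. h (fst z) (snd z)) z"
  using h_smooth W z by (auto intro!: smooth_nearI simp: case_prod_unfold)

lemma f_near: "smooth_near (\<lambda>z. f (fst z) (snd z)) z"
  using f_smooth W z by (auto intro!: smooth_nearI simp: case_prod_unfold)

lemma f_in_V: "f (fst z) (snd z) \<in> V"
  using f_V[of "fst z" "snd z"] z by simp

lemma hc_near: "smooth_near (hc i j) z"
  using smooth_near_nth[OF smooth_near_nth[OF h_near]] by (simp add: hc_def[abs_def])

lemma hi_near: "smooth_near (hi i j) z"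
  unfolding hi_def[abs_def]
proof (rule smooth_near_matrix_inv[OF h_near])
  show "\<forall>\<^sub>F y in nhds z. invertible (h (fst y) (snd y))"
    using near_W
  proof (rule eventually_mono)
    fix y assume "y \<in> W"
    then have "posdef (h (fst y) (snd y))"
      using h_posdef[of "fst y" "snd y"] by simp
    then show "invertible (h (fst y) (snd y))"
      by (rule posdef_invertible)
  qed
qed

lemma fc_near: "smooth_near (fc a) z"
  using smooth_near_nth[OF f_near] by (simp add: fc_def[abs_def])

lemma ch_near: "smooth_near (ch l i j) z"
  unfolding ch_eq[abs_def]
  by (intro smooth_near_mult smooth_near_sum smooth_near_add smooth_near_diff smooth_near_const
      hi_near smooth_near_sp hc_near)

lemma rm_near: "smooth_near (rm l i j m) z"
  unfolding rm_eq[abs_def]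
  by (intro smooth_near_mult smooth_near_sum smooth_near_add smooth_near_diff smooth_near_const
      ch_near smooth_near_sp)

lemma \<alpha>_near: "smooth_near (\<lambda>z. \<alpha> (fst z)) z"
  by (rule smooth_near_compose[of fst, OF smooth_near_linear[OF bounded_linear_fst]])
    (use \<alpha>_smooth[of "fst z" "snd z"] z in simp)

lemma k_near: "smooth_near (\<lambda>v. k v $ a $ b) (f (fst z) (snd z))"
  using k_smooth V f_in_V by (intro smooth_near_nth) (auto intro: smooth_nearI)

lemma kc_near: "smooth_near (kc a b) z"
  unfolding kc_def[abs_def] by (rule smooth_near_compose[OF f_near k_near])

lemma pd_k_near: "smooth_near (pd e (\<lambda>v. k v $ a $ b)) (f (fst z) (snd z))"
  unfolding pd_def[abs_def] by (intro smooth_near_derivI k_near)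

lemma kch_near: "smooth_near (kch a b c) z"
  unfolding kch_def[abs_def]
proof (rule smooth_near_compose[OF f_near])
  have "\<forall>\<^sub>F y in nhds (f (fst z) (snd z)). y \<in> V"
    using V f_in_V eventually_nhds by blast
  then have "\<forall>\<^sub>F y in nhds (f (fst z) (snd z)). invertible (k y)"
    by (rule eventually_mono) (rule posdef_invertible[OF k_posdef])
  moreover have "smooth_near k (f (fst z) (snd z))"
    using k_smooth V f_in_V by (auto intro: smooth_nearI)
  ultimately have inv: "smooth_near (\<lambda>v. matrix_inv (k v) $ i $ j) (f (fst z) (snd z))" for i j
    by (intro smooth_near_matrix_inv)
  show "smooth_near (christoffel k a b c) (f (fst z) (snd z))"
    unfolding christoffel_def[abs_def] divide_inverse
    by (intro smooth_near_mult smooth_near_sum smooth_near_add smooth_near_diff smooth_near_const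
        inv pd_k_near)
qed

lemma sc_near: "smooth_near (sc i j) z"
  unfolding sc_eq[abs_def]
  by (intro smooth_near_mult smooth_near_sum smooth_near_diff rm_near \<alpha>_near kc_near smooth_near_sp fc_near)

lemma Sfun_near: "smooth_near Sfun z"
  unfolding Sfun_def[abs_def] by (intro smooth_near_mult smooth_near_sum hi_near sc_near)

lemma h_pd_sym: "pd l (\<lambda>w. h (fst z) w $ i $ j) (snd z) = pd l (\<lambda>w. h (fst z) w $ j $ i) (snd z)"
proof -
  have "\<forall>\<^sub>F y in nhds z. hc i j y = hc j i y"
    using near_W
  proof (rule eventually_mono)
    fix y assume "y \<in> W"
    then show "hc i j y = hc j i y"
      using h_posdef[of "fst y" "snd y"] transpose_nth_sym unfolding hc_def posdef_def by auto
  qed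
  from sp_cong[OF this hc_near, of l] show ?thesis
    by (simp add: sp_def hc_def)
qed

lemma h_sym: "h (fst z) (snd z) $ i $ j = h (fst z) (snd z) $ j $ i"
  using h_posdef[of "fst z" "snd z"] z transpose_nth_sym by (auto simp: posdef_def)

lemma ch_sym: "ch l i j z = ch l j i z"
  unfolding ch_def by (rule christoffel_sym[OF h_sym h_pd_sym])

lemma hc_metric: "sp l (hc i j) z = (\<Sum>p\<in>UNIV. ch p l i z * hc p j z) + (\<Sum>p\<in>UNIV. hc i p z * ch p l j z)"
  unfolding sp_def ch_def hc_def
  using christoffel_metric[where h="h (fst z)" and u="snd z", OF _ h_pd_sym] h_posdef[of "fst z" "snd z"] z by simp

lemma k_pd_sym: "pd e (\<lambda>v. k v $ a $ b) (f (fst z) (snd z)) = pd e (\<lambda>v. k v $ b $ a) (f (fst z) (snd z))"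
proof -
  have "\<forall>\<^sub>F y in nhds (f (fst z) (snd z)). y \<in> V"
    using V f_in_V eventually_nhds by blast
  then have "\<forall>\<^sub>F y in nhds (f (fst z) (snd z)). k y $ a $ b = k y $ b $ a"
  proof (rule eventually_mono)
    fix y assume "y \<in> V"
    then have "transpose (k y) = k y"
      using k_posdef by (simp add: posdef_def)
    then show "k y $ a $ b = k y $ b $ a"
      by (rule transpose_nth_sym)
  qed
  then show ?thesis
    unfolding pd_def by (simp add: frechet_derivative_cong)
qed

lemma k_sym: "k (f (fst z) (snd z)) $ a $ b = k (f (fst z) (snd z)) $ b $ a"
  using k_posdef[OF f_in_V] transpose_nth_sym by (auto simp: posdef_def)

lemma kch_sym: "kch a b c z = kch a c b z"
  unfolding kch_def by (rule christoffel_sym[OF k_sym k_pd_sym])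

text \<open>The target metric is parallel for its Christoffel symbols, and the chain rule transports
  this along \<phi>. The direction \<open>v\<close> is arbitrary, so one lemma serves the spatial
  connection and the one in time.\<close>

lemma kc_metric: "frechet_derivative (kc a b) (at z) v = (\<Sum>e\<in>UNIV. ((\<Sum>p\<in>UNIV. kch p e a z * kc p b z)
    + (\<Sum>p\<in>UNIV. kc a p z * kch p e b z)) * frechet_derivative (fc e) (at z) v)"
proof -
  define y where "y = f (fst z) (snd z)"
  have lin: "linear (frechet_derivative (\<lambda>v. k v $ a $ b) (at y))"
    using smooth_near_derivative[OF k_near] has_derivative_linear unfolding y_def by blast
  define f' where "f' = frechet_derivative (\<lambda>z. f (fst z) (snd z)) (at z)"
  have f': "((\<lambda>z. f (fst z) (snd z)) has_derivative f') (at z)"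
    unfolding f'_def by (rule smooth_near_derivative[OF f_near])
  have fe: "frechet_derivative (fc e) (at z) v = f' v $ e" for e
    unfolding fc_def[abs_def] using bounded_linear.has_derivative[OF bounded_linear_vec_nth f']
    by (rule frechet_derivative_eq)
  have "frechet_derivative (kc a b) (at z) v = frechet_derivative (\<lambda>v. k v $ a $ b) (at y) (f' v)"
    unfolding kc_def[abs_def]
    by (rule frechet_derivative_eq, rule has_derivative_along[where z="\<lambda>z. f (fst z) (snd z)", OF _ f'])
      (use smooth_near_derivative[OF k_near] in \<open>simp add: y_def\<close>)
  also have "f' v = (\<Sum>e\<in>UNIV. (f' v $ e) *\<^sub>R axis e 1)"
    by (simp only: basis_expansion scalar_mult_eq_scaleR[symmetric])
  also have "frechet_derivative (\<lambda>v. k v $ a $ b) (at y) \<dots> = (\<Sum>e\<in>UNIV. (f' v $ e) * pd e (\<lambda>v. k v $ a $ b) y)"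
    by (simp add: linear_sum[OF lin] linear_scale[OF lin] pd_def)
  also have "\<dots> = (\<Sum>e\<in>UNIV. ((\<Sum>p\<in>UNIV. kch p e a z * kc p b z)
    + (\<Sum>p\<in>UNIV. kc a p z * kch p e b z)) * frechet_derivative (fc e) (at z) v)"
    unfolding fe kch_def kc_def y_def
    by (intro sum.cong refl) (simp add: christoffel_metric[OF k_posdef[OF f_in_V] k_pd_sym])
  finally show ?thesis .
qed

lemma vector_derivative_component:
  assumes "((\<lambda>s. F s (snd z)) has_vector_derivative d) (at (fst z))"
    "smooth_near (\<lambda>z. F (fst z) (snd z)) z"
  shows "frechet_derivative (\<lambda>z. F (fst z) (snd z)) (at z) tdir = d"
proof -
  have a: "((\<lambda>z. F (fst z) (snd z)) has_derivative frechet_derivative (\<lambda>z. F (fst z) (snd z)) (at z)) (at (fst z, snd z))"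
    using smooth_near_derivative[OF assms(2)] by simp
  have b: "((\<lambda>s. (s, snd z)) has_derivative (\<lambda>r. (r, 0))) (at (fst z))"
    by (auto intro!: derivative_eq_intros)
  have "((\<lambda>s. F s (snd z)) has_derivative (\<lambda>r. frechet_derivative (\<lambda>z. F (fst z) (snd z)) (at z) (r, 0))) (at (fst z))"
    using has_derivative_along[where z="\<lambda>s. (s, snd z)" and F="\<lambda>z. F (fst z) (snd z)", OF a b] by simp
  then have "(\<lambda>r. frechet_derivative (\<lambda>z. F (fst z) (snd z)) (at z) (r, 0)) = (\<lambda>r. r *\<^sub>R d)"
    using assms(1) unfolding has_vector_derivative_def by (rule has_derivative_unique)
  then show ?thesis
    by (metis scaleR_one)
qed

lemma frechet_derivative_nth:
  assumes "smooth_near F z"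
  shows "frechet_derivative (\<lambda>z. F z $ i) (at z) v = frechet_derivative F (at z) v $ i"
  by (rule frechet_derivative_eq[OF bounded_linear.has_derivative[OF bounded_linear_vec_nth
          smooth_near_derivative[OF assms]]])

lemma hc_dt: "frechet_derivative (hc i j) (at z) tdir = - (sc i j z + sc i j z)"
proof -
  have "frechet_derivative (\<lambda>z. h (fst z) (snd z)) (at z) tdir =
      (- 2) *\<^sub>R ricci (h (fst z)) (snd z) + (2 * \<alpha> (fst z)) *\<^sub>R grad_tensor k (f (fst z)) (snd z)"
    by (rule vector_derivative_component[OF h_flow h_near]) (simp add: z)
  then show ?thesis
    unfolding hc_def[abs_def] frechet_derivative_nth[OF smooth_near_nth[OF h_near]] frechet_derivative_nth[OF h_near]
    by (simp add: sc_def)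
qed

lemma fc_dt: "frechet_derivative (fc a) (at z) tdir = (\<Sum>i\<in>UNIV. \<Sum>j\<in>UNIV. hi i j z *
    (sp i (sp j (fc a)) z - (\<Sum>l\<in>UNIV. ch l i j z * sp l (fc a) z)
      + (\<Sum>b\<in>UNIV. \<Sum>c\<in>UNIV. kch a b c z * sp i (fc b) z * sp j (fc c) z)))"
proof -
  have "frechet_derivative (\<lambda>z. f (fst z) (snd z)) (at z) tdir = tension (h (fst z)) k (f (fst z)) (snd z)"
    by (rule vector_derivative_component[OF f_flow f_near]) (simp add: z)
  then show ?thesis
    unfolding fc_def[abs_def] frechet_derivative_nth[OF f_near]
    by (simp add: tension_def metric_trace_def second_fundamental_def hi_def ch_def kch_def sp_def)
qed



section \<open>Germs of the flow data\<close>

definition "gG = (\<chi> i j. germ_at z (hi i j))"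
definition "g\<Gamma> i = (\<chi> l j. germ_at z (ch l i j))"
definition "gg = (\<chi> i j. germ_at z (hc i j))"
definition "gS = (\<chi> i j. germ_at z (sc i j))"
definition "gK = (\<chi> a b. germ_at z (kc a b))"
definition "gf = (\<chi> a. germ_at z (fc a))"
text \<open>The pulled-back connection matrix in the space-time direction \<open>v\<close>:
  \<open>sdir i\<close> gives the matrices \<open>\<omega> i\<close>, and \<open>tdir\<close> gives
  \<open>\<omega>t\<close>.\<close>

definition "g\<omega> v = (\<chi> a c. \<Sum>b\<in>UNIV. germ_at z (kch a b c) * germ_D v (germ_at z (fc b)))"
definition "g\<alpha> = germ_at z (\<lambda>z. \<alpha> (fst z))"

end

text \<open>An identity of germs needs equality at all points of the open set \<open>W\<close>. This
  is why the context fixing \<open>z\<close> was closed: outside it, the pointwise facts are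
  available at every point of \<open>W\<close>.\<close>

lemma germ_at_eqI_W:
  assumes "z \<in> W" "smooth_near F z" "\<And>y. y \<in> W \<Longrightarrow> F y = H y"
  shows "germ_at z F = germ_at z H"
  by (rule germ_at_eqI[OF assms(2) eventually_mono[OF near_W[OF assms(1)]]]) (rule assms(3))

context
  fixes z assumes z: "z \<in> W"
begin

lemmas near = hc_near[OF z] hi_near[OF z] fc_near[OF z] ch_near[OF z] rm_near[OF z] \<alpha>_near[OF z]
  kc_near[OF z] kch_near[OF z] sc_near[OF z] Sfun_near[OF z]

lemmas near_intros = smooth_near_mult smooth_near_sum smooth_near_add smooth_near_diff smooth_near_minus
  smooth_near_const smooth_near_sp smooth_near_derivI near

lemma germ_prod_sum:
  assumes "\<And>p. smooth_near (F p) z" "\<And>p. smooth_near (H p) z"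
  shows "germ_at z (\<lambda>y. \<Sum>p\<in>X. F p y * H p y) = (\<Sum>p\<in>X. germ_at z (F p) * germ_at z (H p))"
  using assms by (simp add: germ_at_sum germ_at_mult smooth_near_mult)

lemma derivation_germ: "derivation (germ_D v)"
  by (simp add: derivation_def germ_D_add germ_D_mult)

lemma dm_gg: "derivation.mat_d (germ_D (sdir l)) (gg z) = transpose (g\<Gamma> z l) ** gg z + gg z ** g\<Gamma> z l"
proof -
  have "germ_D (sdir l) (germ_at z (hc i j)) = germ_at z (\<lambda>y. (\<Sum>p\<in>UNIV. ch p l i y * hc p j y) + (\<Sum>p\<in>UNIV. hc i p y * ch p l j y))" for i j
    unfolding germ_at_sp[OF hc_near[OF z], symmetric]
    by (rule germ_at_eqI_W[OF z]) (intro near_intros, rule hc_metric)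
  then show ?thesis
    by (simp add: vec_eq_iff derivation.mat_d_nth[OF derivation_germ] gg_def[OF z] g\<Gamma>_def[OF z] transpose_def matrix_matrix_mult_def
        germ_at_add germ_prod_sum smooth_near_sum smooth_near_mult near)
qed

lemma hG: "gg z ** gG z = mat 1" "gG z ** gg z = mat 1"
proof -
  have h: "h (fst y) (snd y) ** matrix_inv (h (fst y) (snd y)) = mat 1 \<and> matrix_inv (h (fst y) (snd y)) ** h (fst y) (snd y) = mat 1" if "y \<in> W" for y
  proof -
    have "posdef (h (fst y) (snd y))"
      using h_posdef[of "fst y" "snd y"] that by simp
    then show ?thesis
      using matrix_inv posdef_invertible by blast
  qed
  have const: "germ_at z (\<lambda>y. if i = j then 1 else 0) = (if i = j then 1 else 0)" for i j :: 'm
    by (simp add: germ_at_const)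
  have "germ_at z (\<lambda>y. \<Sum>p\<in>UNIV. hc i p y * hi p j y) = germ_at z (\<lambda>y. if i = j then 1 else 0)" for i j
  proof (rule germ_at_eqI_W[OF z])
    show "(\<Sum>p\<in>UNIV. hc i p y * hi p j y) = (if i = j then 1 else 0)" if "y \<in> W" for y
      using arg_cong[OF conjunct1[OF h[OF that]], of "\<lambda>M. M $ i $ j"]
      by (simp add: matrix_matrix_mult_def mat_def hc_def hi_def)
  qed (intro near_intros)
  then show "gg z ** gG z = mat 1"
    by (simp add: vec_eq_iff gg_def[OF z] gG_def[OF z] matrix_matrix_mult_def germ_prod_sum near mat_def const)
  have "germ_at z (\<lambda>y. \<Sum>p\<in>UNIV. hi i p y * hc p j y) = germ_at z (\<lambda>y. if i = j then 1 else 0)" for i j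
  proof (rule germ_at_eqI_W[OF z])
    show "(\<Sum>p\<in>UNIV. hi i p y * hc p j y) = (if i = j then 1 else 0)" if "y \<in> W" for y
      using arg_cong[OF conjunct2[OF h[OF that]], of "\<lambda>M. M $ i $ j"]
      by (simp add: matrix_matrix_mult_def mat_def hc_def hi_def)
  qed (intro near_intros)
  then show "gG z ** gg z = mat 1"
    by (simp add: vec_eq_iff gg_def[OF z] gG_def[OF z] matrix_matrix_mult_def germ_prod_sum near mat_def const)
qed

text \<open>Differentiate the product of metric and inverse, and insert the compatibility of the
  metric itself; this is the form required by \<open>curvature_ring\<close>.\<close>

lemma dm_gG: "derivation.mat_d (germ_D (sdir l)) (gG z) = - (g\<Gamma> z l ** gG z + gG z ** transpose (g\<Gamma> z l))"
proof -
  interpret d: derivation "germ_D (sdir l)" by (rule derivation_germ)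
  have c: "A ** gG z ** gg z = A" "A ** gg z ** gG z = A" for A :: "(real \<times> (real^'m)) germ^'m^'m"
    by (simp_all add: matrix_mul_assoc[symmetric] hG)
  have "d.mat_d (gg z ** gG z) = 0"
    by (simp add: hG)
  then have "gG z ** (d.mat_d (gg z) ** gG z + gg z ** d.mat_d (gG z)) = 0"
    by (simp add: d.mat_d_mult)
  then have "gG z ** transpose (g\<Gamma> z l) + g\<Gamma> z l ** gG z + d.mat_d (gG z) = 0"
    by (simp add: dm_gg matrix_ring_simps c hG)
  then show ?thesis
    by (simp add: eq_neg_iff_add_eq_0 algebra_simps)
qed

lemma dm_gK: "derivation.mat_d (germ_D v) (gK z) = transpose (g\<omega> z v) ** gK z + gK z ** g\<omega> z v"
proof -
  have "germ_D v (germ_at z (kc a b)) = germ_at z (\<lambda>y. \<Sum>e\<in>UNIV. ((\<Sum>p\<in>UNIV. kch p e a y * kc p b y)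
    + (\<Sum>p\<in>UNIV. kc a p y * kch p e b y)) * frechet_derivative (fc e) (at y) v)" for a b
    unfolding germ_at_D[OF kc_near[OF z], symmetric]
    by (rule germ_at_eqI_W[OF z]) (intro near_intros, rule kc_metric)
  also have "\<dots> a b = (\<Sum>e\<in>UNIV. ((\<Sum>p\<in>UNIV. germ_at z (kch p e a) * germ_at z (kc p b))
    + (\<Sum>p\<in>UNIV. germ_at z (kc a p) * germ_at z (kch p e b))) * germ_D v (germ_at z (fc e)))" for a b
    by (simp add: germ_at_sum germ_at_mult germ_at_add germ_at_D smooth_near_mult smooth_near_sum smooth_near_add
        smooth_near_derivI near)
  finally have *: "germ_D v (germ_at z (kc a b)) = (\<Sum>e\<in>UNIV. ((\<Sum>p\<in>UNIV. germ_at z (kch p e a) * germ_at z (kc p b))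
    + (\<Sum>p\<in>UNIV. germ_at z (kc a p) * germ_at z (kch p e b))) * germ_D v (germ_at z (fc e)))" for a b .
  have "germ_D v (germ_at z (kc a b)) = (\<Sum>p\<in>UNIV. \<Sum>e\<in>UNIV. germ_at z (kch p e a) * germ_D v (germ_at z (fc e)) * germ_at z (kc p b))
     + (\<Sum>p\<in>UNIV. \<Sum>e\<in>UNIV. germ_at z (kc a p) * (germ_at z (kch p e b) * germ_D v (germ_at z (fc e))))" for a b
    unfolding * distrib_right sum.distrib sum_distrib_right
    by (rule arg_cong2[where f="(+)"]; rule trans[OF sum.swap]; intro sum.cong refl) (simp_all only: mult_ac)
  then show ?thesis
    by (simp add: vec_eq_iff derivation.mat_d_nth[OF derivation_germ] gK_def[OF z] g\<omega>_def[OF z] transpose_def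
        matrix_matrix_mult_def sum_distrib_left sum_distrib_right)
qed

lemma g\<omega>_torsion: "g\<omega> z v *v derivation.vec_d (germ_D w) (gf z) = g\<omega> z w *v derivation.vec_d (germ_D v) (gf z)"
proof -
  have sym: "germ_at z (kch a b c) = germ_at z (kch a c b)" for a b c
    by (rule germ_at_eqI_W[OF z near(8)]) (rule kch_sym)
  have "(\<Sum>c\<in>UNIV. \<Sum>b\<in>UNIV. germ_at z (kch a b c) * germ_D v (germ_at z (fc b)) * germ_D w (germ_at z (fc c)))
    = (\<Sum>c\<in>UNIV. \<Sum>b\<in>UNIV. germ_at z (kch a b c) * germ_D w (germ_at z (fc b)) * germ_D v (germ_at z (fc c)))" for a
    by (subst sum.swap) (intro sum.cong refl, subst sym, simp only: mult_ac)
  then show ?thesis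
    by (simp add: vec_eq_iff matrix_vector_mult_def derivation.vec_d_nth[OF derivation_germ] g\<omega>_def[OF z] gf_def[OF z] sum_distrib_right)
qed

lemma hi_sym: "hi i j z = hi j i z"
  using matrix_inv_nth_sym[OF h_posdef[of "fst z" "snd z"]] z by (simp add: hi_def)


text \<open>The symmetry is read off from the flow: \<open>sc\<close> is minus half the time
  derivative of the symmetric matrix \<open>h\<close>. Thus the symmetry of the Ricci tensor is not
  derived from a Bianchi identity.\<close>

lemma sc_sym: "sc i j z = sc j i z"
proof -
  have "\<forall>\<^sub>F y in nhds z. hc i j y = hc j i y"
    using near_W[OF z] by (rule eventually_mono) (simp add: hc_def h_sym)
  then have "- (sc i j z + sc i j z) = - (sc j i z + sc j i z)"
    unfolding hc_dt[OF z, symmetric] by (simp add: frechet_derivative_cong)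
  then show ?thesis by simp
qed

end

section \<open>Interpretation of the algebraic locales by germs\<close>

context
  fixes z assumes z: "z \<in> W"
begin

lemmas near' = near[OF z]

lemma gnth: "gG z $ i $ j = germ_at z (hi i j)" "gg z $ i $ j = germ_at z (hc i j)" "gS z $ i $ j = germ_at z (sc i j)"
  "g\<Gamma> z i $ l $ j = germ_at z (ch l i j)" "gK z $ a $ b = germ_at z (kc a b)" "gf z $ a = germ_at z (fc a)"
  "g\<omega> z v $ a $ b = (\<Sum>c\<in>UNIV. germ_at z (kch a c b) * germ_D v (germ_at z (fc c)))"
  by (simp_all add: gG_def[OF z] gg_def[OF z] gS_def[OF z] g\<Gamma>_def[OF z] gK_def[OF z] gf_def[OF z] g\<omega>_def[OF z])

interpretation c: curvature_ring "\<lambda>i. germ_D (sdir i)" "gG z" "g\<Gamma> z"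
proof
  show "transpose (gG z) = gG z"
    using germ_at_eqI_W[OF z near'(2) hi_sym] by (simp add: vec_eq_iff transpose_def gnth)
  show "g\<Gamma> z i $ l $ k = g\<Gamma> z k $ l $ i" for i l k
    using germ_at_eqI_W[OF z near'(4) ch_sym] by (simp add: gnth)
qed (auto simp: germ_D_add germ_D_mult dm_gG[OF z] intro: germ_D_commute germ_two_cancel)

interpretation m: map_ring "\<lambda>i. germ_D (sdir i)" "gG z" "g\<Gamma> z" "gK z" "gf z" "\<lambda>i. g\<omega> z (sdir i)"
proof
  have "kc a b y = kc b a y" if "y \<in> W" for a b y
    using k_sym[OF that] by (simp add: kc_def)
  then have "germ_at z (kc a b) = germ_at z (kc b a)" for a b
    by (intro germ_at_eqI_W[OF z near'(7)])
  from this show "transpose (gK z) = gK z"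
    by (simp add: vec_eq_iff transpose_def gnth)
qed (rule dm_gK[OF z] g\<omega>_torsion[OF z])+

lemma curv_germ: "c.curv i j $ l $ p = germ_at z (rm l i j p)"
  unfolding rm_eq[abs_def]
  by (simp add: c.curv_def matrix_matrix_mult_def gnth germ_at_diff germ_at_add germ_at_sum germ_at_mult
      germ_at_sp near' smooth_near_sp smooth_near_diff smooth_near_add smooth_near_mult smooth_near_sum sum_subtractf)

lemma F_germ: "m.F i $ a = germ_at z (sp i (fc a))"
  by (simp add: m.F_def gnth germ_at_sp near')

lemma P_germ: "m.P $ i $ j = germ_at z (\<lambda>y. \<Sum>a\<in>UNIV. \<Sum>b\<in>UNIV. kc a b y * sp i (fc a) y * sp j (fc b) y)"
  by (simp add: m.P_def m.ip_def dotp_def F_germ gnth matrix_vector_mult_def sum_distrib_left germ_at_sum germ_at_mult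
      near' smooth_near_sp smooth_near_mult smooth_near_sum mult_ac)

text \<open>The germ of the tension field is expressed by the time derivative of \<phi>, which is
  what the equation \<open>Dt_f\<close> of the coupled flow asks for.\<close>

lemma tens_germ: "m.tens $ a = germ_at z (\<lambda>y. frechet_derivative (fc a) (at y) tdir)"
proof -
  have "germ_at z (\<lambda>y. frechet_derivative (fc a) (at y) tdir) = germ_at z (\<lambda>y. \<Sum>i\<in>UNIV. \<Sum>j\<in>UNIV. hi i j y *
    (sp i (sp j (fc a)) y - (\<Sum>l\<in>UNIV. ch l i j y * sp l (fc a) y)
      + (\<Sum>b\<in>UNIV. \<Sum>c\<in>UNIV. kch a b c y * sp i (fc b) y * sp j (fc c) y)))"
    by (rule germ_at_eqI_W[OF z]) (intro near_intros[OF z], rule fc_dt)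
  also have "\<dots> = (\<Sum>i\<in>UNIV. \<Sum>j\<in>UNIV. germ_at z (hi i j) *
    (germ_D (sdir i) (germ_D (sdir j) (germ_at z (fc a))) - (\<Sum>l\<in>UNIV. germ_at z (ch l i j) * germ_at z (sp l (fc a)))
      + (\<Sum>b\<in>UNIV. \<Sum>c\<in>UNIV. germ_at z (kch a b c) * germ_D (sdir i) (germ_at z (fc b)) * germ_D (sdir j) (germ_at z (fc c)))))"
    by (simp add: germ_at_sum germ_at_mult germ_at_add germ_at_diff germ_at_sp
      near' smooth_near_sp smooth_near_mult smooth_near_sum smooth_near_add smooth_near_diff)
  also have "\<dots> = m.tens $ a"
  proof -
    have "(\<Sum>b\<in>UNIV. \<Sum>c\<in>UNIV. germ_at z (kch a b c) * germ_D (sdir i) (germ_at z (fc b)) * germ_D (sdir j) (germ_at z (fc c)))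
      = (g\<omega> z (sdir i) *v m.F j) $ a" for i j
      by (subst sum.swap) (simp add: matrix_vector_mult_def gnth F_germ germ_at_sp near' sum_distrib_right)
    then show ?thesis
      by (simp add: m.tens_def m.hess_def m.nab_def gnth F_germ germ_at_sp near' algebra_simps)
  qed
  finally show ?thesis ..
qed

interpretation r: rh_ring "\<lambda>i. germ_D (sdir i)" "gG z" "g\<Gamma> z" "germ_D tdir" "gg z" "gS z" "gK z" "gf z"
  "\<lambda>i. g\<omega> z (sdir i)" "g\<omega> z tdir" "g\<alpha> z"
proof
  show "transpose (gS z) = gS z"
    using germ_at_eqI_W[OF z near'(9) sc_sym] by (simp add: vec_eq_iff transpose_def gnth)
  have "germ_D tdir (germ_at z (hc i j)) = germ_at z (\<lambda>y. - (sc i j y + sc i j y))" for i j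
    unfolding germ_at_D[OF near'(1), symmetric]
    by (rule germ_at_eqI_W[OF z]) (intro near_intros[OF z], rule hc_dt)
  then have "germ_D tdir (germ_at z (hc i j)) = - (germ_at z (sc i j) + germ_at z (sc i j))" for i j
    by (simp only: germ_at_minus germ_at_add smooth_near_add near')
  then show "derivation.mat_d (germ_D tdir) (gg z) = - (gS z + gS z)"
    by (simp add: vec_eq_iff derivation.mat_d_nth[OF derivation_germ[OF z]] gnth)
  show "germ_D (sdir i) (g\<alpha> z) = 0" for i
  proof -
    have "frechet_derivative (\<lambda>y. \<alpha> (fst y)) (at y) (sdir i) = 0" if y: "y \<in> W" for y
    proof -
      have "(\<alpha> has_derivative frechet_derivative \<alpha> (at (fst y))) (at (fst y))"
        using \<alpha>_smooth[of "fst y" "snd y"] y by (simp add: smooth_near_derivative)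
      then have "((\<lambda>y. \<alpha> (fst y)) has_derivative (\<lambda>v. frechet_derivative \<alpha> (at (fst y)) (fst v))) (at y)"
        by (rule has_derivative_along) (auto intro!: derivative_eq_intros)
      then have "frechet_derivative (\<lambda>y. \<alpha> (fst y)) (at y) (sdir i) = frechet_derivative \<alpha> (at (fst y)) 0"
        by (simp add: frechet_derivative_eq)
      also have "\<dots> = 0"
        using \<alpha>_smooth[of "fst y" "snd y"] y linear_0[OF has_derivative_linear[OF smooth_near_derivative]] by simp
      finally show ?thesis .
    qed
    then have "germ_at z (\<lambda>y. frechet_derivative (\<lambda>y. \<alpha> (fst y)) (at y) (sdir i)) = germ_at z (\<lambda>y. 0)"
      by (intro germ_at_eqI_W[OF z] near_intros[OF z])
    then show ?thesis
      by (simp add: germ_at_D near' g\<alpha>_def[OF z] germ_at_const)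
  qed
  show "gS z $ i $ j = c.ric $ i $ j - g\<alpha> z * m.P $ i $ j" for i j
    unfolding P_germ
    by (simp add: gnth sc_eq[abs_def] c.ric_def curv_germ g\<alpha>_def[OF z] germ_at_sum germ_at_mult germ_at_diff
        near' smooth_near_sp smooth_near_mult smooth_near_sum)
  show "derivation.vec_d (germ_D tdir) (gf z) = m.tens"
    by (simp add: vec_eq_iff derivation.vec_d_nth[OF derivation_germ[OF z]] gnth tens_germ germ_at_D near')
qed (rule germ_D_add germ_D_mult germ_D_commute hG[OF z] dm_gK[OF z] g\<omega>_torsion[OF z])+

lemma Sc_germ: "r.Sc = germ_at z Sfun"
  unfolding Sfun_def[abs_def]
  by (simp add: r.Sc_def m.trace_G gnth germ_at_sum germ_at_mult near' smooth_near_mult smooth_near_sum)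

lemma posdef_z: "posdef (h (fst z) (snd z))" "posdef (k (f (fst z) (snd z)))"
  using h_posdef[of "fst z" "snd z"] k_posdef[OF f_in_V[OF z]] z by simp_all

lemma psd_hi: "psd (\<lambda>i j. hi i j z)"
  using posdef_psd[OF posdef_inv[OF posdef_z(1)]] by (simp add: hi_def)

lemma psd_kc: "psd (\<lambda>a b. kc a b z)"
  using posdef_psd[OF posdef_z(2)] by (simp add: kc_def)

lemma ev_near: "germ_ev (germ_at z (hi i j)) = hi i j z" "germ_ev (germ_at z (sc i j)) = sc i j z"
  "germ_ev (germ_at z (kc a b)) = kc a b z" "germ_ev (germ_at z (ch l i j)) = ch l i j z"
  by (simp_all add: germ_ev_at near')

lemma energy_nonneg: "0 \<le> germ_ev m.energy"
proof -
  have "germ_ev m.energy = (\<Sum>i\<in>UNIV. \<Sum>j\<in>UNIV. hi i j z * (\<Sum>a\<in>UNIV. \<Sum>b\<in>UNIV. kc a b z * germ_ev (m.F i $ a) * germ_ev (m.F j $ b)))"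
    by (simp add: m.energy_def m.trace_G m.P_def m.ip_def dotp_def matrix_vector_mult_def gnth ev_near
        sum_distrib_left mult_ac)
  then show ?thesis
    using psd_trace_nonneg[OF psd_hi psd_congruence[OF psd_kc, of "\<lambda>i a. germ_ev (m.F i $ a)"]] by simp
qed

lemma ip_nonneg: "0 \<le> germ_ev (m.ip U U)"
  using psd_nonneg[OF psd_kc, of "\<lambda>a. germ_ev (U $ a)"]
  by (simp add: m.ip_def dotp_def matrix_vector_mult_def gnth ev_near sum_distrib_left mult_ac)

text \<open>|S_ij|^2 is the trace of the inverse metric against its own congruence by
  \<open>S\<close>. Both forms are positive semidefinite, so no diagonalisation is involved.\<close>

lemma trace_square_nonneg: "0 \<le> germ_ev (trace (gS z ** gG z ** gS z ** gG z))"
proof -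
  have 1: "germ_ev (trace (gS z ** gG z ** gS z ** gG z)) =
    (\<Sum>i\<in>UNIV. \<Sum>j\<in>UNIV. hi i j z * germ_ev ((gS z ** gG z ** gS z) $ i $ j))"
    by (simp add: m.trace_G gnth ev_near)
  have 2: "germ_ev ((gS z ** gG z ** gS z) $ i $ j) = (\<Sum>a\<in>UNIV. \<Sum>b\<in>UNIV. hi a b z * sc i a z * sc j b z)" for i j
    by (subst sum.swap) (simp add: matrix_matrix_mult_def gnth ev_near sum_distrib_left sum_distrib_right
        sc_sym[OF z, of _ j] mult_ac)
  show ?thesis
    unfolding 1 2 by (rule psd_trace_nonneg[OF psd_hi psd_congruence[OF psd_hi, of "\<lambda>i a. sc i a z"]])
qed

text \<open>Evaluation of the evolution equation at the base point; the three terms other than the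
  Laplacian are nonnegative under the sign conditions on \<alpha> and its derivative.\<close>

lemma evolution_ineq:
  assumes "0 \<le> \<alpha> (fst z)" "frechet_derivative \<alpha> (at (fst z)) 1 \<le> 0"
  shows "(\<Sum>i\<in>UNIV. \<Sum>j\<in>UNIV. hi i j z * (sp i (sp j Sfun) z - (\<Sum>l\<in>UNIV. ch l i j z * sp l Sfun z)))
    \<le> frechet_derivative Sfun (at z) tdir"
proof -
  have "germ_ev (germ_D tdir (g\<alpha> z)) = frechet_derivative \<alpha> (at (fst z)) 1"
  proof -
    have "(\<alpha> has_derivative frechet_derivative \<alpha> (at (fst z))) (at (fst z))"
      using \<alpha>_smooth[of "fst z" "snd z"] z by (simp add: smooth_near_derivative)
    then have "((\<lambda>y. \<alpha> (fst y)) has_derivative (\<lambda>v. frechet_derivative \<alpha> (at (fst z)) (fst v))) (at z)"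
      by (rule has_derivative_along) (auto intro!: derivative_eq_intros)
    then show ?thesis
      by (simp add: g\<alpha>_def[OF z] germ_at_D[symmetric] near' germ_ev_at smooth_near_derivI frechet_derivative_eq)
  qed
  then have "0 \<le> 2 * germ_ev (trace (gS z ** gG z ** gS z ** gG z)) + 2 * \<alpha> (fst z) * germ_ev (m.ip m.tens m.tens)
      - germ_ev (germ_D tdir (g\<alpha> z)) * germ_ev m.energy"
    using mult_nonpos_nonneg[OF assms(2) energy_nonneg] mult_nonneg_nonneg[OF assms(1) ip_nonneg[of m.tens]]
      trace_square_nonneg by simp
  moreover have "germ_ev (g\<alpha> z) = \<alpha> (fst z)"
    by (simp add: g\<alpha>_def[OF z] germ_ev_at near')
  moreover have "germ_ev (germ_D tdir r.Sc) = frechet_derivative Sfun (at z) tdir"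
    by (simp add: Sc_germ germ_at_D[symmetric] near' germ_ev_at smooth_near_derivI)
  moreover have "germ_ev (germ_D (sdir i) r.Sc) = sp i Sfun z" "germ_ev (germ_D (sdir i) (germ_D (sdir j) r.Sc)) = sp i (sp j Sfun) z" for i j
    by (simp_all add: Sc_germ germ_at_sp[symmetric] near' germ_ev_at smooth_near_sp)
  ultimately show ?thesis
    using arg_cong[OF r.evolution, of germ_ev]
    by (simp add: gnth ev_near)
qed

end


end

section \<open>The second derivative test at a spatial minimum\<close>

lemma line_derivative:
  assumes "smooth_near \<Phi> (t, u + r *\<^sub>R v)"
  shows "((\<lambda>r. \<Phi> (t, u + r *\<^sub>R v)) has_real_derivative (\<Sum>i\<in>UNIV. v $ i * sp i \<Phi> (t, u + r *\<^sub>R v))) (at r)"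
proof -
  define L where "L = frechet_derivative \<Phi> (at (t, u + r *\<^sub>R v))"
  have L: "(\<Phi> has_derivative L) (at (t, u + r *\<^sub>R v))"
    unfolding L_def by (rule smooth_near_derivative[OF assms])
  then have lin: "linear L"
    by (rule has_derivative_linear)
  have "((\<lambda>r. \<Phi> (t, u + r *\<^sub>R v)) has_derivative (\<lambda>s. L (0, s *\<^sub>R v))) (at r)"
    by (rule has_derivative_along[where z="\<lambda>r. (t, u + r *\<^sub>R v)", OF L]) (auto intro!: derivative_eq_intros)
  moreover have "L (0, s *\<^sub>R v) = (\<Sum>i\<in>UNIV. v $ i * sp i \<Phi> (t, u + r *\<^sub>R v)) * s" for s
  proof -
    have "(0, s *\<^sub>R v) = s *\<^sub>R (\<Sum>i\<in>UNIV. (v $ i) *\<^sub>R sdir i)"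
      by (simp add: prod_eq_iff fst_sum snd_sum basis_expansion scalar_mult_eq_scaleR[symmetric])
    then show ?thesis
      by (simp only: linear_sum[OF lin] linear_scale[OF lin] sp_eq[OF assms] L_def[symmetric])
        (simp add: mult.commute)
  qed
  ultimately show ?thesis
    by (simp add: has_field_derivative_def)
qed

text \<open>If \<open>c\<close> were negative, \<open>q\<close> would be negative just to the right
  of 0, and the mean value theorem would make \<open>p\<close> smaller than at 0.\<close>

lemma second_derivative_at_min:
  fixes p q :: "real \<Rightarrow> real"
  assumes p: "\<forall>\<^sub>F r in nhds 0. (p has_real_derivative q r) (at r)"
    and q: "(q has_real_derivative c) (at 0)" and min: "\<forall>\<^sub>F r in nhds 0. p 0 \<le> p r"
  shows "q 0 = 0" "0 \<le> c"
proof -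
  obtain e where e: "0 < e" "\<And>r. \<bar>r\<bar> < e \<Longrightarrow> (p has_real_derivative q r) (at r)" "\<And>r. \<bar>r\<bar> < e \<Longrightarrow> p 0 \<le> p r"
    using eventually_conj[OF p min] unfolding eventually_nhds_metric by (auto simp: dist_real_def)
  show q0: "q 0 = 0"
    by (rule DERIV_local_min[OF e(2) e(1)]) (use e in auto)
  show "0 \<le> c"
  proof (rule ccontr)
    assume "\<not> 0 \<le> c"
    then obtain d where d: "0 < d" "\<And>h. 0 < h \<Longrightarrow> h < d \<Longrightarrow> q h < 0"
      using DERIV_neg_dec_right[OF q] q0 by auto
    define r where "r = min d e / 2"
    have r: "0 < r" "r < d" "r < e"
      using d(1) e(1) by (auto simp: r_def)
    obtain s where "0 < s" "s < r" "p r - p 0 = r * q s"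
      using MVT2[of 0 r p q] r e(2) by auto
    then show False
      using d(2)[of s] e(3)[of r] r mult_pos_neg[of r "q s"] by auto
  qed
qed

lemma sp_commute:
  assumes "smooth_near \<Phi> z"
  shows "sp i (sp j \<Phi>) z = sp j (sp i \<Phi>) z"
proof -
  have "germ_D (sdir i) (germ_D (sdir j) (germ_at z \<Phi>)) = germ_D (sdir j) (germ_D (sdir i) (germ_at z \<Phi>))"
    by (rule germ_D_commute)
  from arg_cong[OF this, of germ_ev] show ?thesis
    by (simp add: germ_at_sp[symmetric] germ_ev_at assms smooth_near_sp)
qed

lemma hessian_at_min:
  assumes "smooth_near \<Phi> z" "\<forall>\<^sub>F w in nhds (snd z). \<Phi> z \<le> \<Phi> (fst z, w)"
  shows "sp i \<Phi> z = 0" "psd (\<lambda>i j. sp i (sp j \<Phi>) z)"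
proof -
  obtain t u where z: "z = (t, u)"
    by (cases z)
  have lim: "((\<lambda>r. u + r *\<^sub>R v) \<longlongrightarrow> u) (nhds 0)" for v
  proof -
    have "isCont (\<lambda>r. u + r *\<^sub>R v) 0"
      by (intro continuous_intros)
    then have "((\<lambda>r. u + r *\<^sub>R v) \<longlongrightarrow> u + 0 *\<^sub>R v) (nhds 0)"
      unfolding isCont_def by (rule iffD1[OF tendsto_at_iff_tendsto_nhds[of "\<lambda>r. u + r *\<^sub>R v" "0::real"]])
    then show ?thesis by simp
  qed
  have lim': "((\<lambda>r. (t, u + r *\<^sub>R v)) \<longlongrightarrow> z) (nhds 0)" for v
    unfolding z by (intro tendsto_Pair tendsto_const lim)
  have near: "\<forall>\<^sub>F r in nhds 0. smooth_near \<Phi> (t, u + r *\<^sub>R v)" for v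
    using smooth_near_eventually[OF assms(1)] lim'[of v] by (simp add: filterlim_iff)
  define q where "q v r = (\<Sum>i\<in>UNIV. v $ i * sp i \<Phi> (t, u + r *\<^sub>R v))" for v r
  have p: "\<forall>\<^sub>F r in nhds 0. ((\<lambda>r. \<Phi> (t, u + r *\<^sub>R v)) has_real_derivative q v r) (at r)" for v
    using near unfolding q_def by (rule eventually_mono) (rule line_derivative)
  have q': "(q v has_real_derivative (\<Sum>i\<in>UNIV. v $ i * (\<Sum>j\<in>UNIV. v $ j * sp j (sp i \<Phi>) z))) (at 0)" for v
  proof -
    have "((\<lambda>r. sp i \<Phi> (t, u + r *\<^sub>R v)) has_real_derivative (\<Sum>j\<in>UNIV. v $ j * sp j (sp i \<Phi>) z)) (at 0)" for i
      using line_derivative[of "sp i \<Phi>" t u 0 v] smooth_near_sp[OF assms(1)] by (simp add: z)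
    then show ?thesis
      unfolding q_def[abs_def] by (intro DERIV_sum DERIV_cmult)
  qed
  have min: "\<forall>\<^sub>F r in nhds 0. \<Phi> (t, u + 0 *\<^sub>R v) \<le> \<Phi> (t, u + r *\<^sub>R v)" for v
    using filterlim_iff[THEN iffD1, OF lim[of v], rule_format, of "\<lambda>w. \<Phi> (t, u) \<le> \<Phi> (t, w)"] assms(2)
    by (simp add: z)
  note m = second_derivative_at_min[OF p q' min]
  have "(\<Sum>j\<in>UNIV. axis i 1 $ j * sp j \<Phi> z) = sp i \<Phi> z"
    by (simp add: axis_def if_distrib[of "\<lambda>x. x * _"] cong: if_cong)
  then show "sp i \<Phi> z = 0"
    using m(1)[of "axis i 1"] by (simp add: q_def z)
  show "psd (\<lambda>i j. sp i (sp j \<Phi>) z)"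
    unfolding psd_def
  proof (intro conjI allI)
    fix v :: "'a \<Rightarrow> real"
    show "0 \<le> (\<Sum>i\<in>UNIV. \<Sum>j\<in>UNIV. sp i (sp j \<Phi>) z * v i * v j)"
      using m(2)[of "\<chi> i. v i"] by (subst sum.swap) (simp add: sum_distrib_left mult_ac)
  qed (rule sp_commute[OF assms(1)])
qed

context local_flow
begin

text \<open>At a spatial minimum the gradient, and with it the \<Gamma>-term of the Laplacian,
  vanishes; the trace of the positive semidefinite Hessian is nonnegative.\<close>

lemma time_derivative_at_min:
  assumes z: "z \<in> W" and "0 \<le> \<alpha> (fst z)" "frechet_derivative \<alpha> (at (fst z)) 1 \<le> 0"
    and min: "\<forall>\<^sub>F w in nhds (snd z). Sfun z \<le> Sfun (fst z, w)"
  shows "0 \<le> frechet_derivative Sfun (at z) tdir"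
proof -
  note H = hessian_at_min[OF Sfun_near[OF z] min]
  have "0 \<le> (\<Sum>i\<in>UNIV. \<Sum>j\<in>UNIV. hi i j z * sp i (sp j Sfun) z)"
    by (rule psd_trace_nonneg[OF psd_hi[OF z] H(2)])
  then show ?thesis
    using evolution_ineq[OF assms(1-3)] by (simp add: H(1))
qed

end

section \<open>The minimum principle\<close>

lemma matrix_scaleR:
  "A ** (r *\<^sub>R B) = r *\<^sub>R (A ** B)" "(r *\<^sub>R A) ** B = r *\<^sub>R (A ** B)" for A B :: "real^'n^'n"
  by (simp_all add: vec_eq_iff matrix_matrix_mult_def sum_distrib_left mult_ac)

lemma metric_trace_eq: "metric_trace G b = trace (matrix_inv G ** transpose b)"
  by (simp add: metric_trace_def trace_def matrix_matrix_mult_def transpose_def)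

text \<open>Invertibility of \<open>J\<close> is extracted from that of
  \<open>transpose J ** G ** J\<close>; then the factors \<open>J\<close> and its inverse cancel
  under the trace.\<close>

lemma metric_trace_congruence:
  fixes G b J :: "real^'m^'m"
  assumes "invertible G" "invertible (transpose J ** G ** J)"
  shows "metric_trace (transpose J ** G ** J) (transpose J ** b ** J) = metric_trace G b"
proof -
  obtain L where "L ** J = mat 1"
    using matrix_inv(2)[OF assms(2)] by (metis matrix_mul_assoc)
  then have inv: "invertible J"
    using invertible_left_inverse by blast
  define K where "K = matrix_inv J"
  note J = matrix_inv[OF inv, folded K_def] and G = matrix_inv[OF assms(1)]
  have JT: "transpose K ** transpose J = mat 1" "transpose J ** transpose K = mat 1"
    using J by (simp_all add: matrix_transpose_mul[symmetric])
  have c: "A ** transpose K ** transpose J = A" "A ** J ** K = A" "A ** G ** matrix_inv G = A" "A ** matrix_inv G ** G = A"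
    "A ** K ** J = A" "A ** transpose J ** transpose K = A" for A :: "real^'m^'m"
    using J G JT by (simp_all add: matrix_mul_assoc[symmetric])
  have "matrix_inv (transpose J ** G ** J) = K ** matrix_inv G ** transpose K"
    by (rule matrix_inv_unique) (simp_all add: matrix_mul_assoc c JT J)
  then have "metric_trace (transpose J ** G ** J) (transpose J ** b ** J)
      = trace (K ** (matrix_inv G ** transpose b ** J))"
    by (simp add: metric_trace_eq matrix_transpose_mul matrix_mul_assoc c)
  also have "\<dots> = trace (matrix_inv G ** transpose b ** J ** K)"
    by (rule trace_mul_sym)
  finally show ?thesis
    by (simp add: c metric_trace_eq)
qed

lemma metric_trace_linear:
  "metric_trace G (a + b) = metric_trace G a + metric_trace G b"
  "metric_trace G (r *\<^sub>R a) = r * metric_trace G a"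
  by (simp_all add: metric_trace_def algebra_simps sum.distrib sum_distrib_left)

lemma continuous_on_det:
  fixes A :: "'a::topological_space \<Rightarrow> real^'n^'n"
  assumes "\<And>i j. continuous_on S (\<lambda>x. A x $ i $ j)"
  shows "continuous_on S (\<lambda>x. det (A x))"
  unfolding det_def by (intro continuous_intros assms)

lemma continuous_on_matrix_inv:
  fixes A :: "'a::topological_space \<Rightarrow> real^'n^'n"
  assumes "continuous_on S A" "\<And>x. x \<in> S \<Longrightarrow> invertible (A x)"
  shows "continuous_on S (\<lambda>x. matrix_inv (A x) $ i $ j)"
proof -
  have nth: "continuous_on S (\<lambda>x. A x $ i $ j)" for i j
    by (intro continuous_intros assms(1))
  have "continuous_on S (\<lambda>x. (\<chi> r c. if c = i then axis j 1 $ r else A x $ r $ c) $ r $ c)" for r c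
    using nth by (cases "c = i") simp_all
  then have "continuous_on S (\<lambda>x. det (\<chi> r c. if c = i then axis j 1 $ r else A x $ r $ c) * inverse (det (A x)))"
    using assms(2) invertible_det_nz by (intro continuous_intros continuous_on_det nth) auto
  then show ?thesis
    using assms(2) by (simp add: matrix_inv_cramer cong: continuous_on_cong)
qed

lemma time_interval_open: "open {t. 0 < t \<and> t \<in> time_interval T}"
proof -
  have "{t. 0 < t \<and> t \<in> time_interval T} = {0<..} \<inter> ereal -` {..<T}"
    by (auto simp: time_interval_def)
  then show ?thesis
    by (simp add: open_Int open_ereal_vimage)
qed

text \<open>Makes derivatives within the time interval unique, also the one-sided derivative at time
  0.\<close>

lemma time_interval_islimpt:
  assumes "t \<in> time_interval T"
  shows "at t within time_interval T \<noteq> bot"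
proof -
  obtain s where s: "ereal t < ereal s" "ereal s < T"
    using assms ereal_dense2[of "ereal t" T] by (auto simp: time_interval_def)
  have "t islimpt {t<..<s}"
    using s by (intro islimpt_greaterThanLessThan1) simp
  moreover have "{t<..<s} \<subseteq> time_interval T"
    using assms s by (auto simp: time_interval_def intro: less_trans[of _ "ereal s"])
  ultimately show ?thesis
    using islimpt_subset trivial_limit_within by blast
qed

lemma riemannian_posdef:
  assumes "riemannian_metric A g" "c \<in> A" "u \<in> cran c"
  shows "posdef (g c u)"
  using assms unfolding riemannian_metric_def posdef_def by blast

lemma chart_at_in:
  assumes "smooth_atlas A"
  shows "chart_at A p \<in> A" "p \<in> cdom (chart_at A p)"
proof -
  have "\<exists>c. c \<in> A \<and> p \<in> cdom c"
    using assms unfolding smooth_atlas_def by blast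
  from someI_ex[OF this] show "chart_at A p \<in> A" "p \<in> cdom (chart_at A p)"
    unfolding chart_at_def by auto
qed

lemma cinv_cmap:
  assumes "smooth_atlas A" "c \<in> A" "p \<in> cdom c"
  shows "cinv c (cmap c p) = p"
  using assms unfolding smooth_atlas_def is_chart_def homeomorphism_def by blast

lemma cinv_cran:
  assumes "smooth_atlas A" "c \<in> A" "u \<in> cran c"
  shows "cinv c u \<in> cdom c" "cmap c (cinv c u) = u"
  using assms cinv_cmap[OF assms(1,2)] by auto

section \<open>The function \<open>S\<close> on the whole manifold: chart independence and
  continuity\<close>

locale flow =
  fixes A :: "('p::t2_space, 'm::finite) chart set"
    and B :: "('q::t2_space, 'n::finite) chart set"
    and \<gamma> :: "('q, 'n) metric" and T :: ereal and \<alpha> :: "real \<Rightarrow> real"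
    and g :: "real \<Rightarrow> ('p, 'm) metric" and \<phi> :: "real \<Rightarrow> 'p \<Rightarrow> 'q"
  assumes M: "closed_manifold A" and N: "closed_manifold B" "riemannian_metric B \<gamma>"
    and T: "0 < T"
    and flow: "RH_flow A B \<gamma> (time_interval T) \<alpha> g \<phi>"
    and \<alpha>_mono: "antimono_on (time_interval T) \<alpha>"
    and \<alpha>_nonneg: "s \<in> time_interval T \<Longrightarrow> 0 \<le> \<alpha> s"
begin

abbreviation I where "I \<equiv> time_interval T"

definition Sf :: "real \<Rightarrow> 'p \<Rightarrow> real" where
  "Sf t p = scalar_curvature A (g t) p - \<alpha> t * grad_norm_sq A B \<gamma> (g t) (\<phi> t) p"

lemma atlas: "smooth_atlas A" "smooth_atlas B"
  using M N unfolding closed_manifold_def by auto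

lemma charts: "c \<in> A \<Longrightarrow> open (cdom c) \<and> open (cran c) \<and> continuous_on (cdom c) (cmap c) \<and> continuous_on (cran c) (cinv c)"
  using atlas unfolding smooth_atlas_def is_chart_def homeomorphism_def by blast

lemma charts_B: "d \<in> B \<Longrightarrow> open (cdom d) \<and> open (cran d)"
  using atlas unfolding smooth_atlas_def is_chart_def by blast

lemma smooth_g: "c \<in> A \<Longrightarrow> smooth_on (I \<times> cran c) (\<lambda>(t, u). g t c u)"
  and metric_g: "t \<in> I \<Longrightarrow> riemannian_metric A (g t)"
  and smooth_phi: "c \<in> A \<Longrightarrow> d \<in> B \<Longrightarrow> smooth_on {(t, u). t \<in> I \<and> u \<in> cran c \<and> \<phi> t (cinv c u) \<in> cdom d}
        (\<lambda>(t, u). local_rep c d (\<phi> t) u)"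
  and cont_phi: "continuous_on (I \<times> UNIV) (\<lambda>(t, p). \<phi> t p)"
  and smooth_\<alpha>: "smooth_on I \<alpha>"
  using flow unfolding RH_flow_def smooth_metric_family_def smooth_map_family_def by auto

lemma flow_eqs:
  assumes "c \<in> A" "d \<in> B" "t \<in> I" "u \<in> cran c" "\<phi> t (cinv c u) \<in> cdom d"
  shows "((\<lambda>s. g s c u) has_vector_derivative (- 2) *\<^sub>R ricci (g t c) u
           + (2 * \<alpha> t) *\<^sub>R grad_tensor (\<gamma> d) (local_rep c d (\<phi> t)) u) (at t within I)"
    "((\<lambda>s. local_rep c d (\<phi> s) u) has_vector_derivative
           tension (g t c) (\<gamma> d) (local_rep c d (\<phi> t)) u) (at t within I)"
  using flow assms unfolding RH_flow_def by blast+

lemma posdef_g: "t \<in> I \<Longrightarrow> c \<in> A \<Longrightarrow> u \<in> cran c \<Longrightarrow> posdef (g t c u)"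
  by (rule riemannian_posdef[OF metric_g])

text \<open>The flow equation identifies \<open>S = R - \<alpha> \<bar>\<nabla>\<phi>\<bar>\<^sup>2\<close> with \<open>-\<close> half of the metric trace of the time
  derivative of the metric. Since the transition maps do not depend on time, this makes \<open>S\<close>
  independent of the charts, without any transformation law for the curvature.\<close>

lemma flow_trace:
  assumes "c \<in> A" "d \<in> B" "t \<in> I" "u \<in> cran c" "\<phi> t (cinv c u) \<in> cdom d"
    and D: "((\<lambda>s. g s c u) has_vector_derivative D) (at t within I)"
  shows "local_scalar (g t c) u - \<alpha> t * metric_trace (g t c u) (grad_tensor (\<gamma> d) (local_rep c d (\<phi> t)) u)
    = - (1 / 2) * metric_trace (g t c u) D"
proof -
  have "D = (- 2) *\<^sub>R ricci (g t c) u + (2 * \<alpha> t) *\<^sub>R grad_tensor (\<gamma> d) (local_rep c d (\<phi> t)) u"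
    by (rule vector_derivative_unique_within[OF time_interval_islimpt[OF assms(3)] D flow_eqs(1)[OF assms(1-5)]])
  then show ?thesis
    by (simp only: metric_trace_linear local_scalar_def) (simp add: field_simps)
qed

lemma derivative_transform:
  assumes "c \<in> A" "d \<in> A" "p \<in> cdom c \<inter> cdom d" "t \<in> I"
    and D: "((\<lambda>s. g s d (cmap d p)) has_vector_derivative D) (at t within I)"
  shows "\<exists>D'. ((\<lambda>s. g s c (cmap c p)) has_vector_derivative D') (at t within I) \<and>
    metric_trace (g t c (cmap c p)) D' = metric_trace (g t d (cmap d p)) D"
proof -
  define J where "J = jacobian (cmap d \<circ> cinv c) (at (cmap c p))"
  have eq: "g s c (cmap c p) = transpose J ** g s d (cmap d p) ** J" if "s \<in> I" for s
    using metric_g[OF that] assms(1-3) unfolding riemannian_metric_def Let_def J_def by blast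
  have "bounded_linear (\<lambda>X :: real^'m^'m. transpose J ** X ** J)"
    by (intro linear_conv_bounded_linear[THEN iffD1] linearI)
      (simp_all only: matrix_add_ldistrib matrix_add_rdistrib' matrix_scaleR)
  then have "((\<lambda>s. transpose J ** g s d (cmap d p) ** J) has_vector_derivative transpose J ** D ** J) (at t within I)"
    by (rule bounded_linear.has_vector_derivative[OF _ D])
  then have "((\<lambda>s. g s c (cmap c p)) has_vector_derivative transpose J ** D ** J) (at t within I)"
    by (rule has_vector_derivative_transform[OF assms(4), rotated]) (simp add: eq)
  moreover have "metric_trace (g t c (cmap c p)) (transpose J ** D ** J) = metric_trace (g t d (cmap d p)) D"
    unfolding eq[OF assms(4)]
  proof (rule metric_trace_congruence)
    show "invertible (g t d (cmap d p))"
      using assms by (intro posdef_invertible posdef_g) auto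
    show "invertible (transpose J ** g t d (cmap d p) ** J)"
      unfolding eq[OF assms(4), symmetric] using assms by (intro posdef_invertible posdef_g) auto
  qed
  ultimately show ?thesis by blast
qed

lemma Sf_trace:
  assumes "c \<in> A" "p \<in> cdom c" "t \<in> I"
    and D: "((\<lambda>s. g s c (cmap c p)) has_vector_derivative D) (at t within I)"
  shows "Sf t p = - (1 / 2) * metric_trace (g t c (cmap c p)) D"
proof -
  let ?c = "chart_at A p" and ?d = "chart_at B (\<phi> t p)"
  note c = chart_at_in[OF atlas(1), of p] and d = chart_at_in[OF atlas(2), of "\<phi> t p"]
  obtain D' where D': "((\<lambda>s. g s ?c (cmap ?c p)) has_vector_derivative D') (at t within I)"
      "metric_trace (g t ?c (cmap ?c p)) D' = metric_trace (g t c (cmap c p)) D"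
    using derivative_transform[OF c(1) assms(1) _ assms(3) D] c assms by auto
  have "\<phi> t (cinv ?c (cmap ?c p)) \<in> cdom ?d"
    using cinv_cmap[OF atlas(1) c] d by simp
  from flow_trace[OF c(1) d(1) assms(3) imageI[OF c(2)] this D'(1)] show ?thesis
    unfolding Sf_def scalar_curvature_def grad_norm_sq_def Let_def D'(2) .
qed

text \<open>The time derivative taken from the joint space-time derivative, whose continuity up to
  time 0 is part of smoothness of the family. Thus \<open>S\<close> is continuous there without a
  study of how the curvature depends on time.\<close>

definition gdot :: "('p, 'm) chart \<Rightarrow> real \<Rightarrow> real^'m \<Rightarrow> real^'m^'m" where
  "gdot c t u = frechet_derivative (\<lambda>(t, u). g t c u) (at (t, u) within I \<times> cran c) (1, 0)"

lemma has_gdot: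
  assumes "c \<in> A" "t \<in> I" "u \<in> cran c"
  shows "((\<lambda>s. g s c u) has_vector_derivative gdot c t u) (at t within I)"
proof -
  have "(\<lambda>(t, u). g t c u) differentiable (at (t, u) within I \<times> cran c)"
  proof -
    have "Ck_on (Suc 0) (I \<times> cran c) (\<lambda>(t, u). g t c u)"
      using smooth_g[OF assms(1)] unfolding smooth_on_def by blast
    then show ?thesis
      unfolding Ck_on.simps differentiable_on_def using assms by blast
  qed
  then have L: "((\<lambda>(t, u). g t c u) has_derivative frechet_derivative (\<lambda>(t, u). g t c u) (at (t, u) within I \<times> cran c))
      (at (t, u) within I \<times> cran c)"
    by (simp add: frechet_derivative_works)
  define L where "L = frechet_derivative (\<lambda>(t, u). g t c u) (at (t, u) within I \<times> cran c)"
  have line: "((\<lambda>s. (s, u)) has_derivative (\<lambda>r. (r, 0))) (at t within I)"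
    by (auto intro!: derivative_eq_intros)
  have "(\<lambda>s. (s, u)) ` I \<subseteq> I \<times> cran c"
    using assms by auto
  from has_derivative_in_compose[OF line has_derivative_subset[OF L this]]
  have D: "((\<lambda>s. g s c u) has_derivative (\<lambda>r. L (r, 0))) (at t within I)"
    by (simp add: L_def)
  have "(\<lambda>r. L (r, 0)) = (\<lambda>r. r *\<^sub>R L (1, 0))"
  proof
    show "L (r, 0) = r *\<^sub>R L (1, 0)" for r
      using linear_scale[OF has_derivative_linear[OF L], of r "(1, 0)"] by (simp add: L_def)
  qed
  from D[unfolded this] show ?thesis
    by (simp add: has_vector_derivative_def gdot_def L_def)
qed

lemma gdot_continuous: "c \<in> A \<Longrightarrow> continuous_on (I \<times> cran c) (\<lambda>(t, u). gdot c t u)"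
proof -
  assume "c \<in> A"
  then have "Ck_on (Suc 0) (I \<times> cran c) (\<lambda>(t, u). g t c u)"
    using smooth_g unfolding smooth_on_def by blast
  moreover have "(1, 0) \<in> (Basis :: (real \<times> (real^'m)) set)"
    by (simp add: Basis_prod_def)
  ultimately have "continuous_on (I \<times> cran c) (\<lambda>x. frechet_derivative (\<lambda>(t, u). g t c u) (at x within I \<times> cran c) (1, 0))"
    by (simp add: Ck_on.simps)
  then show ?thesis
    by (simp add: gdot_def case_prod_unfold)
qed


lemma Sf_gdot:
  assumes "c \<in> A" "p \<in> cdom c" "t \<in> I"
  shows "Sf t p = - (1 / 2) * metric_trace (g t c (cmap c p)) (gdot c t (cmap c p))"
  using Sf_trace[OF assms has_gdot] assms by simp

text \<open>In every chart \<open>Sf_gdot\<close> expresses \<open>S\<close> by the inverse metric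
  and \<open>gdot\<close>, both jointly continuous. The fixed chart matters: \<open>chart_at\<close>
  may jump from point to point.\<close>

lemma Sf_continuous: "continuous_on (I \<times> UNIV) (\<lambda>(t, p). Sf t p)"
  unfolding continuous_on_eq_continuous_within
proof
  fix x assume x: "x \<in> I \<times> (UNIV :: 'p set)"
  define c where "c = chart_at A (snd x)"
  have c: "c \<in> A" "snd x \<in> cdom c"
    using chart_at_in[OF atlas(1)] by (simp_all add: c_def)
  have "continuous_on (I \<times> cdom c) (\<lambda>x. cmap c (snd x))"
    by (rule continuous_on_compose2[of "cdom c" "cmap c" _ snd])
      (use charts[OF c(1)] in \<open>auto intro: continuous_on_snd continuous_on_id\<close>)
  then have chart: "continuous_on (I \<times> cdom c) (\<lambda>(t, p). (t, cmap c p))"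
    unfolding case_prod_unfold by (intro continuous_on_Pair continuous_on_fst continuous_on_id)
  have img: "(\<lambda>(t, p). (t, cmap c p)) ` (I \<times> cdom c) \<subseteq> I \<times> cran c"
    by auto
  have "continuous_on (I \<times> cran c) (\<lambda>(t, u). g t c u)"
    using smooth_g[OF c(1)] unfolding smooth_on_def by (auto dest: spec[of _ 0])
  moreover have "invertible ((\<lambda>(t, u). g t c u) y)" if "y \<in> I \<times> cran c" for y
    using that c by (auto intro!: posdef_invertible posdef_g)
  ultimately have "continuous_on (I \<times> cran c) (\<lambda>y. matrix_inv ((\<lambda>(t, u). g t c u) y) $ i $ j)" for i j
    by (intro continuous_on_matrix_inv)
  moreover have "continuous_on (I \<times> cran c) (\<lambda>y. (\<lambda>(t, u). gdot c t u) y $ i $ j)" for i j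
    using gdot_continuous[OF c(1)] by (intro continuous_intros)
  ultimately have "continuous_on (I \<times> cran c) (\<lambda>y. - (1 / 2) * (\<Sum>i\<in>UNIV. \<Sum>j\<in>UNIV.
      matrix_inv ((\<lambda>(t, u). g t c u) y) $ i $ j * (\<lambda>(t, u). gdot c t u) y $ i $ j))"
    by (intro continuous_on_mult continuous_on_const continuous_on_sum)
  from continuous_on_compose2[OF this chart img]
  have "continuous_on (I \<times> cdom c) (\<lambda>(t, p). - (1 / 2) * metric_trace (g t c (cmap c p)) (gdot c t (cmap c p)))"
    by (simp add: metric_trace_def case_prod_unfold)
  then have "continuous_on (I \<times> cdom c) (\<lambda>(t, p). Sf t p)"
    by (rule continuous_on_eq) (auto simp: Sf_gdot[OF c(1)])
  then have "continuous (at x within I \<times> cdom c) (\<lambda>(t, p). Sf t p)"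
    using x c by (cases x) (auto simp: continuous_on_eq_continuous_within)
  moreover have "at x within I \<times> cdom c = at x within I \<times> UNIV"
    using charts[OF c(1)] c(2) by (intro at_within_nhd[of x "UNIV \<times> cdom c"]) (auto simp: open_Times mem_Times_iff)
  ultimately show "continuous (at x within I \<times> UNIV) (\<lambda>(t, p). Sf t p)"
    by simp
qed

section \<open>Positive times and open chart domains in space-time\<close>

definition J :: "real set" where
  "J = {t. 0 < t \<and> t \<in> I}"

lemma J: "open J" "J \<subseteq> I"
  unfolding J_def by (rule time_interval_open) auto

lemma at_J: "t \<in> J \<Longrightarrow> at t within I = at t"
  using J interior_maximal by (intro at_within_interior) blast

text \<open>Restricting to positive times makes this set open, hence the derivatives in the flow
  equations two-sided and germs available.\<close>

definition Wf :: "('p, 'm) chart \<Rightarrow> ('q, 'n) chart \<Rightarrow> (real \<times> (real^'m)) set" where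
  "Wf c d = {(t, u). t \<in> J \<and> u \<in> cran c \<and> \<phi> t (cinv c u) \<in> cdom d}"

lemma Wf_open:
  assumes "c \<in> A" "d \<in> B"
  shows "open (Wf c d)"
proof -
  have "continuous_on (J \<times> cran c) (\<lambda>x. cinv c (snd x))"
    by (rule continuous_on_compose2[of "cran c" "cinv c" _ snd])
      (use charts[OF assms(1)] in \<open>auto intro: continuous_on_snd continuous_on_id\<close>)
  then have "continuous_on (J \<times> cran c) (\<lambda>(t, u). (t, cinv c u))"
    unfolding case_prod_unfold by (intro continuous_on_Pair continuous_on_fst continuous_on_id)
  then have "continuous_on (J \<times> cran c) (\<lambda>x. (\<lambda>(t, p). \<phi> t p) ((\<lambda>(t, u). (t, cinv c u)) x))"
    by (rule continuous_on_compose2[OF cont_phi]) (use J(2) in auto)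
  moreover have "open (J \<times> cran c)"
    using charts[OF assms(1)] J(1) by (intro open_Times) auto
  ultimately have "open ((J \<times> cran c) \<inter> (\<lambda>x. (\<lambda>(t, p). \<phi> t p) ((\<lambda>(t, u). (t, cinv c u)) x)) -` cdom d)"
    using charts_B[OF assms(2)] by (intro continuous_open_preimage) auto
  also have "(J \<times> cran c) \<inter> (\<lambda>x. (\<lambda>(t, p). \<phi> t p) ((\<lambda>(t, u). (t, cinv c u)) x)) -` cdom d = Wf c d"
    by (auto simp: Wf_def)
  finally show ?thesis .
qed

lemma local_flow_Wf:
  assumes "c \<in> A" "d \<in> B"
  shows "local_flow (Wf c d) (\<lambda>t. g t c) (cran d) (\<gamma> d) (\<lambda>t. local_rep c d (\<phi> t)) \<alpha>"
proof
  show "open (Wf c d)" "open (cran d)"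
    using Wf_open[OF assms] charts_B[OF assms(2)] by auto
  show "smooth_on (Wf c d) (\<lambda>(t, u). g t c u)"
    by (rule smooth_on_subset[OF Wf_open[OF assms] _ smooth_g[OF assms(1)]]) (use J in \<open>auto simp: Wf_def\<close>)
  show "smooth_on (Wf c d) (\<lambda>(t, u). local_rep c d (\<phi> t) u)"
    by (rule smooth_on_subset[OF Wf_open[OF assms] _ smooth_phi[OF assms]]) (use J in \<open>auto simp: Wf_def\<close>)
  show "smooth_on (cran d) (\<gamma> d)"
    using N(2) assms unfolding riemannian_metric_def by blast
  show "posdef (\<gamma> d v)" if "v \<in> cran d" for v
    by (rule riemannian_posdef[OF N(2) assms(2) that])
  fix t u assume tu: "(t, u) \<in> Wf c d"
  then have *: "t \<in> J" "t \<in> I" "u \<in> cran c" "\<phi> t (cinv c u) \<in> cdom d"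
    using J by (auto simp: Wf_def)
  show "posdef (g t c u)"
    using * assms by (intro posdef_g)
  show "local_rep c d (\<phi> t) u \<in> cran d"
    using * by (simp add: local_rep_def)
  show "smooth_near \<alpha> t"
    by (rule smooth_nearI[OF J(1) *(1) smooth_on_subset[OF J smooth_\<alpha>]])
  show "((\<lambda>s. g s c u) has_vector_derivative (- 2) *\<^sub>R ricci (g t c) u
           + (2 * \<alpha> t) *\<^sub>R grad_tensor (\<gamma> d) (local_rep c d (\<phi> t)) u) (at t)"
    "((\<lambda>s. local_rep c d (\<phi> s) u) has_vector_derivative
           tension (g t c) (\<gamma> d) (local_rep c d (\<phi> t)) u) (at t)"
    using flow_eqs[OF assms *(2-4)] unfolding at_J[OF *(1)] .
qed

lemma \<alpha>_deriv_nonpos: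
  assumes "t \<in> J"
  shows "frechet_derivative \<alpha> (at t) 1 \<le> 0"
proof (rule ccontr)
  assume neg: "\<not> ?thesis"
  have near: "smooth_near \<alpha> t"
    by (rule smooth_nearI[OF J(1) assms smooth_on_subset[OF J smooth_\<alpha>]])
  note d = smooth_near_derivative[OF near]
  define k where "k = frechet_derivative \<alpha> (at t) 1"
  have "frechet_derivative \<alpha> (at t) = (\<lambda>r. k * r)"
  proof
    show "frechet_derivative \<alpha> (at t) r = k * r" for r
      using linear_scale[OF has_derivative_linear[OF d], of r 1] by (simp add: k_def)
  qed
  from d[unfolded this] have "(\<alpha> has_real_derivative k) (at t)"
    unfolding has_field_derivative_def .
  then obtain e where e: "0 < e" "\<And>h. 0 < h \<Longrightarrow> h < e \<Longrightarrow> \<alpha> t < \<alpha> (t + h)"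
    using DERIV_pos_inc_right[of \<alpha> k t] neg by (auto simp: k_def)
  obtain b where b: "0 < b" "ball t b \<subseteq> J"
    using J(1) assms openE by blast
  define h where "h = min e b / 2"
  have h: "0 < h" "h < e" "h < b"
    using e(1) b(1) by (auto simp: h_def)
  then have "t + h \<in> I" "t \<in> I"
    using b(2) assms J(2) by (auto simp: dist_real_def subset_iff)
  then have "\<alpha> (t + h) \<le> \<alpha> t"
    using \<alpha>_mono h(1) by (auto simp: monotone_on_def)
  then show False
    using e(2)[OF h(1,2)] by simp
qed

text \<open>Both sides are minus half the metric trace of the time derivative of the metric, so the
  minimum of the global function can be examined in any pair of charts.\<close>

lemma Sf_local:
  assumes "c \<in> A" "d \<in> B" "z \<in> Wf c d"
  shows "local_flow.Sfun (\<lambda>t. g t c) (\<gamma> d) (\<lambda>t. local_rep c d (\<phi> t)) \<alpha> z = Sf (fst z) (cinv c (snd z))"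
proof -
  interpret l: local_flow "Wf c d" "\<lambda>t. g t c" "cran d" "\<gamma> d" "\<lambda>t. local_rep c d (\<phi> t)" \<alpha>
    by (rule local_flow_Wf[OF assms(1,2)])
  obtain t u where z: "z = (t, u)" "t \<in> I" "u \<in> cran c" "\<phi> t (cinv c u) \<in> cdom d"
    using assms(3) J(2) by (auto simp: Wf_def)
  note u = cinv_cran[OF atlas(1) assms(1) z(3)]
  have "Sf t (cinv c u) = - (1 / 2) * metric_trace (g t c u) (gdot c t u)"
    using Sf_gdot[OF assms(1) u(1) z(2)] by (simp add: u(2))
  also have "\<dots> = local_scalar (g t c) u - \<alpha> t * metric_trace (g t c u) (grad_tensor (\<gamma> d) (local_rep c d (\<phi> t)) u)"
    using flow_trace[OF assms(1,2) z(2-4) has_gdot] assms z by simp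
  also have "\<dots> = l.Sfun z"
    by (simp add: l.Sfun_def l.hi_def l.sc_def z local_scalar_def metric_trace_def right_diff_distrib sum_subtractf
        sum_distrib_left mult_ac)
  finally show ?thesis
    by (simp add: z)
qed

text \<open>At a minimum of \<open>S + e t\<close> over [0,t1] x M with positive time, spatial
  minimality forces \<partial>_t S >= 0, while comparison with earlier times forces \<partial>_t S
  <= -e. So the minimum lies at time 0, which is incompatible with a later value below the initial
  minimum.\<close>

lemma Sf_lower_bound: "\<exists>C. \<forall>t\<in>I. \<forall>p. C \<le> Sf t p"
proof -
  have I0: "0 \<in> I"
    using T by (simp add: time_interval_def zero_ereal_def)
  have comp: "compact (UNIV :: 'p set)"
    using M by (simp add: closed_manifold_def)
  have "continuous_on UNIV (\<lambda>p. (\<lambda>(t, p). Sf t p) (0, p))"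
    by (rule continuous_on_compose2[OF Sf_continuous]) (use I0 in \<open>auto intro!: continuous_intros\<close>)
  then obtain p0 where p0: "\<And>p. Sf 0 p0 \<le> Sf 0 p"
    using continuous_attains_inf[OF comp, of "\<lambda>p. Sf 0 p"] by auto
  have "Sf 0 p0 \<le> Sf t1 p1" if t1: "t1 \<in> I" for t1 p1
  proof (rule ccontr)
    assume "\<not> ?thesis"
    then have less: "Sf t1 p1 < Sf 0 p0" by simp
    \<comment> \<open>Small enough that \<open>e * t1\<close> stays below the supposed drop;
      \<open>t1 + 1\<close> keeps the denominator positive even for \<open>t1 = 0\<close>.\<close>
    define e where "e = (Sf 0 p0 - Sf t1 p1) / (2 * (t1 + 1))"
    have t1': "0 \<le> t1"
      using t1 by (simp add: time_interval_def)
    have e: "0 < e" "e * t1 < Sf 0 p0 - Sf t1 p1"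
    proof -
      show e0: "0 < e" using less t1' by (simp add: e_def)
      have "e * (2 * (t1 + 1)) = Sf 0 p0 - Sf t1 p1"
        using t1' by (simp add: e_def)
      moreover have "e * (2 * (t1 + 1)) = 2 * (e * t1) + 2 * e"
        by (simp add: algebra_simps)
      moreover have "0 \<le> e * t1"
        using e0 t1' by simp
      ultimately show "e * t1 < Sf 0 p0 - Sf t1 p1"
        using e0 by linarith
    qed
    have sub: "{0..t1} \<subseteq> I"
      using t1 by (auto simp: time_interval_def intro: le_less_trans[of _ "ereal t1"])
    have "continuous_on ({0..t1} \<times> UNIV) (\<lambda>x. (\<lambda>(t, p). Sf t p) x + e * fst x)"
      using sub by (intro continuous_intros continuous_on_subset[OF Sf_continuous]) auto
    moreover have "compact ({0..t1} \<times> (UNIV :: 'p set))"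
      by (intro compact_Times comp compact_Icc)
    moreover have "{0..t1} \<times> (UNIV :: 'p set) \<noteq> {}"
      using t1' by auto
    ultimately obtain x where x: "x \<in> {0..t1} \<times> UNIV"
      "\<And>y. y \<in> {0..t1} \<times> UNIV \<Longrightarrow> (\<lambda>(t, p). Sf t p) x + e * fst x \<le> (\<lambda>(t, p). Sf t p) y + e * fst y"
      using continuous_attains_inf[of "{0..t1} \<times> (UNIV :: 'p set)" "\<lambda>x. (\<lambda>(t, p). Sf t p) x + e * fst x"] by blast
    obtain t p where tp: "x = (t, p)" "t \<in> {0..t1}"
      using x(1) by auto
    have min: "Sf t p + e * t \<le> Sf s q + e * s" if "s \<in> {0..t1}" for s q
      using x(2)[of "(s, q)"] that by (simp add: tp)
    \<comment> \<open>A minimum at time 0 would give an initial value at most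
      \<open>Sf t1 p1 + e * t1\<close>, which lies below \<open>Sf 0 p0\<close>.\<close>
    have "t \<noteq> 0"
    proof
      assume "t = 0"
      then have "Sf 0 p \<le> Sf t1 p1 + e * t1"
        using min[of t1 p1] t1' by simp
      then show False
        using e(2) p0[of p] by simp
    qed
    then have t: "t \<in> J"
      using tp(2) sub by (auto simp: J_def)
    define c d where "c = chart_at A p" and "d = chart_at B (\<phi> t p)"
    have c: "c \<in> A" "p \<in> cdom c" and d: "d \<in> B" "\<phi> t p \<in> cdom d"
      by (simp_all add: c_def d_def chart_at_in atlas)
    interpret l: local_flow "Wf c d" "\<lambda>t. g t c" "cran d" "\<gamma> d" "\<lambda>t. local_rep c d (\<phi> t)" \<alpha>
      by (rule local_flow_Wf[OF c(1) d(1)])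
    define u where "u = cmap c p"
    have u: "cinv c u = p"
      by (simp add: u_def cinv_cmap[OF atlas(1) c])
    have z: "(t, u) \<in> Wf c d"
      using t c d by (simp add: Wf_def u) (simp add: u_def)
    have S: "l.Sfun y = Sf (fst y) (cinv c (snd y))" if "y \<in> Wf c d" for y
      by (rule Sf_local[OF c(1) d(1) that])
    obtain W1 W2 where W12: "open W1" "open W2" "(t, u) \<in> W1 \<times> W2" "W1 \<times> W2 \<subseteq> Wf c d"
      using open_prod_elim[OF l.W z] by blast
    have "\<forall>w\<in>W2. l.Sfun (t, u) \<le> l.Sfun (t, w)"
    proof
      fix w assume "w \<in> W2"
      then have "(t, w) \<in> Wf c d"
        using W12 by blast
      then show "l.Sfun (t, u) \<le> l.Sfun (t, w)"
        using min[OF tp(2), of "cinv c w"] by (simp add: S[OF z] S u)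
    qed
    then have "\<forall>\<^sub>F w in nhds (snd (t, u)). l.Sfun (t, u) \<le> l.Sfun (fst (t, u), w)"
      using W12 unfolding eventually_nhds by auto
    moreover have "0 \<le> \<alpha> (fst (t, u))" "frechet_derivative \<alpha> (at (fst (t, u))) 1 \<le> 0"
      using \<alpha>_nonneg \<alpha>_deriv_nonpos[OF t] t J(2) by auto
    ultimately have D0: "0 \<le> frechet_derivative l.Sfun (at (t, u)) (1, 0)"
      by (intro l.time_derivative_at_min[OF z])
    define L where "L = frechet_derivative l.Sfun (at (t, u))"
    have L: "(l.Sfun has_derivative L) (at (t, u))"
      unfolding L_def by (rule smooth_near_derivative[OF l.Sfun_near[OF z]])
    have D: "((\<lambda>r. l.Sfun (r, u)) has_derivative (\<lambda>r. L (r, 0))) (at t)"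
      by (rule has_derivative_along[where z="\<lambda>r. (r, u)", OF L]) (auto intro!: derivative_eq_intros)
    have "(\<lambda>r. L (r, 0)) = (\<lambda>r. L (1, 0) * r)"
    proof
      show "L (r, 0) = L (1, 0) * r" for r
        using linear_scale[OF has_derivative_linear[OF L], of r "(1, 0)"] by simp
    qed
    from D[unfolded this] have "((\<lambda>r. l.Sfun (r, u)) has_real_derivative L (1, 0)) (at t)"
      by (simp add: has_field_derivative_def)
    then have "((\<lambda>r. l.Sfun (r, u) + e * r) has_real_derivative L (1, 0) + e) (at t)"
      by (auto intro!: derivative_eq_intros)
    moreover have "0 < L (1, 0) + e"
      using D0 e(1) by (simp add: L_def)
    ultimately obtain b where b: "0 < b" "\<And>h. 0 < h \<Longrightarrow> h < b \<Longrightarrow> l.Sfun (t - h, u) + e * (t - h) < l.Sfun (t, u) + e * t"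
      using DERIV_pos_inc_left by blast
    obtain b' where b': "0 < b'" "ball t b' \<subseteq> W1"
      using W12 openE by blast
    \<comment> \<open>The step back in time must keep the sign from \<open>b\<close>, remain in the
      chart domain (\<open>b'\<close>), and not pass time 0 (\<open>t\<close>).\<close>
    define h where "h = min (min b b') t / 2"
    have h: "0 < h" "h < b" "h < b'" "h < t"
      using b(1) b'(1) t by (auto simp: h_def J_def)
    then have "t - h \<in> W1"
      using b'(2) by (auto simp: dist_real_def subset_iff)
    then have "(t - h, u) \<in> Wf c d"
      using W12 by blast
    then have "Sf (t - h) p + e * (t - h) < Sf t p + e * t"
      using b(2)[OF h(1,2)] by (simp add: S[OF z] S u)
    moreover have "t - h \<in> {0..t1}"
      using h tp(2) by auto
    ultimately show False
      using min[of "t - h" p] by simp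
  qed
  then show ?thesis by blast
qed

end

text \<open>Singularity appears in a strong form: the norm of the curvature tensor is unbounded
  along the given points \<open>x k\<close> themselves. It follows from R \<rightarrow> \<infinity>
  because |R| is at most the dimension times that norm.\<close>

theorem corollary5p3:
  fixes A :: "('p::t2_space, 'm::finite) chart set"
    and B :: "('q::t2_space, 'n::finite) chart set"
    and \<gamma> :: "('q, 'n) metric"
    and T :: ereal
    and \<alpha> :: "real \<Rightarrow> real" and \<alpha>_low :: real
    and g :: "real \<Rightarrow> ('p, 'm) metric"
    and \<phi> :: "real \<Rightarrow> 'p \<Rightarrow> 'q"
    and x :: "nat \<Rightarrow> 'p" and t :: "nat \<Rightarrow> real"
  assumes M: "closed_manifold A"
    and N: "closed_manifold B" "riemannian_metric B \<gamma>"
    and T: "0 < T"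
    and flow: "RH_flow A B \<gamma> (time_interval T) \<alpha> g \<phi>"
    and \<alpha>_mono: "antimono_on (time_interval T) \<alpha>"
    and \<alpha>_low: "0 < \<alpha>_low" "\<And>s. s \<in> time_interval T \<Longrightarrow> \<alpha>_low \<le> \<alpha> s"
    and t: "\<And>k. t k \<in> time_interval T" "incseq t" "(\<lambda>k. ereal (t k)) \<longlonglongrightarrow> T"
    and grad: "filterlim (\<lambda>k. grad_norm_sq A B \<gamma> (g (t k)) (\<phi> (t k)) (x k)) at_top sequentially"
  shows "filterlim (\<lambda>k. scalar_curvature A (g (t k)) (x k)) at_top sequentially \<and>
         \<not> bounded (range (\<lambda>k. riemann_norm A (g (t k)) (x k)))"
proof -
  interpret flow A B \<gamma> T \<alpha> g \<phi>
    using M N T flow \<alpha>_mono \<alpha>_low by unfold_locales (auto intro: order_trans[OF less_imp_le])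
  let ?e = "\<lambda>k. grad_norm_sq A B \<gamma> (g (t k)) (\<phi> (t k)) (x k)"
  let ?R = "\<lambda>k. scalar_curvature A (g (t k)) (x k)"
  obtain C where C: "\<And>s p. s \<in> time_interval T \<Longrightarrow> C \<le> Sf s p"
    using Sf_lower_bound by blast
  have "filterlim (\<lambda>k. C + \<alpha>_low * ?e k) at_top sequentially"
    using \<alpha>_low(1) grad
    by (intro filterlim_tendsto_add_at_top[OF tendsto_const] filterlim_tendsto_pos_mult_at_top[OF tendsto_const])
  \<comment> \<open>That |\<nabla>\<phi>|^2 is nonnegative is read off from its divergence, so
    replacing \<alpha> by its lower bound is justified for large \<open>k\<close>.\<close>
  moreover have "\<forall>\<^sub>F k in sequentially. C + \<alpha>_low * ?e k \<le> ?R k"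
  proof -
    have "\<forall>\<^sub>F k in sequentially. 0 \<le> ?e k"
      using grad by (simp add: filterlim_at_top)
    then show ?thesis
    proof (rule eventually_mono)
      fix k assume "0 \<le> ?e k"
      then have "\<alpha>_low * ?e k \<le> \<alpha> (t k) * ?e k"
        using \<alpha>_low(2)[OF t(1)] by (rule mult_right_mono[rotated])
      then show "C + \<alpha>_low * ?e k \<le> ?R k"
        using C[OF t(1), of k "x k"] by (simp add: Sf_def)
    qed
  qed
  ultimately have R: "filterlim ?R at_top sequentially"
    by (rule filterlim_at_top_mono)
  moreover have "\<not> bounded (range (\<lambda>k. riemann_norm A (g (t k)) (x k)))"
  proof
    assume "bounded (range (\<lambda>k. riemann_norm A (g (t k)) (x k)))"
    then obtain b where b: "\<And>k. \<bar>riemann_norm A (g (t k)) (x k)\<bar> \<le> b"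
      by (auto simp: bounded_iff)
    have "?R k \<le> real CARD('m) * b" for k
    proof -
      note c = chart_at_in[OF atlas(1), of "x k"]
      have "\<bar>?R k\<bar> \<le> real CARD('m) * riemann_norm A (g (t k)) (x k)"
        unfolding scalar_curvature_def riemann_norm_def Let_def
        by (intro local_scalar_bound posdef_g t(1) c imageI)
      also have "\<dots> \<le> real CARD('m) * b"
        using b[of k] by (intro mult_left_mono) auto
      finally show ?thesis by simp
    qed
    moreover have "\<forall>\<^sub>F k in sequentially. real CARD('m) * b < ?R k"
      using R by (simp add: filterlim_at_top_dense)
    ultimately show False
      by (metis (mono_tags, lifting) eventually_sequentially not_le order_refl)
  qed
  ultimately show ?thesis ..
qed

end
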